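(* Let $M$ be a simple ternary matroid that is not a ternary comatroid but such that $M|F$ is a ternary comatroid for every proper flat $F$ of $M$, and suppose $r(M)\ge 4$. Then $M$ or $M^c$ has a cocircuit of size less than four.
   Context: All matroids are simple. Every simple ternary matroid $M$ is uniquely $GF(3)$-representable, so for $k\ge r(M)$ one can write $M\cong PG(k-1,3)|T$, and the $(GF(3),k)$-complement of $M$ is $PG(k-1,3)\backslash T$ (well defined up to isomorphism); $M^c$ denotes the $(GF(3),r(M))$-complement of $M$. Ternary comatroids are defined recursively: $U_{0,0}$ is one; the direct sum of two is one; and the $(GF(3),t)$-complement of one is one for every $t\ge r(M)$. *)

theory Defs
  imports Complex_Main "HOL-Library.Function_Algebras"
begin

section \<open>Matroids\<close>

record 'a pre_matroid =
  ground :: "'a set"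
  indep :: "'a set set"

definition matroid :: "'a pre_matroid \<Rightarrow> bool" where
  "matroid M \<longleftrightarrow> finite (ground M) \<and> indep M \<subseteq> Pow (ground M) \<and> {} \<in> indep M
     \<and> (\<forall>I J. I \<in> indep M \<longrightarrow> J \<subseteq> I \<longrightarrow> J \<in> indep M)
     \<and> (\<forall>I\<in>indep M. \<forall>J\<in>indep M. card I < card J \<longrightarrow> (\<exists>x\<in>J - I. insert x I \<in> indep M))"

definition rank_of :: "'a pre_matroid \<Rightarrow> 'a set \<Rightarrow> nat" where
  "rank_of M X = Max (card ` {I \<in> indep M. I \<subseteq> X})"

definition rank :: "'a pre_matroid \<Rightarrow> nat" where
  "rank M = rank_of M (ground M)"

definition flat :: "'a pre_matroid \<Rightarrow> 'a set \<Rightarrow> bool" where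
  "flat M F \<longleftrightarrow> F \<subseteq> ground M \<and> (\<forall>x\<in>ground M - F. rank_of M F < rank_of M (insert x F))"

definition circuit :: "'a pre_matroid \<Rightarrow> 'a set \<Rightarrow> bool" where
  "circuit M C \<longleftrightarrow> C \<subseteq> ground M \<and> C \<notin> indep M \<and> (\<forall>D. D \<subset> C \<longrightarrow> D \<in> indep M)"

definition basis :: "'a pre_matroid \<Rightarrow> 'a set \<Rightarrow> bool" where
  "basis M B \<longleftrightarrow> B \<in> indep M \<and> (\<forall>I\<in>indep M. B \<subseteq> I \<longrightarrow> I = B)"

text \<open>The bases of the dual are the complements of the bases.\<close>

definition dual :: "'a pre_matroid \<Rightarrow> 'a pre_matroid" where
  "dual M = \<lparr>ground = ground M, indep = {I. \<exists>B. basis M B \<and> I \<subseteq> ground M - B}\<rparr>"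

definition cocircuit :: "'a pre_matroid \<Rightarrow> 'a set \<Rightarrow> bool" where
  "cocircuit M C \<longleftrightarrow> circuit (dual M) C"

text \<open>No loops and no parallel pairs.\<close>

definition simple :: "'a pre_matroid \<Rightarrow> bool" where
  "simple M \<longleftrightarrow> (\<forall>C. circuit M C \<longrightarrow> card C \<ge> 3)"

definition restriction :: "'a pre_matroid \<Rightarrow> 'a set \<Rightarrow> 'a pre_matroid" where
  "restriction M X = \<lparr>ground = ground M \<inter> X, indep = {I \<in> indep M. I \<subseteq> X}\<rparr>"

definition deletion :: "'a pre_matroid \<Rightarrow> 'a set \<Rightarrow> 'a pre_matroid" where
  "deletion M X = restriction M (ground M - X)"

text \<open>Meant for matroids with disjoint ground sets.\<close>

definition direct_sum :: "'a pre_matroid \<Rightarrow> 'a pre_matroid \<Rightarrow> 'a pre_matroid" where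
  "direct_sum M N = \<lparr>ground = ground M \<union> ground N, indep = {I \<union> J |I J. I \<in> indep M \<and> J \<in> indep N}\<rparr>"

definition isomorphic :: "'a pre_matroid \<Rightarrow> 'b pre_matroid \<Rightarrow> bool" where
  "isomorphic M N \<longleftrightarrow> (\<exists>f. bij_betw f (ground M) (ground N) \<and> indep N = (\<lambda>I. f ` I) ` indep M)"


section \<open>Ternary matroids and complements\<close>

type_synonym gf3 = Enum.finite_3

text \<open>
  The space \<open>GF(3)\<^sup>k\<close> is the subspace \<open>gf3_space k\<close> of the space of all
  sequences over the three-element field, so that \<open>k\<close> can vary within one type.
\<close>

type_synonym gf3_vec = "nat \<Rightarrow> gf3"

definition gf3_scale :: "gf3 \<Rightarrow> gf3_vec \<Rightarrow> gf3_vec" where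
  "gf3_scale c v = (\<lambda>i. c * v i)"

global_interpretation gf3: vector_space gf3_scale
  by unfold_locales (auto simp: gf3_scale_def fun_eq_iff algebra_simps)

definition gf3_space :: "nat \<Rightarrow> gf3_vec set" where
  "gf3_space k = {v. \<forall>i\<ge>k. v i = 0}"

text \<open>
  \<open>PG3 k\<close> is the rank-\<open>k\<close> matroid \<open>PG(k-1,3)\<close>: its elements
  are the one-dimensional subspaces of \<open>GF(3)\<^sup>k\<close>, and the independent sets of them
  are the sets of lines spanned by the members of linearly independent sets of vectors.
\<close>

definition PG3 :: "nat \<Rightarrow> gf3_vec set pre_matroid" where
  "PG3 k = \<lparr>ground = {gf3.span {v} |v. v \<in> gf3_space k \<and> v \<noteq> 0},
     indep = {(\<lambda>v. gf3.span {v}) ` X |X. X \<subseteq> gf3_space k \<and> gf3.independent X}\<rparr>"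

definition ternary :: "'a pre_matroid \<Rightarrow> bool" where
  "ternary M \<longleftrightarrow> (\<exists>k f. f ` ground M \<subseteq> gf3_space k
     \<and> (\<forall>I\<subseteq>ground M. I \<in> indep M \<longleftrightarrow> inj_on f I \<and> gf3.independent (f ` I)))"

text \<open>
  \<open>is_complement k M N\<close>: \<open>N\<close> is (up to isomorphism) the \<open>(GF(3),k)\<close>-complement
  of \<open>M\<close>. In particular, \<open>is_complement (rank M) M N\<close> says that \<open>N\<close> is \<open>M\<^sup>c\<close>.
\<close>

definition is_complement :: "nat \<Rightarrow> 'a pre_matroid \<Rightarrow> 'b pre_matroid \<Rightarrow> bool" where
  "is_complement k M N \<longleftrightarrow> (\<exists>T\<subseteq>ground (PG3 k).
     isomorphic (restriction (PG3 k) T) M \<and> isomorphic (deletion (PG3 k) T) N)"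

text \<open>
  The recursion has to take place within one type; every finite matroid has an isomorphic
  copy on a set of natural numbers.
\<close>

inductive nat_comatroid :: "nat pre_matroid \<Rightarrow> bool" where
  U00: "nat_comatroid \<lparr>ground = {}, indep = {{}}\<rparr>"
| direct_sum: "nat_comatroid M \<Longrightarrow> nat_comatroid N \<Longrightarrow> ground M \<inter> ground N = {} \<Longrightarrow>
    nat_comatroid (direct_sum M N)"
| complement: "nat_comatroid M \<Longrightarrow> rank M \<le> t \<Longrightarrow> is_complement t M N \<Longrightarrow> nat_comatroid N"
| isomorphic: "nat_comatroid M \<Longrightarrow> isomorphic M N \<Longrightarrow> nat_comatroid N"

definition ternary_comatroid :: "'a pre_matroid \<Rightarrow> bool" where
  "ternary_comatroid M \<longleftrightarrow> (\<exists>N. nat_comatroid N \<and> isomorphic N M)"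

end

theory Submission
  imports Defs
begin

text \<open>
  Colour the points of \<open>M\<close> red and the other points of the projective space green, and call a set of
  points split in a subspace \<open>U\<close> if it is covered by two disjoint proper subspaces of \<open>U\<close>, that is,
  if it is disconnected or does not span \<open>U\<close>. In a comatroid one of the two colours is split in every
  subspace of dimension at least two. For the minimal non-comatroid \<open>M\<close> this holds in every proper
  subspace, while neither colour is split in the whole space.

  If every hyperplane splits red, then a maximal proper subspace \<open>A\<close> in which red is not split has
  codimension at least two, and the red points outside \<open>A\<close> form, modulo \<open>A\<close>, little more than a
  circuit; some hyperplane misses at most three of them. Otherwise both kinds of hyperplanes occur.
  A hyperplane of one kind contains at most one codimension-two subspace of the other kind, and then
  it has at most one point of its colour outside that subspace. Hence, if no hyperplane misses at
  most three points of a colour, every pencil contains two hyperplanes of its own kind, which is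
  impossible in dimension at least five. In dimension four, where a line can be of both kinds,
  the sizes of the parallel plane sections of the at most twelve red points outside a hyperplane
  are too unevenly distributed for the second moment that double counting gives them.
\<close>

section \<open>Vector spaces over the field with three elements\<close>

text \<open>Neither colour of the minimal \<open>M\<close> is split in the whole space, because both
  closure operations apply: a split of red would make \<open>M\<close> a direct sum of restrictions
  to proper flats, and a split of green would do the same for the complement, which could then be
  complemented back. For comatroids, splitting is proved by induction over the recursion. The
  obstacle is that a complement is formed in one embedding, while direct sums and flats make the
  claim necessary for every embedding; the missing piece of unique representability comes from
  spanning circuits. A hyperplane missing few points of a colour yields the small cocircuit, since
  the missed elements are codependent. From dimension three on, counting forbids that both colours
  are split; a line with two red and two green points shows that this fails in dimension two, so
  codimension two behaves well only from dimension five on. Dimensions appear as cardinalities: 3, 9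
  and 27 vectors form a point, a line and a plane of the projective space, and
  \<open>card U = 3 * card W\<close> says that \<open>W\<close> is a hyperplane of
  \<open>U\<close>.\<close>

declare zero_finite_3_def [simp del] one_finite_3_def [simp del] two_finite_3 [simp del]

lemma gf3_cases: "(c = 0 \<Longrightarrow> P) \<Longrightarrow> (c = 1 \<Longrightarrow> P) \<Longrightarrow> (c = -1 \<Longrightarrow> P) \<Longrightarrow> P" for c :: gf3
  by (cases c) (simp_all add: zero_finite_3_def one_finite_3_def uminus_finite_3_def)

lemma gf3_add_self: "c + c = - c" for c :: gf3
  by (cases c) (simp_all add: zero_finite_3_def one_finite_3_def uminus_finite_3_def plus_finite_3_def)

lemma gf3_one_neq_minus_one [simp]: "(1 :: gf3) \<noteq> - 1" "(-1 :: gf3) \<noteq> 1"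
  by (simp_all add: one_finite_3_def uminus_finite_3_def)

lemma UNIV_gf3: "(UNIV :: gf3 set) = {0, 1, -1}"
  using gf3_cases by blast

lemma card_UNIV_gf3 [simp]: "card (UNIV :: gf3 set) = 3"
  unfolding UNIV_gf3 by simp

lemma gf3_numerals [simp]: "(2 :: gf3) = -1" "(3 :: gf3) = 0"
proof -
  show two: "(2 :: gf3) = -1" by (metis gf3_add_self one_add_one)
  have "(3 :: gf3) = 2 + 1" by simp
  then show "(3 :: gf3) = 0" unfolding two by simp
qed

lemma gf3_mult_self: "c \<noteq> 0 \<Longrightarrow> c * c = 1" for c :: gf3
  by (cases c rule: gf3_cases) simp_all

lemma gf3_neq_imp_minus: "a \<noteq> 0 \<Longrightarrow> b \<noteq> 0 \<Longrightarrow> a \<noteq> b \<Longrightarrow> b = - a" for a b :: gf3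
  by (cases a rule: gf3_cases; cases b rule: gf3_cases) simp_all

lemma vec_add_self: "v + v = - v" for v :: gf3_vec
  by (simp only: fun_eq_iff plus_fun_apply gf3_add_self uminus_apply simp_thms)

lemma vec_add_add_self: "v + (v + w) = w - v" for v w :: gf3_vec
  by (metis add.assoc vec_add_self add.commute diff_conv_add_uminus)

lemma vec_eq_minus_self [simp]: "v = - v \<longleftrightarrow> v = 0" "- v = v \<longleftrightarrow> v = 0" for v :: gf3_vec
  by (metis add_cancel_right_right neg_0_equal_iff_equal vec_add_self)+

lemma scale_gf3 [simp]: "gf3_scale 0 v = 0" "gf3_scale 1 v = v" "gf3_scale (-1) v = - v"
  by (simp_all only: gf3_scale_def fun_eq_iff mult_zero_left mult_1_left mult_minus_left
      zero_fun_apply uminus_apply simp_thms)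

text \<open>Closure under scalars is automatic: they are 0, 1 and -1, and
  \<open>- x = x + x\<close>.\<close>

lemma subspace_gf3_iff: "gf3.subspace S \<longleftrightarrow> 0 \<in> S \<and> (\<forall>x\<in>S. \<forall>y\<in>S. x + y \<in> S)"
proof
  assume *: "0 \<in> S \<and> (\<forall>x\<in>S. \<forall>y\<in>S. x + y \<in> S)"
  show "gf3.subspace S"
  proof (rule gf3.subspaceI)
    fix c x assume "x \<in> S"
    then have "- x \<in> S" using * vec_add_self by metis
    with \<open>x \<in> S\<close> * show "gf3_scale c x \<in> S" by (cases c rule: gf3_cases) auto
  qed (use * in auto)
qed (auto simp: gf3.subspace_0 gf3.subspace_add)

lemma subspace_neg_iff: "gf3.subspace S \<Longrightarrow> - x \<in> S \<longleftrightarrow> x \<in> S"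
  by (metis gf3.subspace_neg minus_minus)

lemma span_single_gf3: "gf3.span {v} = {0, v, - v}"
  unfolding gf3.span_singleton UNIV_gf3 by auto

lemma span_insert_gf3:
  assumes "gf3.subspace A"
  shows "gf3.span (insert x A) = A \<union> (+) x ` A \<union> (+) (- x) ` A"
proof -
  have A: "gf3.span A = A" using assms by simp
  have "y \<in> gf3.span (insert x A) \<longleftrightarrow> y \<in> A \<or> y - x \<in> A \<or> y + x \<in> A" for y
  proof -
    have "(\<exists>k. y - gf3_scale k x \<in> A) \<longleftrightarrow>
        y - gf3_scale 0 x \<in> A \<or> y - gf3_scale 1 x \<in> A \<or> y - gf3_scale (-1) x \<in> A"
      using gf3_cases by metis
    then show ?thesis unfolding gf3.span_breakdown_eq A by simp
  qed
  moreover have "y - x \<in> A \<longleftrightarrow> y \<in> (+) x ` A" "y + x \<in> A \<longleftrightarrow> y \<in> (+) (- x) ` A" for y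
  proof -
    have "y - x \<in> A \<longleftrightarrow> y \<in> (+) x ` A" for x y :: gf3_vec
    proof
      assume "y - x \<in> A"
      then show "y \<in> (+) x ` A" by (intro image_eqI[of _ _ "y - x"]) simp
    qed auto
    from this this[of y "- x"] show "y - x \<in> A \<longleftrightarrow> y \<in> (+) x ` A" "y + x \<in> A \<longleftrightarrow> y \<in> (+) (- x) ` A"
      by (simp_all add: add.commute)
  qed
  ultimately show ?thesis by auto
qed

section \<open>Cardinalities in place of dimensions\<close>

text \<open>Addition is injective on pairs, since two equal sums would differ by a vector of the
  trivial meet.\<close>

lemma card_subspace_sum_le:
  assumes "gf3.subspace A" "gf3.subspace B" "gf3.subspace U" "A \<subseteq> U" "B \<subseteq> U" "finite U" "A \<inter> B = {0}"
  shows "card A * card B \<le> card U"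
proof -
  have "inj_on (\<lambda>(a, b). a + b) (A \<times> B)"
  proof (rule inj_onI; clarify)
    fix a b a' b' assume h: "a \<in> A" "b \<in> B" "a' \<in> A" "b' \<in> B" "a + b = a' + b'"
    then have eq: "a - a' = b' - b" by (metis add_diff_cancel add.commute add_diff_eq diff_diff_eq2)
    moreover have "a - a' \<in> A" "b' - b \<in> B" using h assms by (auto simp: gf3.subspace_diff)
    ultimately have "a - a' \<in> A \<inter> B" by simp
    then have "a - a' = 0" unfolding assms(7) by simp
    with eq have "a - a' = 0" "b' - b = 0" by simp_all
    then show "a = a' \<and> b = b'" by auto
  qed
  then have "card A * card B = card ((\<lambda>(a, b). a + b) ` (A \<times> B))"
    by (simp add: card_image card_cartesian_product)
  also have "\<dots> \<le> card U"
    using assms by (intro card_mono) (auto simp: gf3.subspace_add subset_eq)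
  finally show ?thesis .
qed

lemma card_span_insert:
  assumes "gf3.subspace A" "finite A" "x \<notin> A"
  shows "finite (gf3.span (insert x A))" "card (gf3.span (insert x A)) = 3 * card A"
proof -
  have nx: "- x \<notin> A" using assms subspace_neg_iff by blast
  have disj: "A \<inter> (+) y ` A = {}" if "y \<notin> A" for y
  proof -
    have "y + a \<notin> A" if "a \<in> A" for a
      using \<open>y \<notin> A\<close> that gf3.subspace_diff[OF assms(1), of "y + a" a] by auto
    then show ?thesis by auto
  qed
  have 1: "A \<inter> (+) x ` A = {}" "A \<inter> (+) (- x) ` A = {}" "(+) x ` A \<inter> (+) (- x) ` A = {}"
  proof -
    show "A \<inter> (+) x ` A = {}" "A \<inter> (+) (- x) ` A = {}" using disj[OF assms(3)] disj[OF nx] by blast+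
    show "(+) x ` A \<inter> (+) (- x) ` A = {}"
    proof -
      have "x + a \<noteq> - x + b" if "a \<in> A" "b \<in> A" for a b
      proof
        assume "x + a = - x + b"
        then have "b = x + (x + a)" by (metis add.assoc add.left_inverse add_0 add.right_inverse)
        then have "- x = b - a" by (simp add: vec_add_add_self)
        then show False using nx that assms(1) gf3.subspace_diff by metis
      qed
      then show ?thesis by auto
    qed
  qed
  show "finite (gf3.span (insert x A))" using assms by (simp add: span_insert_gf3)
  have "card (A \<union> (+) x ` A \<union> (+) (- x) ` A) = card A + card ((+) x ` A) + card ((+) (- x) ` A)"
    using 1 assms(2) by (subst card_Un_disjoint; auto)+
  also have "\<dots> = 3 * card A" by (simp add: card_image)
  finally show "card (gf3.span (insert x A)) = 3 * card A"
    using assms by (simp add: span_insert_gf3)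
qed

lemma card_proper_subspace_le:
  assumes "gf3.subspace A" "gf3.subspace U" "A \<subset> U" "finite U"
  shows "3 * card A \<le> card U"
proof -
  obtain x where x: "x \<in> U" "x \<notin> A" using assms by auto
  have "gf3.span (insert x A) \<subseteq> U" using assms x by (intro gf3.span_minimal) auto
  then have "card (gf3.span (insert x A)) \<le> card U" using assms by (intro card_mono)
  moreover have "finite A" using assms finite_subset by auto
  ultimately show ?thesis using card_span_insert[OF assms(1) _ x(2)] by simp
qed

text \<open>Each of two proper inclusions would cost a factor three, and only one factor is
  available.\<close>

lemma index3_maximal:
  assumes "gf3.subspace A" "gf3.subspace C" "gf3.subspace U" "A \<subseteq> C" "C \<subseteq> U" "finite U" "card U = 3 * card A"
  shows "C = A \<or> C = U"
proof (rule ccontr)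
  assume "\<not> ?thesis"
  then have "3 * card C \<le> card U" "3 * card A \<le> card C"
    using assms card_proper_subspace_le[of C U] card_proper_subspace_le[of A C] finite_subset[of C U] by auto
  moreover have "card A > 0" using assms by (metis card_gt_0_iff empty_iff finite_subset gf3.subspace_0 subset_trans)
  ultimately show False using assms by linarith
qed

text \<open>A subspace that avoids a hyperplane has dimension at most one. This is what turns
  splittings into statements about single points.\<close>

lemma card_meet_zero_index3_le:
  assumes "gf3.subspace K" "gf3.subspace C" "gf3.subspace W" "K \<subseteq> W" "C \<subseteq> W" "finite W"
    "card W = 3 * card K" "C \<inter> K = {0}"
  shows "card C \<le> 3"
proof -
  have "card C * card K \<le> card W" using assms by (intro card_subspace_sum_le) auto
  moreover have "card K > 0" using assms by (metis card_gt_0_iff empty_iff finite_subset gf3.subspace_0)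
  ultimately show ?thesis using assms by simp
qed

lemma span_insert_span: "gf3.span (insert x (gf3.span B)) = gf3.span (insert x B)"
proof
  have "insert x (gf3.span B) \<subseteq> gf3.span (insert x B)"
    using gf3.span_mono[of B "insert x B"] by (auto intro: gf3.span_base)
  then show "gf3.span (insert x (gf3.span B)) \<subseteq> gf3.span (insert x B)" by (simp add: gf3.span_minimal)
  show "gf3.span (insert x B) \<subseteq> gf3.span (insert x (gf3.span B))"
    by (intro gf3.span_mono insert_mono gf3.span_superset)
qed

lemma card_span_independent:
  assumes "finite B" "gf3.independent B"
  shows "finite (gf3.span B) \<and> card (gf3.span B) = 3 ^ card B"
  using assms
proof (induction B)
  case (insert x B)
  then have B: "gf3.independent B" "x \<notin> gf3.span B"
    using gf3.independent_insert by (auto split: if_splits intro: gf3.independent_mono)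
  with insert B card_span_insert[of "gf3.span B" x] show ?case by (simp add: span_insert_span)
qed simp

lemma finite_subspace_basis:
  assumes "S \<subseteq> U" "gf3.subspace U" "finite U"
  obtains B where "B \<subseteq> S" "finite B" "gf3.independent B" "gf3.span B = gf3.span S"
    "card (gf3.span S) = 3 ^ card B"
proof -
  obtain B where B: "B \<subseteq> S" "gf3.independent B" "S \<subseteq> gf3.span B"
    using gf3.maximal_independent_subset by blast
  have "finite B" using B assms finite_subset by metis
  moreover have "gf3.span B = gf3.span S" using B
    by (simp add: gf3.span_minimal gf3.span_mono subset_antisym)
  ultimately show ?thesis using that B card_span_independent by metis
qed

lemma finite_span_gf3: "finite S \<Longrightarrow> finite (gf3.span S) \<and> card (gf3.span S) \<le> 3 ^ card S"
proof (induction S rule: finite_induct)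
  case (insert x S)
  show ?case
  proof (cases "x \<in> gf3.span S")
    case True
    then have "gf3.span (insert x S) = gf3.span S" by (simp add: gf3.span_redundant)
    then show ?thesis using insert by simp
  next
    case False
    then show ?thesis using card_span_insert[of "gf3.span S" x] insert by (simp add: span_insert_span)
  qed
qed simp

lemma subspace_gf3_space [simp]: "gf3.subspace (gf3_space k)"
  by (auto simp: subspace_gf3_iff gf3_space_def)

lemma gf3_space_Suc: "gf3_space (Suc k) = (\<lambda>(c, v). v(k := c)) ` (UNIV \<times> gf3_space k)"
proof (intro equalityI subsetI)
  fix v assume v: "v \<in> gf3_space (Suc k)"
  have "v(k := 0) \<in> gf3_space k"
    using v by (auto simp: gf3_space_def Suc_le_eq dest: le_neq_implies_less)
  then show "v \<in> (\<lambda>(c, v). v(k := c)) ` (UNIV \<times> gf3_space k)"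
    by (intro image_eqI[of _ _ "(v k, v(k := 0))"]) auto
qed (auto simp: gf3_space_def)

lemma finite_card_gf3_space: "finite (gf3_space k) \<and> card (gf3_space k) = 3 ^ k"
proof (induction k)
  case 0
  have "gf3_space 0 = {0}" by (auto simp: gf3_space_def)
  then show ?case by simp
next
  case (Suc k)
  have "inj_on (\<lambda>(c, v). v(k := c)) (UNIV \<times> gf3_space k)"
  proof (rule inj_onI; clarify)
    fix c :: gf3 and v d w assume h: "v \<in> gf3_space k" "w \<in> gf3_space k" "v(k := c) = w(k := d)"
    have "v i = w i" for i
    proof (cases "i = k")
      case True
      then show ?thesis using h(1,2) by (auto simp: gf3_space_def)
    next
      case False
      then show ?thesis using fun_cong[OF h(3), of i] by simp
    qed
    then show "c = d \<and> v = w" using fun_cong[OF h(3), of k] by auto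
  qed
  then show ?case using Suc by (simp add: gf3_space_Suc card_image card_cartesian_product)
qed

lemmas finite_gf3_space [simp] = finite_card_gf3_space[THEN conjunct1]
lemmas card_gf3_space = finite_card_gf3_space[THEN conjunct2]

section \<open>The standard bilinear form and annihilators\<close>

definition dot :: "nat \<Rightarrow> gf3_vec \<Rightarrow> gf3_vec \<Rightarrow> gf3" where
  "dot r u v = (\<Sum>i<r. u i * v i)"

lemma dot_add: "dot r u (v + w) = dot r u v + dot r u w" "dot r (u + w) v = dot r u v + dot r w v"
  by (simp_all add: dot_def algebra_simps sum.distrib)

lemma dot_0 [simp]: "dot r u 0 = 0" "dot r 0 v = 0"
  by (simp_all add: dot_def)

lemma dot_minus: "dot r u (- v) = - dot r u v" "dot r (- u) v = - dot r u v"
  by (simp_all add: dot_def sum_negf)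

lemma dot_diff: "dot r u (v - w) = dot r u v - dot r u w" "dot r (u - w) v = dot r u v - dot r w v"
  by (simp_all add: dot_def algebra_simps sum_subtractf)

lemma dot_commute: "dot r u v = dot r v u"
  by (simp add: dot_def mult.commute)

lemma dot_nondegenerate:
  assumes "u \<in> gf3_space r" "u \<noteq> 0"
  shows "\<exists>v\<in>gf3_space r. dot r u v \<noteq> 0"
proof -
  obtain i where i: "u i \<noteq> 0" using assms by (auto simp: fun_eq_iff)
  then have ir: "i < r" using assms(1) by (auto simp: gf3_space_def not_le[symmetric])
  define v :: gf3_vec where "v = (\<lambda>j. if j = i then 1 else 0)"
  have "dot r u v = (\<Sum>j<r. if j = i then u i else 0)"
    unfolding dot_def v_def by (intro sum.cong) auto
  then have "dot r u v = u i" using ir by simp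
  moreover have "v \<in> gf3_space r" using ir by (auto simp: v_def gf3_space_def)
  ultimately show ?thesis using i by metis
qed

text \<open>Translation by a vector \<open>y\<close> with \<open>L y = 1\<close> maps the fibre over
  \<open>s\<close> injectively into the fibre over \<open>s + 1\<close>; going round the three
  values makes all fibres equal. Additivity is asked on \<open>U\<close> alone because coordinates
  with respect to a basis are additive only on its span.\<close>

lemma additive_fibre_card:
  fixes L :: "gf3_vec \<Rightarrow> gf3"
  assumes U: "gf3.subspace U" "finite U" and L: "\<And>x y. x \<in> U \<Longrightarrow> y \<in> U \<Longrightarrow> L (x + y) = L x + L y"
    and x0: "x0 \<in> U" "L x0 \<noteq> 0"
  shows "3 * card {x \<in> U. L x = t} = card U"
proof -
  have Lm: "L (- x) = - L x" if "x \<in> U" for x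
    using L[of x x] that by (simp only: vec_add_self gf3_add_self)
  obtain y where y: "y \<in> U" "L y = 1"
    using that[of x0] that[of "- x0"] x0 Lm[OF x0(1)] gf3.subspace_neg[OF U(1)]
    by (cases "L x0" rule: gf3_cases) auto
  let ?F = "\<lambda>t. {x \<in> U. L x = t}"
  have le: "card (?F s) \<le> card (?F (s + 1))" for s
  proof (rule card_inj_on_le[of "(+) y"])
    show "(+) y ` ?F s \<subseteq> ?F (s + 1)" using y U by (auto simp: gf3.subspace_add L)
  qed (use U in auto)
  have eq: "card (?F 0) = card (?F 1)" "card (?F 1) = card (?F (-1))"
    using le[of 0] le[of 1] le[of "-1"] by (auto simp: gf3_add_self)
  have "U = ?F 0 \<union> ?F 1 \<union> ?F (-1)" using gf3_cases by blast
  then have "card U = card (?F 0 \<union> ?F 1 \<union> ?F (-1))" by simp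
  also have "\<dots> = card (?F 0) + card (?F 1) + card (?F (-1))"
    using U(2) by (subst card_Un_disjoint; auto)+
  finally show ?thesis using eq by (cases t rule: gf3_cases) auto
qed

definition annih :: "nat \<Rightarrow> gf3_vec set \<Rightarrow> gf3_vec set" where
  "annih r Y = {v \<in> gf3_space r. \<forall>u\<in>Y. dot r u v = 0}"

lemma subspace_annih [simp]: "gf3.subspace (annih r Y)"
  by (auto simp: subspace_gf3_iff annih_def dot_add
      intro: gf3.subspace_add[OF subspace_gf3_space] gf3.subspace_0[OF subspace_gf3_space])

lemma annih_subset: "annih r Y \<subseteq> gf3_space r"
  by (auto simp: annih_def)

lemma finite_annih [simp]: "finite (annih r Y)"
  using annih_subset finite_subset finite_gf3_space by metis

text \<open>Orthogonal pairs are counted in two ways. A nonzero \<open>u\<close> is orthogonal to a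
  third of the space, and a vector outside the annihilator is orthogonal to a third of
  \<open>Y\<close>; the exceptional terms of both counts must then agree.\<close>

lemma card_annih:
  assumes Y: "gf3.subspace Y" "Y \<subseteq> gf3_space r"
  shows "card Y * card (annih r Y) = 3 ^ r"
proof -
  let ?V = "gf3_space r"
  have fY: "finite Y" using Y(2) finite_gf3_space finite_subset by blast
  have 0: "0 \<in> Y" "0 \<in> annih r Y" using Y gf3.subspace_0 by auto
  have cV: "card ?V = 3 ^ r" by (rule card_gf3_space)
  have s1: "3 * card {v \<in> ?V. dot r u v = 0} = (if u = 0 then 3 * 3 ^ r else 3 ^ r)" if "u \<in> Y" for u
  proof (cases "u = 0")
    case False
    then obtain v where "v \<in> ?V" "dot r u v \<noteq> 0" using dot_nondegenerate[of u r] \<open>u \<in> Y\<close> Y(2) by blast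
    then show ?thesis using False additive_fibre_card[of ?V "dot r u" v 0] by (simp add: dot_add cV)
  qed (use cV in auto)
  have s2: "3 * card {u \<in> Y. dot r u v = 0} = (if v \<in> annih r Y then 3 * card Y else card Y)" if "v \<in> ?V" for v
  proof (cases "v \<in> annih r Y")
    case True
    then have "{u \<in> Y. dot r u v = 0} = Y" by (auto simp: annih_def)
    then show ?thesis using True by simp
  next
    case False
    then obtain u where "u \<in> Y" "dot r u v \<noteq> 0" using \<open>v \<in> ?V\<close> by (auto simp: annih_def)
    then show ?thesis using False additive_fibre_card[of Y "\<lambda>u. dot r u v" u 0] Y fY by (simp add: dot_add)
  qed
  have sw: "(\<Sum>u\<in>Y. card {v \<in> ?V. dot r u v = 0}) = (\<Sum>v\<in>?V. card {u \<in> Y. dot r u v = 0})"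
    using sum.swap_restrict[OF fY finite_gf3_space[of r], of "\<lambda>_ _. 1 :: nat" "\<lambda>u v. dot r u v = 0"] by simp
  have "3 * (\<Sum>u\<in>Y. card {v \<in> ?V. dot r u v = 0}) = (\<Sum>u\<in>Y. 3 ^ r + (if u = 0 then 2 * 3 ^ r else 0))"
    unfolding sum_distrib_left by (intro sum.cong) (auto simp: s1)
  also have "\<dots> = card Y * 3 ^ r + 2 * 3 ^ r"
    using 0 fY by (simp add: sum.distrib)
  finally have e1: "3 * (\<Sum>u\<in>Y. card {v \<in> ?V. dot r u v = 0}) = card Y * 3 ^ r + 2 * 3 ^ r" .
  have "3 * (\<Sum>v\<in>?V. card {u \<in> Y. dot r u v = 0}) = (\<Sum>v\<in>?V. card Y + (if v \<in> annih r Y then 2 * card Y else 0))"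
    unfolding sum_distrib_left by (intro sum.cong) (auto simp: s2)
  also have "\<dots> = 3 ^ r * card Y + 2 * card Y * card (annih r Y)"
    using annih_subset[of r Y] by (simp add: sum.distrib cV sum.inter_restrict[symmetric] Int_absorb1)
  finally show ?thesis using e1 sw by (simp add: mult.commute)
qed

text \<open>One inclusion is clear, and applying \<open>card_annih\<close> twice shows that both
  sides have the same size.\<close>

lemma annih_annih:
  assumes Y: "gf3.subspace Y" "Y \<subseteq> gf3_space r"
  shows "annih r (annih r Y) = Y"
proof -
  have sub: "Y \<subseteq> annih r (annih r Y)" using Y by (auto simp: annih_def dot_commute)
  have "card (annih r Y) * card (annih r (annih r Y)) = 3 ^ r" using card_annih annih_subset by simp
  with card_annih[OF Y] have "card (annih r Y) * card (annih r (annih r Y)) = card (annih r Y) * card Y"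
    by (simp add: mult.commute)
  moreover have "card (annih r Y) \<noteq> 0"
    using gf3.subspace_0[OF subspace_annih[of r Y]] finite_annih[of r Y] by (metis card_0_eq empty_iff)
  ultimately have "card (annih r (annih r Y)) = card Y" by simp
  then show ?thesis using sub card_subset_eq[OF finite_annih sub] by simp
qed

lemma annih_span: "annih r (gf3.span Y) = annih r Y"
proof
  show "annih r Y \<subseteq> annih r (gf3.span Y)"
  proof
    fix v assume v: "v \<in> annih r Y"
    have "gf3.subspace {u. dot r u v = 0}" by (simp add: subspace_gf3_iff dot_add)
    then have "gf3.span Y \<subseteq> {u. dot r u v = 0}" using v by (intro gf3.span_minimal) (auto simp: annih_def)
    then show "v \<in> annih r (gf3.span Y)" using v by (auto simp: annih_def)
  qed
qed (auto simp: annih_def gf3.span_base)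

section \<open>Split sets and maximal unsplit subspaces\<close>

text \<open>
  Taking \<open>B = {0}\<close> shows that a set which does not span \<open>U\<close> is split in \<open>U\<close>, unless \<open>U\<close> is a point.
\<close>

definition split :: "gf3_vec set \<Rightarrow> gf3_vec set \<Rightarrow> bool" where
  "split S U \<longleftrightarrow> (\<exists>A B. gf3.subspace A \<and> gf3.subspace B \<and> A \<subset> U \<and> B \<subset> U \<and> A \<inter> B = {0} \<and> S \<inter> U \<subseteq> A \<union> B)"

lemma splitI:
  "gf3.subspace A \<Longrightarrow> gf3.subspace B \<Longrightarrow> A \<subset> U \<Longrightarrow> B \<subset> U \<Longrightarrow> A \<inter> B = {0} \<Longrightarrow> S \<inter> U \<subseteq> A \<union> B \<Longrightarrow> split S U"
  unfolding split_def by blast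

lemma small_subspace:
  assumes "gf3.subspace D" "finite D" "card D \<le> 3"
  obtains p where "D = {0, p, - p}"
proof (cases "D = {0}")
  case True
  then show ?thesis using that[of 0] by simp
next
  case False
  then obtain p where p: "p \<in> D" "p \<noteq> 0" using gf3.subspace_0[OF assms(1)] by blast
  have "{0, p, - p} \<subseteq> D" using p assms(1) gf3.subspace_0 by (simp add: gf3.subspace_neg)
  moreover have "card {0, p, - p} = 3" using p by simp
  ultimately have "{0, p, - p} = D" using assms card_seteq[of D "{0, p, - p}"] by simp
  then show ?thesis using that by blast
qed

text \<open>An unsplit subspace lies inside one of the two pieces, for otherwise its meets with them
  are proper and split it. The pieces are named so that this one is \<open>C\<close>.\<close>

lemma subspace_with_split:
  assumes "gf3.subspace A" "A \<subseteq> U" "\<not> split R A" "split R U"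
  obtains C D where "gf3.subspace C" "gf3.subspace D" "C \<subset> U" "D \<subset> U" "C \<inter> D = {0}" "R \<inter> U \<subseteq> C \<union> D" "A \<subseteq> C"
proof -
  obtain C D where CD: "gf3.subspace C" "gf3.subspace D" "C \<subset> U" "D \<subset> U" "C \<inter> D = {0}" "R \<inter> U \<subseteq> C \<union> D"
    using assms(4) unfolding split_def by blast
  have "A \<subseteq> C \<or> A \<subseteq> D"
  proof (rule ccontr)
    assume "\<not> ?thesis"
    then have "split R A"
      using CD assms(1,2) gf3.subspace_0[OF assms(1)]
      by (intro splitI[of "A \<inter> C" "A \<inter> D"]) (auto intro: gf3.subspace_inter)
    then show False using assms(3) by blast
  qed
  then show ?thesis
  proof
    assume "A \<subseteq> C"
    then show ?thesis using that[of C D] CD by blast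
  next
    assume "A \<subseteq> D"
    moreover have "D \<inter> C = {0}" "R \<inter> U \<subseteq> D \<union> C" using CD by blast+
    ultimately show ?thesis using that[of D C] CD by blast
  qed
qed

lemma single_not_split:
  assumes "x \<in> R" "x \<noteq> 0"
  shows "\<not> split R (gf3.span {x})"
proof
  assume "split R (gf3.span {x})"
  then obtain A B where AB: "gf3.subspace A" "gf3.subspace B" "A \<subset> gf3.span {x}" "B \<subset> gf3.span {x}" "R \<inter> gf3.span {x} \<subseteq> A \<union> B"
    unfolding split_def by blast
  have "x \<in> A \<or> x \<in> B" using AB assms by (auto intro: gf3.span_base)
  then show False using AB gf3.span_minimal[of "{x}"] by blast
qed

locale split_hyperplanes =
  fixes V R :: "gf3_vec set"
  assumes V: "gf3.subspace V" "finite V" "card V \<ge> 27"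
    and R: "R \<subseteq> V" "0 \<notin> R" "\<And>v. v \<in> R \<Longrightarrow> - v \<in> R"
    and not_split: "\<not> split R V"
    and hyperplane_split: "\<And>W. gf3.subspace W \<Longrightarrow> W \<subseteq> V \<Longrightarrow> card V = 3 * card W \<Longrightarrow> split R W"
begin

text \<open>A single red point is unsplit, so unsplit proper subspaces exist, and one of largest
  size is maximal. Comparison with that point gives \<open>card A \<ge> 3\<close>.\<close>

lemma maximal_unsplit:
  obtains A where "gf3.subspace A" "A \<subset> V" "\<not> split R A" "card A \<ge> 3"
    "\<And>B. gf3.subspace B \<Longrightarrow> A \<subset> B \<Longrightarrow> B \<subset> V \<Longrightarrow> split R B"
proof -
  have "R \<noteq> {}"
  proof
    assume "R = {}"
    moreover have "{0} \<subset> V" using V gf3.subspace_0[OF V(1)] by auto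
    ultimately have "split R V" by (intro splitI[of "{0}" "{0}"]) auto
    then show False using not_split by blast
  qed
  then obtain x where x: "x \<in> R" "x \<noteq> 0" using R(2) by auto
  have cx: "card (gf3.span {x}) = 3" using x by (simp add: span_single_gf3)
  define P where "P A \<longleftrightarrow> gf3.subspace A \<and> A \<subset> V \<and> \<not> split R A" for A
  have "gf3.span {x} \<noteq> V" using cx V(3) by auto
  moreover have "gf3.span {x} \<subseteq> V" using x R V by (intro gf3.span_minimal) auto
  ultimately have Px: "P (gf3.span {x})"
    unfolding P_def using single_not_split[OF x] by auto
  have "\<forall>A. P A \<longrightarrow> card A < Suc (card V)" using V by (auto simp: P_def intro!: card_mono le_imp_less_Suc)
  then obtain A where A: "P A" "\<And>B. P B \<Longrightarrow> card B \<le> card A"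
    using ex_has_greatest_nat[of P "gf3.span {x}" card "Suc (card V)"] Px by blast
  show ?thesis
  proof (rule that[of A])
    show "card A \<ge> 3" using A(2)[OF Px] cx by simp
    fix B assume "gf3.subspace B" "A \<subset> B" "B \<subset> V"
    then show "split R B" using A(2)[of B] V psubset_card_mono[of B A] unfolding P_def
      by (meson finite_subset linorder_not_less psubset_imp_subset)
  qed (use A in \<open>auto simp: P_def\<close>)
qed

end

locale maximal_unsplit = split_hyperplanes +
  fixes A
  assumes A: "gf3.subspace A" "A \<subset> V" "\<not> split R A" "card A \<ge> 3"
    and above: "\<And>B. gf3.subspace B \<Longrightarrow> A \<subset> B \<Longrightarrow> B \<subset> V \<Longrightarrow> split R B"
begin

lemma finA: "finite A" using A V finite_subset by blast

lemma not_index3: "card V \<noteq> 3 * card A"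
  using hyperplane_split[of A] A by auto

text \<open>Below \<open>V\<close> the red points look like a direct sum with \<open>A\<close> as
  one summand. A splitting of \<open>B\<close> keeps \<open>A\<close> inside one piece, to which
  induction applies; the complement found there is enlarged by the other piece.\<close>

lemma complement_in_proper:
  assumes "gf3.subspace B" "A \<subseteq> B" "B \<subset> V"
  shows "\<exists>D. gf3.subspace D \<and> D \<subseteq> B \<and> D \<inter> A = {0} \<and> R \<inter> B \<subseteq> A \<union> D"
  using assms
proof (induction "card B" arbitrary: B rule: less_induct)
  case less
  show ?case
  proof (cases "A = B")
    case True
    then show ?thesis using gf3.subspace_0[OF A(1)] by (intro exI[of _ "{0}"]) auto
  next
    case False
    then have "split R B" using above less.prems by blast
    then obtain C D where CD: "gf3.subspace C" "gf3.subspace D" "C \<subset> B" "D \<subset> B" "C \<inter> D = {0}" "R \<inter> B \<subseteq> C \<union> D" "A \<subseteq> C"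
      using subspace_with_split[OF A(1) less(3) A(3)] by blast
    have "finite B" using less.prems(3) V(2) finite_subset by blast
    then have "card C < card B" using CD by (intro psubset_card_mono)
    then obtain E where E: "gf3.subspace E" "E \<subseteq> C" "E \<inter> A = {0}" "R \<inter> C \<subseteq> A \<union> E"
      using less.hyps[of C] CD(1,3,7) less.prems(3) by (metis psubset_imp_subset psubset_trans)
    \<comment> \<open>The sum of both complements still meets \<open>A\<close> only in 0: if
      \<open>x + y\<close> lies in \<open>A\<close>, then \<open>y\<close> lies in both
      \<open>C\<close> and \<open>D\<close>, hence is 0, and then \<open>x\<close> lies in both
      \<open>E\<close> and \<open>A\<close>.\<close>
    let ?F = "{x + y |x y. x \<in> E \<and> y \<in> D}"
    have "x \<in> ?F" if "x \<in> E" for x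
      using that gf3.subspace_0[OF CD(2)] by (intro CollectI exI[of _ x] exI[of _ 0]) auto
    moreover have "x \<in> ?F" if "x \<in> D" for x
      using that gf3.subspace_0[OF E(1)] by (intro CollectI exI[of _ 0] exI[of _ x]) auto
    ultimately have F: "E \<subseteq> ?F" "D \<subseteq> ?F" by blast+
    have "x + y = 0" if "x \<in> E" "y \<in> D" "x + y \<in> A" for x y
    proof -
      have "(x + y) - x \<in> C" using that E CD by (intro gf3.subspace_diff) auto
      then have "y = 0" using that CD by auto
      then show ?thesis using that E by auto
    qed
    moreover have "x + y \<in> B" if "x \<in> E" "y \<in> D" for x y
      using that E CD less(2) by (intro gf3.subspace_add) auto
    moreover have "0 \<in> ?F" using F gf3.subspace_0[OF E(1)] by blast
    ultimately have "?F \<subseteq> B" "?F \<inter> A = {0}" using gf3.subspace_0[OF A(1)] by blast+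
    moreover have "R \<inter> B \<subseteq> A \<union> ?F"
    proof
      fix v assume v: "v \<in> R \<inter> B"
      then have "v \<in> D \<or> v \<in> A \<or> v \<in> E" using CD(6) E(4) by blast
      then show "v \<in> A \<union> ?F" using F by blast
    qed
    ultimately show ?thesis using gf3.subspace_sums[OF E(1) CD(2)] by (intro exI[of _ ?F]) auto
  qed
qed

text \<open>One dimension above \<open>A\<close>, the subspace that holds the red vectors off
  \<open>A\<close> avoids a hyperplane, so it is at most a point.\<close>

lemma few_above:
  assumes "x \<in> V" "x \<notin> A"
  shows "card (R \<inter> gf3.span (insert x A) - A) \<le> 2"
proof -
  let ?B = "gf3.span (insert x A)"
  have cB: "card ?B = 3 * card A" using card_span_insert assms A(1) finA by blast
  have "?B \<subseteq> V" using assms A V by (intro gf3.span_minimal) auto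
  moreover have "?B \<noteq> V" using not_index3 cB by auto
  ultimately have "?B \<subset> V" by auto
  moreover have AB: "A \<subseteq> ?B" using gf3.span_superset by blast
  ultimately obtain D where D: "gf3.subspace D" "D \<subseteq> ?B" "D \<inter> A = {0}" "R \<inter> ?B \<subseteq> A \<union> D"
    using complement_in_proper[of ?B] by auto
  have fB: "finite ?B" using \<open>?B \<subseteq> V\<close> V finite_subset by blast
  then have "card D \<le> 3" using card_meet_zero_index3_le[OF A(1) D(1) _ AB D(2)] cB D(3) by simp
  then obtain p where p: "D = {0, p, - p}" using small_subspace D fB finite_subset by metis
  have "R \<inter> ?B - A \<subseteq> {p, - p}" using D p R(2) by auto
  then have "card (R \<inter> ?B - A) \<le> card {p, - p}" by (intro card_mono) auto
  also have "\<dots> \<le> 2" by (simp add: card_insert_if)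
  finally show ?thesis .
qed

text \<open>The kernel of \<open>L\<close> is a proper subspace through \<open>A\<close>, so its red
  vectors off \<open>A\<close> lie in a subspace \<open>D\<close> that meets \<open>A\<close> only
  in 0. Hence these vectors span no nonzero vector of \<open>A\<close>.\<close>

lemma functional_kernel:
  assumes L: "\<And>u v. u \<in> V \<Longrightarrow> v \<in> V \<Longrightarrow> L (u + v) = L u + (L v :: gf3)" "\<And>a. a \<in> A \<Longrightarrow> L a = 0"
    and x0: "x0 \<in> V" "L x0 \<noteq> 0"
    and w: "w \<in> A" "w \<in> gf3.span Z" "Z \<subseteq> R - A" "\<And>z. z \<in> Z \<Longrightarrow> L z = 0"
  shows "w = 0"
proof -
  let ?W = "{v \<in> V. L v = 0}"
  have L0: "L 0 = 0" using L(2) gf3.subspace_0[OF A(1)] by blast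
  have sW: "gf3.subspace ?W" using V L(1) by (auto simp: subspace_gf3_iff L0)
  have "A \<subseteq> ?W" "?W \<subset> V" using A L x0 by auto
  then obtain D where D: "gf3.subspace D" "D \<inter> A = {0}" "R \<inter> ?W \<subseteq> A \<union> D"
    using complement_in_proper[OF sW] by auto
  have "Z \<subseteq> D" using w(3,4) D(3) R(1) by blast
  then have "w \<in> D" using w(2) D(1) gf3.span_minimal by blast
  then show ?thesis using D(2) w(1) by blast
qed

end

text \<open>
  Coordinates modulo \<open>A\<close> with respect to red vectors \<open>b x\<close>, scaled so that a further red vector \<open>y\<close>
  is congruent to their sum. The difference of \<open>y\<close> and that sum, a vector of \<open>A\<close>, does not vanish,
  whereas \<open>ap_zero\<close> below makes such a vector vanish as soon as it lies in the span of red vectors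
  from one hyperplane through \<open>A\<close>. This excludes all but a few positions of red vectors.
\<close>

locale unsplit_coordinates = maximal_unsplit +
  fixes I :: "gf3_vec set" and b :: "gf3_vec \<Rightarrow> gf3_vec" and e :: "gf3_vec \<Rightarrow> gf3_vec \<Rightarrow> gf3" and y
  assumes I: "finite I" "card V = card A * 3 ^ card I"
    and b: "\<And>x. x \<in> I \<Longrightarrow> b x \<in> R - A"
    and e_add: "\<And>u v x. u \<in> V \<Longrightarrow> v \<in> V \<Longrightarrow> e (u + v) x = e u x + e v x"
    and e_A: "\<And>a x. a \<in> A \<Longrightarrow> x \<in> I \<Longrightarrow> e a x = 0"
    and e_b: "\<And>x x'. x \<in> I \<Longrightarrow> x' \<in> I \<Longrightarrow> e (b x) x' = (if x' = x then 1 else 0)"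
    and decomp: "\<And>v. v \<in> V \<Longrightarrow> v - (\<Sum>x\<in>I. gf3_scale (e v x) (b x)) \<in> A"
    and y: "y \<in> R" "\<And>x. x \<in> I \<Longrightarrow> e y x = 1" "y \<noteq> (\<Sum>x\<in>I. b x)"

context maximal_unsplit begin

text \<open>Otherwise this span and \<open>{0}\<close> would split \<open>V\<close>.\<close>

lemma span_A_R: "gf3.span (A \<union> R) = V"
proof (rule ccontr)
  assume neq: "gf3.span (A \<union> R) \<noteq> V"
  have "gf3.span (A \<union> R) \<subseteq> V" using A R V by (intro gf3.span_minimal) auto
  then have "split R V"
    using neq A V gf3.subspace_0[OF V(1)] gf3.span_superset[of "A \<union> R"] gf3.span_zero[of "A \<union> R"]
    by (intro splitI[of "gf3.span (A \<union> R)" "{0}"]) auto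
  then show False using not_split by blast
qed

text \<open>Since \<open>A\<close> and \<open>R\<close> span \<open>V\<close>, a basis of
  \<open>A\<close> extends to one of \<open>V\<close> by red vectors alone; these form
  \<open>I\<close>.\<close>

lemma coordinates: "\<exists>I b e y. unsplit_coordinates V R A I b e y"
proof -
  obtain BA where BA: "BA \<subseteq> A" "gf3.independent BA" "A \<subseteq> gf3.span BA"
    using gf3.maximal_independent_subset[of A] by blast
  obtain B where B: "BA \<subseteq> B" "B \<subseteq> A \<union> R" "gf3.independent B" "A \<union> R \<subseteq> gf3.span B"
    using gf3.maximal_independent_subset_extend[of BA "A \<union> R"] BA by blast
  have BV: "B \<subseteq> V" using B A R by blast
  have finB: "finite B" using BV V finite_subset by blast
  have spBA: "gf3.span BA = A" using BA A gf3.span_minimal by blast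
  have spB: "gf3.span B = V"
    using gf3.span_minimal[OF BV V(1)] gf3.span_minimal[OF B(4)] span_A_R by auto
  define I where "I = B - BA"
  have finI: "finite I" using finB I_def by simp
  define c where "c = gf3.representation B"
  have "card B = card BA + card I"
    unfolding I_def using B(1) finB by (metis card_Diff_subset card_mono finite_subset le_add_diff_inverse)
  then have cV: "card V = card A * 3 ^ card I"
    using card_span_independent[OF finB B(3)] card_span_independent[OF _ BA(2)] finB B(1) spBA spB
    by (simp add: power_add finite_subset)
  have c_add: "c (u + v) x = c u x + c v x" if "u \<in> V" "v \<in> V" for u v x
    unfolding c_def using that spB B(3) by (simp add: gf3.representation_add)
  have c_A: "c a x = 0" if "a \<in> A" "x \<in> I" for a x
  proof -
    have "c a = gf3.representation BA a"
      unfolding c_def using that B BA by (intro gf3.representation_extend) auto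
    then show ?thesis using that gf3.representation_ne_zero[of BA a x] by (auto simp: I_def)
  qed
  have c_b: "c x x' = (if x' = x then 1 else 0)" if "x \<in> I" for x x'
    unfolding c_def using that B(3) by (subst gf3.representation_basis) (auto simp: I_def)
  have c_sum: "v = (\<Sum>x\<in>BA. gf3_scale (c v x) x) + (\<Sum>x\<in>I. gf3_scale (c v x) x)" if "v \<in> V" for v
  proof -
    have "v = (\<Sum>x\<in>B. gf3_scale (c v x) x)"
      unfolding c_def using that B(3) spB finB by (subst gf3.sum_representation_eq) auto
    also have "B = BA \<union> I" using B I_def by auto
    finally show ?thesis using finB B(1) by (subst (asm) sum.union_disjoint) (auto simp: I_def finite_subset)
  qed
  have c_dec: "v - (\<Sum>x\<in>I. gf3_scale (c v x) x) \<in> A" if "v \<in> V" for v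
  proof -
    have "v - (\<Sum>x\<in>I. gf3_scale (c v x) x) = (\<Sum>x\<in>BA. gf3_scale (c v x) x)"
      using c_sum[OF that] by (metis add_diff_cancel_right')
    also have "\<dots> \<in> A" using BA A(1) by (intro gf3.subspace_sum gf3.subspace_scale) auto
    finally show ?thesis .
  qed
  have IR: "I \<subseteq> R - A"
  proof
    fix x assume x: "x \<in> I"
    then have "x \<notin> A" using c_A[of x x] c_b[of x x] by auto
    then show "x \<in> R - A" using x B by (auto simp: I_def)
  qed
  have "gf3.span I \<inter> A = {0}"
  proof -
    have "w = 0" if "w \<in> gf3.span I" "w \<in> A" for w
    proof -
      have "w \<in> V" using that A by auto
      have "c w x = 0" if "x \<in> BA" for x
      proof -
        have "c w = gf3.representation I w"
          unfolding c_def using \<open>w \<in> gf3.span I\<close> B by (intro gf3.representation_extend) (auto simp: I_def)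
        then show ?thesis using that gf3.representation_ne_zero[of I w x] by (auto simp: I_def)
      qed
      then show ?thesis using c_sum[OF \<open>w \<in> V\<close>] c_A[OF \<open>w \<in> A\<close>] by simp
    qed
    then show ?thesis using gf3.subspace_0[OF A(1)] gf3.span_zero by auto
  qed
  moreover have "gf3.span I \<subset> V"
  proof -
    have "gf3.span I \<subseteq> V" using IR R V by (intro gf3.span_minimal) auto
    moreover have "A \<noteq> {0}" using A(4) by auto
    ultimately show ?thesis using \<open>gf3.span I \<inter> A = {0}\<close> A(2) by auto
  qed
  \<comment> \<open>The span of \<open>I\<close> and \<open>A\<close> are proper and meet trivially,
    so they would split \<open>V\<close> if they contained all red vectors. A red vector left over
    serves as \<open>y\<close>.\<close>
  ultimately have "\<not> R \<inter> V \<subseteq> gf3.span I \<union> A"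
    using not_split A splitI[of "gf3.span I" A V R] by auto
  then obtain y where y: "y \<in> R" "y \<in> V" "y \<notin> A" "y \<notin> gf3.span I" by auto
  \<comment> \<open>If the coordinate \<open>k\<close> of \<open>y\<close> were 0, then
    \<open>y\<close> and the basis vectors it uses would lie in the kernel of that coordinate. The
    \<open>A\<close>-part of \<open>y\<close> would vanish by \<open>functional_kernel\<close>, and
    \<open>y\<close> would lie in the span of \<open>I\<close>.\<close>
  have cy: "c y k \<noteq> 0" if k: "k \<in> I" for k
  proof
    assume 0: "c y k = 0"
    let ?w = "y - (\<Sum>x\<in>I. gf3_scale (c y x) x)"
    let ?Z = "insert y (I - {k})"
    have "gf3_scale (c y x) x \<in> gf3.span ?Z" if "x \<in> I" for x
      using that 0 by (cases "x = k") (auto intro: gf3.span_scale gf3.span_base gf3.span_zero)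
    then have "?w \<in> gf3.span ?Z" by (intro gf3.span_diff gf3.span_sum) (auto intro: gf3.span_base)
    then have "?w = 0"
      using k IR R y 0 c_dec[OF y(2)] c_add c_A[OF _ k] c_b
      by (intro functional_kernel[of "\<lambda>v. c v k" k ?w ?Z]) auto
    moreover have "(\<Sum>x\<in>I. gf3_scale (c y x) x) \<in> gf3.span I"
      by (intro gf3.span_sum gf3.span_scale gf3.span_base)
    ultimately show False using y by auto
  qed
  \<comment> \<open>The coordinates of \<open>y\<close> are signs. Multiplying basis vectors and
    coordinates by them turns every coordinate of \<open>y\<close> into 1.\<close>
  define e where "e v x = c y x * c v x" for v x
  define b where "b x = gf3_scale (c y x) x" for x
  have bpm: "b x = x \<and> c y x = 1 \<or> b x = - x \<and> c y x = -1" if "x \<in> I" for x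
    using cy[OF that] unfolding b_def by (cases "c y x" rule: gf3_cases) auto
  have c_minus: "c (- x) x' = - c x x'" if "x \<in> V" for x x'
    using c_add[OF that that, of x'] by (simp only: vec_add_self gf3_add_self)
  have eb: "gf3_scale (e v x) (b x) = gf3_scale (c v x) x" if "x \<in> I" for v x
  proof -
    have "e v x * c y x = c v x" using gf3_mult_self[OF cy[OF that]] unfolding e_def by (metis mult.assoc mult.commute mult_1)
    then show ?thesis unfolding b_def by simp
  qed
  have "unsplit_coordinates V R A I b e y"
  proof unfold_locales
    show "finite I" "card V = card A * 3 ^ card I" by fact+
    show "b x \<in> R - A" if "x \<in> I" for x
    proof -
      have "x \<in> R" "x \<notin> A" using that IR by auto
      then show ?thesis using bpm[OF that] R(3) subspace_neg_iff[OF A(1)] by auto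
    qed
    show "e (u + v) x = e u x + e v x" if "u \<in> V" "v \<in> V" for u v x
      using c_add[OF that] by (simp add: e_def algebra_simps)
    show "e a x = 0" if "a \<in> A" "x \<in> I" for a x using c_A[OF that] by (simp add: e_def)
    show "e (b x) x' = (if x' = x then 1 else 0)" if "x \<in> I" "x' \<in> I" for x x'
    proof -
      have "x \<in> V" using that IR R by auto
      then show ?thesis using bpm[OF that(1)] c_b[OF that(1), of x'] c_minus[of x x'] by (auto simp: e_def)
    qed
    show "v - (\<Sum>x\<in>I. gf3_scale (e v x) (b x)) \<in> A" if "v \<in> V" for v
      using c_dec[OF that] eb by simp
    show "y \<in> R" by fact
    show "e y x = 1" if "x \<in> I" for x using gf3_mult_self[OF cy[OF that]] by (simp add: e_def)
    show "y \<noteq> (\<Sum>x\<in>I. b x)"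
    proof
      assume "y = (\<Sum>x\<in>I. b x)"
      moreover have "(\<Sum>x\<in>I. b x) \<in> gf3.span I"
        unfolding b_def by (intro gf3.span_sum gf3.span_scale gf3.span_base)
      ultimately show False using y by simp
    qed
  qed
  then show ?thesis by blast
qed

end

section \<open>Red vectors outside a maximal unsplit subspace\<close>

context unsplit_coordinates begin

lemma bV: "x \<in> I \<Longrightarrow> b x \<in> V" and yV: "y \<in> V"
  using b y R by auto

lemma e_minus: "v \<in> V \<Longrightarrow> e (- v) x = - e v x"
  using e_add[of v v x] by (simp only: vec_add_self gf3_add_self)

lemma e_diff: "u \<in> V \<Longrightarrow> v \<in> V \<Longrightarrow> e (u - v) x = e u x - e v x"
  using e_add[of u "- v" x] e_minus[of v x] gf3.subspace_neg[OF V(1), of v] by simp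

text \<open>On \<open>V\<close> this is the projection to \<open>A\<close> along the span of the
  vectors \<open>b x\<close>.\<close>

definition ap where "ap v = v - (\<Sum>x\<in>I. gf3_scale (e v x) (b x))"

lemma ap_add: "u \<in> V \<Longrightarrow> v \<in> V \<Longrightarrow> ap (u + v) = ap u + ap v"
  by (simp add: ap_def e_add gf3.scale_left_distrib sum.distrib)

lemma ap_minus: "v \<in> V \<Longrightarrow> ap (- v) = - ap v"
  using ap_add[of v v] by (simp only: vec_add_self)

lemma ap_diff: "u \<in> V \<Longrightarrow> v \<in> V \<Longrightarrow> ap (u - v) = ap u - ap v"
  using ap_add[of u "- v"] ap_minus[of v] gf3.subspace_neg[OF V(1), of v] by simp

lemma ap_in: "v \<in> V \<Longrightarrow> ap v \<in> A"
  unfolding ap_def by (rule decomp)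

lemma ap_b: assumes "x \<in> I" shows "ap (b x) = 0"
proof -
  have "(\<Sum>x'\<in>I. gf3_scale (e (b x) x') (b x')) = (\<Sum>x'\<in>I. if x' = x then b x else 0)"
    using e_b[OF assms] by (intro sum.cong) auto
  then show ?thesis using assms I by (simp add: ap_def)
qed

lemma ap_y: "ap y \<noteq> 0"
proof -
  have "(\<Sum>x\<in>I. gf3_scale (e y x) (b x)) = (\<Sum>x\<in>I. b x)" using y by (intro sum.cong) auto
  then show ?thesis using y by (simp add: ap_def)
qed

lemma ap_y_minus: "ap y \<noteq> - ap y"
  using ap_y by simp

text \<open>The last assumption makes \<open>u\<close> use only basis vectors from the kernel of
  \<open>L\<close>. Its \<open>A\<close>-part is then a combination of red vectors of that kernel,
  so \<open>functional_kernel\<close> applies.\<close>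

lemma ap_zero:
  assumes L: "\<And>u v. u \<in> V \<Longrightarrow> v \<in> V \<Longrightarrow> L (u + v) = L u + (L v :: gf3)" "\<And>a. a \<in> A \<Longrightarrow> L a = 0"
    and x0: "x0 \<in> V" "L x0 \<noteq> 0"
    and u: "u \<in> gf3.span {v \<in> R - A. L v = 0}" "\<And>x. x \<in> I \<Longrightarrow> e u x \<noteq> 0 \<Longrightarrow> L (b x) = 0"
  shows "ap u = 0"
proof (rule functional_kernel[OF L x0])
  let ?Z = "{v \<in> R - A. L v = 0}"
  have "gf3.span ?Z \<subseteq> V" using R V by (intro gf3.span_minimal) auto
  then show "ap u \<in> A" using u(1) ap_in by blast
  have "gf3_scale (e u x) (b x) \<in> gf3.span ?Z" if "x \<in> I" for x
    using u(2)[OF that] b[OF that] by (cases "e u x = 0") (auto intro: gf3.span_zero gf3.span_scale gf3.span_base)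
  then show "ap u \<in> gf3.span ?Z" unfolding ap_def using u(1) by (intro gf3.span_diff gf3.span_sum) auto
qed auto

lemma ap_zero_of_coordinate:
  assumes "z \<in> R" "z \<notin> A" "k \<in> I" "e z k = 0"
  shows "ap z = 0"
  using assms e_add e_A e_b bV by (intro ap_zero[of "\<lambda>v. e v k" "b k"]) (auto intro: gf3.span_base)

lemma y_notin: assumes "I \<noteq> {}" shows "y \<notin> A"
proof
  assume "y \<in> A"
  obtain x where "x \<in> I" using assms by auto
  then show False using y(2)[of x] e_A[OF \<open>y \<in> A\<close>, of x] by simp
qed

text \<open>The functional is the difference of the coordinates \<open>i\<close> and
  \<open>j\<close>. Both \<open>y\<close> and \<open>z\<close> lie in its kernel, and
  \<open>y - z\<close> uses neither of the two basis vectors outside the kernel.\<close>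

lemma ap_eq_of_coordinates:
  assumes "z \<in> R" "z \<notin> A" "i \<in> I" "j \<in> I" "i \<noteq> j" "e z i = 1" "e z j = 1"
  shows "ap z = ap y"
proof -
  have zV: "z \<in> V" using assms R by auto
  have "ap (y - z) = 0"
  proof (rule ap_zero[of "\<lambda>v. e v i - e v j" "b i"])
    have "y \<notin> A" using y_notin assms by auto
    then show "y - z \<in> gf3.span {v \<in> R - A. e v i - e v j = 0}"
      using assms y by (intro gf3.span_diff gf3.span_base) auto
    show "e (b x) i - e (b x) j = 0" if "x \<in> I" "e (y - z) x \<noteq> 0" for x
      using that assms e_diff[OF yV zV, of x] y(2) e_b by auto
  qed (use assms e_add e_A e_b bV in auto)
  then show ?thesis using ap_diff[OF yV zV] by simp
qed

lemma decomp_eq: "v = ap v + (\<Sum>x\<in>I. gf3_scale (e v x) (b x))"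
  by (simp add: ap_def)

text \<open>Two coordinates equal to 1 force the \<open>A\<close>-part \<open>ap y\<close>, two
  equal to -1 force \<open>- ap y\<close>, and a zero coordinate forces 0. These three vectors of
  \<open>A\<close> are distinct, so only nearly empty or nearly constant coordinate patterns
  survive, and pattern and \<open>A\<close>-part together determine the vector.\<close>

lemma classification:
  assumes m: "card I \<ge> 3" and z: "z \<in> R" "z \<notin> A"
  shows "(\<exists>i\<in>I. z = b i \<or> z = - b i) \<or> z = y \<or> z = - y \<or> (\<exists>i\<in>I. \<exists>j\<in>I. i \<noteq> j \<and> z = b i - b j)
    \<or> (\<exists>j\<in>I. z = y + b j \<or> z = - (y + b j))"
proof -
  have zV: "z \<in> V" using z R by auto
  have mz: "- z \<in> R" "- z \<notin> A" using z R(3) subspace_neg_iff[OF A(1)] by auto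
  define P where "P w = {x \<in> I. e w x = 1}" for w
  define N where "N w = {x \<in> I. e w x = -1}" for w
  have fin: "finite (P w)" "finite (N w)" for w using I by (auto simp: P_def N_def)
  have disj: "P w \<inter> N w = {}" for w by (auto simp: P_def N_def)
  have sumPN: "w = ap w + (\<Sum>x\<in>P w. b x) - (\<Sum>x\<in>N w. b x)" for w
  proof -
    have "(\<Sum>x\<in>I. gf3_scale (e w x) (b x)) = (\<Sum>x\<in>P w \<union> N w. gf3_scale (e w x) (b x))"
    proof (rule sum.mono_neutral_right)
      show "\<forall>x\<in>I - (P w \<union> N w). gf3_scale (e w x) (b x) = 0"
      proof
        fix x assume "x \<in> I - (P w \<union> N w)"
        then have "e w x = 0" by (cases "e w x" rule: gf3_cases) (auto simp: P_def N_def)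
        then show "gf3_scale (e w x) (b x) = 0" by simp
      qed
    qed (use I in \<open>auto simp: P_def N_def\<close>)
    also have "\<dots> = (\<Sum>x\<in>P w. gf3_scale (e w x) (b x)) + (\<Sum>x\<in>N w. gf3_scale (e w x) (b x))"
      using fin disj by (rule sum.union_disjoint)
    also have "(\<Sum>x\<in>P w. gf3_scale (e w x) (b x)) = (\<Sum>x\<in>P w. b x)"
      by (intro sum.cong) (auto simp: P_def)
    also have "(\<Sum>x\<in>N w. gf3_scale (e w x) (b x)) = - (\<Sum>x\<in>N w. b x)"
      unfolding sum_negf[symmetric] by (intro sum.cong) (auto simp: N_def)
    finally have S: "(\<Sum>x\<in>I. gf3_scale (e w x) (b x)) = (\<Sum>x\<in>P w. b x) - (\<Sum>x\<in>N w. b x)"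
      by (simp only: add_uminus_conv_diff)
    show ?thesis using decomp_eq[of w] unfolding S by (simp only: add_diff_eq)
  qed
  have PN_minus: "P (- z) = N z" "N (- z) = P z"
    unfolding P_def N_def e_minus[OF zV] by (simp_all add: minus_equation_iff[of _ 1] eq_commute[of "-1"])
  have two: "\<exists>i j. i \<in> S \<and> j \<in> S \<and> i \<noteq> j" if "card S \<ge> 2" "finite S" for S :: "gf3_vec set"
    using that by (metis One_nat_def Suc_1 card_le_Suc0_iff_eq not_less_eq_eq)
  have P2: "ap w = ap y" if "w \<in> R" "w \<notin> A" "card (P w) \<ge> 2" for w
    using two[OF that(3) fin(1)] ap_eq_of_coordinates[OF that(1,2)] by (auto simp: P_def)
  show ?thesis
  proof (cases "\<exists>k\<in>I. e z k = 0")
    case True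
    then have az: "ap z = 0" using ap_zero_of_coordinate z by blast
    have "card (P z) \<le> 1" using P2[OF z] az ap_y by fastforce
    moreover have "card (N z) \<le> 1" using P2[OF mz] PN_minus az ap_minus[OF zV] ap_y by fastforce
    moreover have "z \<noteq> 0" using z R by auto
    ultimately consider i where "P z = {i}" "N z = {}" | j where "P z = {}" "N z = {j}"
      | i j where "P z = {i}" "N z = {j}"
      using fin[of z] sumPN[of z] az by (auto simp: le_Suc_eq card_1_singleton_iff)
    then show ?thesis
    proof cases
      case 1
      then have "z = b i" "i \<in> I" using sumPN[of z] az by (auto simp: P_def)
      then show ?thesis by blast
    next
      case 2
      then have "z = - b j" "j \<in> I" using sumPN[of z] az by (auto simp: N_def)
      then show ?thesis by blast
    next
      case 3
      then have "i \<in> P z" "j \<in> N z" by auto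
      then have "z = b i - b j" "i \<in> I" "j \<in> I" "i \<noteq> j"
        using sumPN[of z] az 3 disj[of z] by (auto simp: P_def N_def)
      then show ?thesis by blast
    qed
  next
    case False
    have full: "w = y \<or> (\<exists>j\<in>I. w = y + b j)"
      if w: "w \<in> R" "w \<notin> A" "- w \<in> R" "- w \<notin> A" "P (- w) = N w" "card (P w) \<ge> 2" "I = P w \<union> N w" for w
    proof -
      have wV: "w \<in> V" using w R by auto
      have aw: "ap w = ap y" using P2 w by blast
      have "card (N w) \<le> 1"
      proof (rule ccontr)
        assume "\<not> ?thesis"
        then have "ap (- w) = ap y" using P2[of "- w"] w by simp
        then show False using aw ap_minus[OF wV] ap_y_minus by simp
      qed
      have "(\<Sum>x\<in>I. b x) = (\<Sum>x\<in>P w. b x) + (\<Sum>x\<in>N w. b x)"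
        using fin[of w] disj[of w] by (subst w(7)) (rule sum.union_disjoint)
      moreover have "y = ap y + (\<Sum>x\<in>I. b x)"
      proof -
        have "(\<Sum>x\<in>I. gf3_scale (e y x) (b x)) = (\<Sum>x\<in>I. b x)" using y by (intro sum.cong) auto
        then show ?thesis using decomp_eq[of y] by simp
      qed
      \<comment> \<open>Compared with \<open>y\<close>, a basis vector in \<open>N w\<close> has
        coefficient -1 instead of 1. The change is -2, which is 1 in this field.\<close>
      ultimately have "w = y - (\<Sum>x\<in>N w. b x) - (\<Sum>x\<in>N w. b x)"
        using sumPN[of w] aw by (metis add.assoc add_diff_cancel_right')
      then have wy: "w = y + (\<Sum>x\<in>N w. b x)"
        by (metis diff_diff_eq vec_add_self diff_minus_eq_add)
      show ?thesis
      proof (cases "N w = {}")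
        case True
        then show ?thesis using wy by simp
      next
        case False
        then obtain j where "N w = {j}"
          using \<open>card (N w) \<le> 1\<close> fin[of w] by (auto simp: le_Suc_eq card_1_singleton_iff)
        moreover from this have "j \<in> I" by (auto simp: N_def)
        ultimately show ?thesis using wy by auto
      qed
    qed
    have IPN: "I = P z \<union> N z" using False gf3_cases by (auto simp: P_def N_def)
    then have "card I = card (P z) + card (N z)" using fin[of z] disj[of z] card_Un_disjoint by metis
    \<comment> \<open>Three nonzero coordinates contain two equal ones; replacing \<open>z\<close>
      by \<open>- z\<close> makes them 1.\<close>
    then consider "card (P z) \<ge> 2" | "card (N z) \<ge> 2" using m by linarith
    then show ?thesis
    proof cases
      case 1
      then show ?thesis using full[OF z mz PN_minus(1) _ IPN] by blast
    next
      case 2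
      then have "- z = y \<or> (\<exists>j\<in>I. - z = y + b j)"
        using full[of "- z"] z mz PN_minus IPN by (auto simp: Un_commute)
      then show ?thesis by (metis minus_minus)
    qed
  qed
qed

lemma in_span_kernel: "z \<in> R \<Longrightarrow> z \<notin> A \<Longrightarrow> L z = 0 \<Longrightarrow> z \<in> gf3.span {v \<in> R - A. L v = 0}"
  by (auto intro: gf3.span_base)

lemma difference_notin:
  assumes "i \<in> I" "j \<in> I" "i \<noteq> j" shows "b i - b j \<notin> A"
  using e_A[of "b i - b j" i] e_diff[OF bV bV, of i j i] e_b assms by auto

text \<open>The sum of the three coordinates vanishes on both differences, and on \<open>y\<close>
  because \<open>1 + 1 + 1 = 0\<close>. The three vectors add up to one with zero coordinates at
  \<open>i\<close>, \<open>j\<close> and \<open>l\<close>, so its \<open>A\<close>-part should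
  vanish, yet it is \<open>ap y\<close>.\<close>

lemma conflict1:
  assumes "i \<in> I" "j \<in> I" "l \<in> I" "i \<noteq> j" "i \<noteq> l" "j \<noteq> l"
  shows "\<not> (b i - b j \<in> R \<and> b i - b l \<in> R)"
proof
  assume z: "b i - b j \<in> R \<and> b i - b l \<in> R"
  let ?L = "\<lambda>v. e v i + e v j + e v l"
  let ?u = "y + (b i - b j) + (b i - b l)"
  have V1: "b i \<in> V" "b j \<in> V" "b l \<in> V" "b i - b j \<in> V" "b i - b l \<in> V" "y + (b i - b j) \<in> V"
    using bV assms yV V gf3.subspace_diff gf3.subspace_add by metis+
  have eu: "e ?u x = 1 + ((if x = i then 1 else 0) - (if x = j then 1 else 0))
      + ((if x = i then 1 else 0) - (if x = l then 1 else 0))" if "x \<in> I" for x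
    by (simp only: e_add e_diff e_b y(2) V1 yV that assms)
  have "ap ?u = 0"
  proof (rule ap_zero[of ?L "b i"])
    have three: "1 + 1 + (1 :: gf3) = 0" by (metis add.left_inverse gf3_add_self)
    have 1: "y \<in> gf3.span {v \<in> R - A. ?L v = 0}"
      using y assms y_notin three by (intro in_span_kernel) auto
    have 2: "b i - b j \<in> gf3.span {v \<in> R - A. ?L v = 0}" "b i - b l \<in> gf3.span {v \<in> R - A. ?L v = 0}"
      using z assms difference_notin V1 by - (rule in_span_kernel; auto simp: e_diff e_b)+
    show "?u \<in> gf3.span {v \<in> R - A. ?L v = 0}" using 1 2 by (intro gf3.span_add)
    show "?L (b x) = 0" if "x \<in> I" "e ?u x \<noteq> 0" for x
      using that assms eu[OF that(1)] gf3_add_self[of 1] by (auto simp: e_b split: if_splits)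
  qed (use assms e_add e_A e_b bV in auto)
  moreover have "ap ?u = ap y"
    by (simp only: ap_add ap_diff ap_b V1 yV assms diff_self add_0_right add_0_left)
  ultimately show False using ap_y by simp
qed

lemma y_plus:
  assumes "j \<in> I" "k \<in> I" "k \<noteq> j" shows "y + b j \<notin> A"
  using e_A[of "y + b j" k] e_add[OF yV bV, of j k] e_b y(2) assms by auto

text \<open>At \<open>i\<close> and \<open>j\<close> the two vectors have coordinates
  \<open>1, -1\<close> and \<open>-1, 1\<close>. Both lie in the kernel of the sum of these
  coordinates, and their own sum has zeros there, although its \<open>A\<close>-part is
  \<open>ap y\<close>.\<close>

lemma conflict2:
  assumes "i \<in> I" "j \<in> I" "i \<noteq> j"
  shows "\<not> (b i - b j \<in> R \<and> y + b i \<in> R)"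
proof
  assume z: "b i - b j \<in> R \<and> y + b i \<in> R"
  let ?L = "\<lambda>v. e v i + e v j"
  let ?u = "(b i - b j) + (y + b i)"
  have V1: "b i \<in> V" "b j \<in> V" "b i - b j \<in> V" "y + b i \<in> V"
    using bV assms yV V gf3.subspace_diff gf3.subspace_add by metis+
  have eu: "e ?u x = ((if x = i then 1 else 0) - (if x = j then 1 else 0))
      + (1 + (if x = i then 1 else 0))" if "x \<in> I" for x
    by (simp only: e_add e_diff e_b y(2) V1 yV that assms)
  have "ap ?u = 0"
  proof (rule ap_zero[of ?L "b i"])
    have 1: "y + b i \<in> gf3.span {v \<in> R - A. ?L v = 0}"
      using z assms V1 yV y_plus[of i j] gf3_add_self[of 1] by (intro in_span_kernel) (auto simp: e_add e_b y(2))
    have 2: "b i - b j \<in> gf3.span {v \<in> R - A. ?L v = 0}"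
      using z assms difference_notin V1 by - (rule in_span_kernel; auto simp: e_diff e_b)+
    show "?u \<in> gf3.span {v \<in> R - A. ?L v = 0}" using gf3.span_add[OF 2 1] .
    show "?L (b x) = 0" if "x \<in> I" "e ?u x \<noteq> 0" for x
      using that assms eu[OF that(1)] gf3_add_self[of 1] by (auto simp: e_b split: if_splits)
  qed (use assms e_add e_A e_b bV in auto)
  moreover have "ap ?u = ap y"
    by (simp only: ap_add ap_diff ap_b V1 yV assms diff_self add_0_right add_0_left)
  ultimately show False using ap_y by simp
qed

text \<open>Again the coordinates at \<open>i\<close> and \<open>j\<close> are opposite pairs that
  cancel. The \<open>A\<close>-part of the sum is \<open>ap y + ap y\<close>, that is
  \<open>- ap y\<close>, which is not 0.\<close>

lemma conflict3:
  assumes "i \<in> I" "j \<in> I" "i \<noteq> j"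
  shows "\<not> (y + b i \<in> R \<and> y + b j \<in> R)"
proof
  assume z: "y + b i \<in> R \<and> y + b j \<in> R"
  let ?L = "\<lambda>v. e v i + e v j"
  let ?u = "(y + b i) + (y + b j)"
  have V1: "b i \<in> V" "b j \<in> V" "y + b j \<in> V" "y + b i \<in> V"
    using bV assms yV V gf3.subspace_diff gf3.subspace_add by metis+
  have eu: "e ?u x = (1 + (if x = i then 1 else 0)) + (1 + (if x = j then 1 else 0))" if "x \<in> I" for x
    by (simp only: e_add e_diff e_b y(2) V1 yV that assms)
  have "ap ?u = 0"
  proof (rule ap_zero[of ?L "b i"])
    have 1: "y + b i \<in> gf3.span {v \<in> R - A. ?L v = 0}" "y + b j \<in> gf3.span {v \<in> R - A. ?L v = 0}"
      using z assms V1 yV y_plus[of i j] y_plus[of j i]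
      by - (rule in_span_kernel; auto simp: e_add e_b y(2))+
    show "?u \<in> gf3.span {v \<in> R - A. ?L v = 0}" using gf3.span_add[OF 1] .
    show "?L (b x) = 0" if "x \<in> I" "e ?u x \<noteq> 0" for x
      using that assms eu[OF that(1)] gf3_add_self[of 1] by (auto simp: e_b split: if_splits)
  qed (use assms e_add e_A e_b bV in auto)
  moreover have "ap ?u = ap y + ap y" by (simp only: ap_add ap_b add_0_right V1 yV assms)
  ultimately show False using ap_y vec_add_self by (metis neg_equal_0_iff_equal)
qed

lemma card_six: "card {p, - p, q, - q, s, - s :: gf3_vec} \<le> 6"
  by (simp add: card_insert_if)

text \<open>The hyperplane on which the coordinates \<open>i\<close> and \<open>j\<close> agree
  contains \<open>A\<close>, \<open>y\<close> and every \<open>b l\<close> with another index. A red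
  difference \<open>b i - b j\<close>, if there is one, selects the pair; otherwise the pair avoids
  the only possible \<open>l\<close> with \<open>y + b l\<close> red.\<close>

lemma few_off_hyperplane_ge3:
  assumes m: "card I \<ge> 3"
  shows "\<exists>W. gf3.subspace W \<and> W \<subseteq> V \<and> card V = 3 * card W \<and> card (R - W) \<le> 6"
proof -
  define W where "W i j = {v \<in> V. e v i - e v j = 0}" for i j
  have W: "gf3.subspace (W i j)" "W i j \<subseteq> V" "card V = 3 * card (W i j)" if "i \<in> I" "j \<in> I" "i \<noteq> j" for i j
  proof -
    have add: "e (u + v) i - e (u + v) j = (e u i - e u j) + (e v i - e v j)" if "u \<in> V" "v \<in> V" for u v
      using that by (simp add: e_add)
    show "W i j \<subseteq> V" by (auto simp: W_def)
    have "e 0 i - e 0 j = 0" using e_A[OF gf3.subspace_0[OF A(1)]] that by simp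
    then show "gf3.subspace (W i j)"
      using V(1) e_add by (auto simp: subspace_gf3_iff W_def)
    show "card V = 3 * card (W i j)"
      unfolding W_def using add bV[OF that(1)] that V
      by (subst additive_fibre_card[of V _ "b i"]) (auto simp: e_b)
  qed
  have eyb: "e (y + b l) x = 1 + (if x = l then 1 else 0)" if "l \<in> I" "x \<in> I" for l x
    using that e_add[OF yV bV] e_b y(2) by simp
  have edb: "e (b p - b q) x = (if x = p then 1 else 0) - (if x = q then 1 else 0)" if "p \<in> I" "q \<in> I" "x \<in> I" for p q x
    using that e_diff[OF bV bV] e_b by simp
  have mem: "- v \<in> W i j \<longleftrightarrow> v \<in> W i j" if "i \<in> I" "j \<in> I" "i \<noteq> j" for v i j
    using subspace_neg_iff[OF W(1)[OF that]] .
  have AW: "A \<subseteq> W i j" if "i \<in> I" "j \<in> I" for i j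
    using that A e_A by (auto simp: W_def)
  show ?thesis
  proof (cases "\<exists>i\<in>I. \<exists>j\<in>I. i \<noteq> j \<and> b i - b j \<in> R")
    case True
    then obtain i j where ij: "i \<in> I" "j \<in> I" "i \<noteq> j" "b i - b j \<in> R" by blast
    have ji: "b j - b i \<in> R" using R(3)[OF ij(4)] by simp
    \<comment> \<open>By \<open>conflict2\<close> neither \<open>y + b i\<close> nor
      \<open>y + b j\<close> is red, and by \<open>conflict1\<close> no red difference shares just
      one index with the pair. Three points remain off the hyperplane.\<close>
    have "R - W i j \<subseteq> {b i, - b i, b j, - b j, b i - b j, - (b i - b j)}"
    proof
      fix z assume z: "z \<in> R - W i j"
      then have "z \<in> R" "z \<notin> A" using AW[OF ij(1,2)] by auto
      have b_off: "l = i \<or> l = j" if "l \<in> I" "b l \<notin> W i j" for l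
        using that ij e_b bV by (auto simp: W_def split: if_splits)
      have y_in: "y \<in> W i j" using yV y(2) ij by (auto simp: W_def)
      have yb_in: "y + b l \<in> W i j" if "l \<in> I" "y + b l \<in> R \<or> - (y + b l) \<in> R" for l
      proof -
        have "y + b l \<in> R" using that(2) R(3) by (metis minus_minus)
        then have "l \<noteq> i" "l \<noteq> j" using conflict2 ij ji by metis+
        then show ?thesis
          using that ij eyb gf3.subspace_add[OF V(1) yV bV] by (auto simp: W_def)
      qed
      have db_in: "b p - b q \<in> W i j \<or> {p, q} = {i, j}" if "p \<in> I" "q \<in> I" "p \<noteq> q" "b p - b q \<in> R" for p q
      proof (cases "p \<in> {i, j} \<or> q \<in> {i, j}")
        case True
        have qp: "b q - b p \<in> R" using R(3)[OF that(4)] by simp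
        then show ?thesis using True conflict1[of p q] conflict1[of q p] that ij ji by blast
      next
        case False
        then show ?thesis using edb[OF that(1,2)] that ij gf3.subspace_diff[OF V(1) bV bV] by (auto simp: W_def)
      qed
      have "\<not> (\<exists>l\<in>I. z = y + b l \<or> z = - (y + b l))"
        using yb_in mem[OF ij(1,2,3)] z by blast
      with classification[OF m \<open>z \<in> R\<close> \<open>z \<notin> A\<close>] z
      show "z \<in> {b i, - b i, b j, - b j, b i - b j, - (b i - b j)}"
        using b_off y_in db_in mem[OF ij(1,2,3)] \<open>z \<in> R\<close>
        by (elim disjE bexE conjE) (auto simp: doubleton_eq_iff)
    qed
    then have "card (R - W i j) \<le> card {b i, - b i, b j, - b j, b i - b j, - (b i - b j)}"
      by (intro card_mono) auto
    also have "\<dots> \<le> 6" by (rule card_six)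
    finally show ?thesis using W[OF ij(1-3)] by blast
  next
    case False
    have "\<exists>l. \<forall>j\<in>I. y + b j \<in> R \<longrightarrow> j = l" using conflict3 by metis
    then obtain l where l: "\<And>j. j \<in> I \<Longrightarrow> y + b j \<in> R \<Longrightarrow> j = l" by blast
    have "card (I - {l}) \<ge> 2" using m I by (auto simp: card_Diff_singleton_if)
    then have "\<not> card (I - {l}) \<le> Suc 0" by simp
    then obtain i j where "i \<in> I - {l}" "j \<in> I - {l}" "i \<noteq> j"
      using I by (subst (asm) card_le_Suc0_iff_eq) auto
    then have ij: "i \<in> I" "j \<in> I" "i \<noteq> j" "i \<noteq> l" "j \<noteq> l" by auto
    \<comment> \<open>Only two points are off the hyperplane here; the second one is listed twice to
      fit the bound for six vectors.\<close>
    have "R - W i j \<subseteq> {b i, - b i, b j, - b j, b j, - b j}"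
    proof
      fix z assume z: "z \<in> R - W i j"
      then have "z \<in> R" "z \<notin> A" using AW[OF ij(1,2)] by auto
      have b_off: "k = i \<or> k = j" if "k \<in> I" "b k \<notin> W i j" for k
        using that ij e_b bV by (auto simp: W_def split: if_splits)
      have y_in: "y \<in> W i j" using yV y(2) ij by (auto simp: W_def)
      have yb_in: "y + b k \<in> W i j" if "k \<in> I" "y + b k \<in> R \<or> - (y + b k) \<in> R" for k
      proof -
        have "y + b k \<in> R" using that(2) R(3) by (metis minus_minus)
        then have "k \<noteq> i" "k \<noteq> j" using l that ij by metis+
        then show ?thesis
          using that ij eyb gf3.subspace_add[OF V(1) yV bV] by (auto simp: W_def)
      qed
      have "\<not> (\<exists>k\<in>I. z = y + b k \<or> z = - (y + b k))"
        using yb_in mem[OF ij(1,2,3)] z by blast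
      with classification[OF m \<open>z \<in> R\<close> \<open>z \<notin> A\<close>] z
      show "z \<in> {b i, - b i, b j, - b j, b j, - b j}"
        using b_off y_in False mem[OF ij(1,2,3)] \<open>z \<in> R\<close>
        by (elim disjE bexE conjE) auto
    qed
    then have "card (R - W i j) \<le> card {b i, - b i, b j, - b j, b j, - b j}"
      by (intro card_mono) auto
    also have "\<dots> \<le> 6" by (rule card_six)
    finally show ?thesis using W[OF ij(1-3)] by blast
  qed
qed

text \<open>In codimension two exactly four hyperplanes contain \<open>A\<close>: \<open>?W\<close>
  and the three spaces \<open>?S t\<close>. The red vectors off \<open>?W\<close> are in the latter,
  and each of these has at most two off \<open>A\<close>.\<close>

lemma few_off_hyperplane_2:
  assumes "card I = 2"
  shows "\<exists>W. gf3.subspace W \<and> W \<subseteq> V \<and> card V = 3 * card W \<and> card (R - W) \<le> 6"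
proof -
  obtain x1 x2 where x: "I = {x1, x2}" "x1 \<noteq> x2" using assms by (metis card_2_iff)
  let ?W = "gf3.span (insert (b x1) A)"
  let ?S = "\<lambda>t. gf3.span (insert (b x2 + gf3_scale t (b x1)) A)"
  have bx: "b x1 \<in> V" "b x1 \<notin> A" "b x2 \<in> V" "b x2 \<notin> A" using x b bV by auto
  have W: "card ?W = 3 * card A" "?W \<subseteq> V"
    using card_span_insert[OF A(1) finA bx(2)] bx A V gf3.span_minimal[of "insert (b x1) A" V] by auto
  have cV: "card V = 3 * card ?W" using I(2) assms W by simp
  let ?q = "\<lambda>t. b x2 + gf3_scale t (b x1)"
  have q: "?q t \<in> V" "?q t \<notin> A" for t
  proof -
    show qV: "?q t \<in> V" using bx V by (intro gf3.subspace_add gf3.subspace_scale) auto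
    have tV: "gf3_scale t (b x1) \<in> V" using bx V by (intro gf3.subspace_scale) auto
    have "e (gf3_scale t (b x1)) x2 = 0"
      using e_b[of x1 x2] e_minus[OF bx(1), of x2] x e_A[OF gf3.subspace_0[OF A(1)], of x2]
      by (cases t rule: gf3_cases) auto
    then have "e (?q t) x2 = 1" using e_add[OF bx(3) tV, of x2] e_b[of x2 x2] x by simp
    then show "?q t \<notin> A" using e_A[of "?q t" x2] x by auto
  qed
  have "R - ?W \<subseteq> (\<Union>t. R \<inter> ?S t - A)"
  proof
    fix v assume v: "v \<in> R - ?W"
    then have vV: "v \<in> V" using R by auto
    have "A \<subseteq> ?W" using gf3.span_superset by blast
    then have vA: "v \<notin> A" using v by auto
    let ?c = "e v x1" and ?d = "e v x2"
    have veq: "v = ap v + (gf3_scale ?c (b x1) + gf3_scale ?d (b x2))"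
      using decomp_eq[of v] x by simp
    have d: "?d \<noteq> 0"
    proof
      assume "?d = 0"
      then have "v = ap v + gf3_scale ?c (b x1)" using veq by simp
      moreover have "ap v + gf3_scale ?c (b x1) \<in> ?W"
        using ap_in[OF vV] by (intro gf3.span_add gf3.span_scale gf3.span_base) auto
      ultimately show False using v by simp
    qed
    have "gf3_scale ?d (?q (?d * ?c)) = gf3_scale ?c (b x1) + gf3_scale ?d (b x2)"
      using gf3_mult_self[OF d] by (simp add: gf3.scale_right_distrib mult.assoc[symmetric] add.commute)
    then have "v = ap v + gf3_scale ?d (?q (?d * ?c))" using veq by simp
    moreover have "ap v + gf3_scale ?d (?q (?d * ?c)) \<in> ?S (?d * ?c)"
      using ap_in[OF vV] by (intro gf3.span_add gf3.span_scale gf3.span_base) auto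
    ultimately show "v \<in> (\<Union>t. R \<inter> ?S t - A)" using v vA by auto
  qed
  moreover have "finite R" using R V finite_subset by blast
  ultimately have "card (R - ?W) \<le> card (\<Union>t. R \<inter> ?S t - A)" by (intro card_mono) auto
  also have "\<dots> \<le> (\<Sum>t\<in>UNIV. card (R \<inter> ?S t - A))" by (intro card_UN_le) simp
  also have "\<dots> \<le> (\<Sum>t\<in>(UNIV :: gf3 set). 2)" using few_above[OF q] by (intro sum_mono) auto
  also have "\<dots> = 6" by simp
  finally show ?thesis using W cV gf3.subspace_span by blast
qed

end

lemma (in split_hyperplanes) few_off_hyperplane:
  "\<exists>W. gf3.subspace W \<and> W \<subseteq> V \<and> card V = 3 * card W \<and> card (R - W) \<le> 6"
proof -
  obtain A where A: "gf3.subspace A" "A \<subset> V" "\<not> split R A" "card A \<ge> 3"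
    "\<And>B. gf3.subspace B \<Longrightarrow> A \<subset> B \<Longrightarrow> B \<subset> V \<Longrightarrow> split R B"
    using maximal_unsplit by blast
  interpret maximal_unsplit V R A using A by unfold_locales
  obtain I b e y where "unsplit_coordinates V R A I b e y" using coordinates by blast
  then interpret unsplit_coordinates V R A I b e y .
  \<comment> \<open>Codimension 0 would mean \<open>A = V\<close>, and codimension 1 is impossible
    because hyperplanes are split.\<close>
  have "card I \<noteq> 0" using I(2) A(2) V by (auto dest: card_subset_eq[OF V(2)])
  moreover have "card I \<noteq> 1" using I(2) not_index3 by auto
  ultimately consider "card I = 2" | "card I \<ge> 3" by linarith
  then show ?thesis using few_off_hyperplane_2 few_off_hyperplane_ge3 by cases
qed

section \<open>Two-colourings of a projective space in which all proper subspaces split\<close>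

lemma split_restrict:
  assumes "split S W" "gf3.subspace K" "K \<subseteq> W" "\<not> split S K"
  obtains A B where "gf3.subspace A" "gf3.subspace B" "A \<subset> W" "B \<subset> W" "A \<inter> B = {0}" "S \<inter> W \<subseteq> A \<union> B" "K \<subseteq> A"
  using subspace_with_split[OF assms(2,3,4,1)] by blast

text \<open>An unsplit hyperplane \<open>K\<close> of \<open>W\<close> fills one piece of the
  splitting, so the other piece is at most a point.\<close>

lemma few_off_unsplit:
  assumes "split S W" "gf3.subspace W" "finite W" "gf3.subspace K" "K \<subseteq> W" "card W = 3 * card K" "\<not> split S K"
  shows "card (S \<inter> W - K) \<le> 2"
proof -
  obtain A B where AB: "gf3.subspace A" "gf3.subspace B" "A \<subset> W" "B \<subset> W" "A \<inter> B = {0}" "S \<inter> W \<subseteq> A \<union> B" "K \<subseteq> A"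
    using split_restrict assms by metis
  have KA: "K = A" using index3_maximal[of K A W] AB assms by auto
  have "card B \<le> 3" using card_meet_zero_index3_le[of K B W] AB assms KA by (auto simp: Int_commute)
  moreover have "finite B" using AB assms finite_subset by blast
  ultimately obtain p where p: "B = {0, p, - p}" using small_subspace AB by blast
  have "S \<inter> W - K \<subseteq> {p, - p}" using AB(6) p KA gf3.subspace_0[OF AB(1)] by auto
  then have "card (S \<inter> W - K) \<le> card {p, - p}" by (intro card_mono) auto
  also have "\<dots> \<le> 2" by (simp add: card_insert_if)
  finally show ?thesis .
qed

lemma card_subspace_pos: "gf3.subspace A \<Longrightarrow> finite A \<Longrightarrow> card A > 0"
  using gf3.subspace_0 card_gt_0_iff by blast

text \<open>One piece is \<open>K\<close> and the other at most a point. Likewise \<open>K'\<close>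
  fills a piece, and by \<open>card W \<ge> 27\<close> it has at least nine vectors, too many for
  the small one.\<close>

lemma unsplit_unique:
  assumes W: "split S W" "gf3.subspace W" "finite W" "card W \<ge> 27"
    and K: "gf3.subspace K" "K \<subseteq> W" "card W = 3 * card K" "\<not> split S K"
    and K': "gf3.subspace K'" "K' \<subseteq> W" "card W = 3 * card K'" "\<not> split S K'"
  shows "K = K'"
proof -
  obtain A B where AB: "gf3.subspace A" "gf3.subspace B" "A \<subset> W" "B \<subset> W" "A \<inter> B = {0}" "S \<inter> W \<subseteq> A \<union> B" "K \<subseteq> A"
    using split_restrict[OF W(1) K(1,2,4)] by blast
  have KA: "K = A" using index3_maximal[of K A W] AB K W by auto
  have "K' \<subseteq> A \<or> K' \<subseteq> B"
  proof (rule ccontr)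
    assume "\<not> ?thesis"
    then have "split S K'" using AB K' gf3.subspace_0[OF K'(1)]
      by (intro splitI[of "K' \<inter> A" "K' \<inter> B"]) (auto intro: gf3.subspace_inter)
    then show False using K' by blast
  qed
  then show ?thesis
  proof
    assume "K' \<subseteq> A"
    then show ?thesis using index3_maximal[of K' A W] AB K' W KA by auto
  next
    assume "K' \<subseteq> B"
    then have "K' = B" using index3_maximal[of K' B W] AB K' W by auto
    then have "card B \<le> 3" using card_meet_zero_index3_le[of K B W] AB W K KA by (auto simp: Int_commute)
    then show ?thesis using \<open>K' = B\<close> K'(3) W(4) by simp
  qed
qed

text \<open>For nonzero pieces, expand the nonnegative product of \<open>card A - 3\<close> and
  \<open>card B - 3\<close> and use \<open>card A * card B \<le> card U\<close>. If one piece is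
  \<open>{0}\<close>, the other has at most a third of the vectors.\<close>

lemma card_split_pieces:
  assumes "gf3.subspace A" "gf3.subspace B" "gf3.subspace U" "finite U" "A \<subset> U" "B \<subset> U" "A \<inter> B = {0}"
  shows "3 * (card A + card B) \<le> card U + 9"
proof -
  have fin: "finite A" "finite B" using assms(5,6) by (auto intro: finite_subset[OF _ assms(4)])
  have le: "card A * card B \<le> card U" using card_subspace_sum_le[of A B U] assms by auto
  have A3: "3 * card A \<le> card U" "3 * card B \<le> card U" using card_proper_subspace_le assms by blast+
  have big: "card C = 1 \<or> card C \<ge> 3" if "gf3.subspace C" "finite C" for C
  proof (cases "C = {0}")
    case False
    then have "{0} \<subset> C" using gf3.subspace_0[OF that(1)] by auto
    then show ?thesis using card_proper_subspace_le[of "{0}" C] that by auto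
  qed simp
  consider "card A = 1" | "card B = 1" | "card A \<ge> 3" "card B \<ge> 3"
    using big assms fin by blast
  then show ?thesis
  proof cases
    case 3
    then obtain a b where "card A = 3 + a" "card B = 3 + b" using le_Suc_ex by blast
    then show ?thesis using le by (simp add: algebra_simps)
  qed (use A3 in auto)
qed

text \<open>The four pieces would cover all nonzero vectors, but by \<open>card_split_pieces\<close>
  their sizes add up to at most two thirds of \<open>card U\<close> plus 6. This is too little from
  27 vectors on, though not for 9.\<close>

lemma not_both_split:
  assumes U: "gf3.subspace U" "finite U" "card U \<ge> 27" "U - {0} \<subseteq> R \<union> G"
  shows "\<not> (split R U \<and> split G U)"
proof
  assume "split R U \<and> split G U"
  then obtain A B C D where
    AB: "gf3.subspace A" "gf3.subspace B" "A \<subset> U" "B \<subset> U" "A \<inter> B = {0}" "R \<inter> U \<subseteq> A \<union> B" and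
    CD: "gf3.subspace C" "gf3.subspace D" "C \<subset> U" "D \<subset> U" "C \<inter> D = {0}" "G \<inter> U \<subseteq> C \<union> D"
    unfolding split_def by metis
  have fin: "finite A" "finite B" "finite C" "finite D"
    using AB(3,4) CD(3,4) by (auto intro: finite_subset[OF _ U(2)])
  have zero: "0 \<in> A" "0 \<in> B" "0 \<in> C" "0 \<in> D" using AB CD gf3.subspace_0 by auto
  let ?A = "A - {0}" and ?B = "B - {0}" and ?C = "C - {0}" and ?D = "D - {0}"
  have pos: "card A > 0" "card B > 0" "card C > 0" "card D > 0" using card_subspace_pos AB CD fin by auto
  have "U - {0} \<subseteq> ?A \<union> ?B \<union> ?C \<union> ?D" using U(4) AB(6) CD(6) by blast
  then have "card (U - {0}) \<le> card (?A \<union> ?B \<union> ?C \<union> ?D)" using fin by (intro card_mono) auto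
  also have "\<dots> \<le> card ?A + card ?B + card ?C + card ?D"
    by (intro order_trans[OF card_Un_le] add_mono order_refl)
  finally have "card U - 1 \<le> (card A - 1) + (card B - 1) + (card C - 1) + (card D - 1)"
    using zero fin U(1,2) gf3.subspace_0 by (simp add: card_Diff_singleton)
  then have "card U + 3 \<le> card A + card B + card C + card D" using pos U(3) by linarith
  moreover have "3 * (card A + card B) \<le> card U + 9" "3 * (card C + card D) \<le> card U + 9"
    using card_split_pieces AB CD U by blast+
  moreover have False if "u + 3 \<le> a + b + c + d" "3 * (a + b) \<le> u + 9" "3 * (c + d) \<le> u + 9" "27 \<le> u"
    for a b c d u :: nat
    using that by presburger
  ultimately show False using U(3) by blast
qed

section \<open>Hyperplanes as points of the dual space\<close>

abbreviation hyper :: "nat \<Rightarrow> gf3_vec \<Rightarrow> gf3_vec set" where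
  "hyper r u \<equiv> annih r {u}"

lemma span_subset_space: "S \<subseteq> gf3_space r \<Longrightarrow> gf3.span S \<subseteq> gf3_space r"
  by (rule gf3.span_minimal) auto

lemma card_hyper:
  assumes "u \<in> gf3_space r" "u \<noteq> 0"
  shows "card (gf3_space r) = 3 * card (hyper r u)"
proof -
  have "card (gf3.span {u}) = 3" using assms by (simp add: span_single_gf3)
  then show ?thesis
    using card_annih[OF gf3.subspace_span span_subset_space[of "{u}"]] assms
    by (simp add: annih_span card_gf3_space)
qed

text \<open>Independent \<open>u\<close> and \<open>w\<close> span a line of the dual space, whose
  points are the four hyperplanes through the codimension-two subspace
  \<open>annih r {u, w}\<close>.\<close>

lemma card_pencil:
  assumes "u \<in> gf3_space r" "w \<in> gf3_space r" "u \<noteq> 0" "w \<notin> gf3.span {u}"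
  shows "card (hyper r u) = 3 * card (annih r {u, w})"
proof -
  have "card (gf3.span {u}) = 3" using assms by (simp add: span_single_gf3)
  moreover have "finite (gf3.span {u})" by (simp add: span_single_gf3)
  ultimately have c: "card (gf3.span {u, w}) = 9"
    using card_span_insert(2)[OF gf3.subspace_span _ assms(4)] by (simp add: insert_commute span_insert_span)
  have "gf3.span {u, w} \<subseteq> gf3_space r" using assms by (intro span_subset_space) auto
  then have "9 * card (annih r {u, w}) = 3 ^ r" using card_annih[of "gf3.span {u, w}" r] c by (simp add: annih_span)
  then show ?thesis using card_hyper[OF assms(1,3)] by (simp add: card_gf3_space)
qed

lemma span_eq_if_pencil_eq:
  assumes "u \<in> gf3_space r" "w \<in> gf3_space r" "w' \<in> gf3_space r" "annih r {u, w} = annih r {u, w'}"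
  shows "gf3.span {u, w} = gf3.span {u, w'}"
proof -
  have "gf3.span {u, w} \<subseteq> gf3_space r" "gf3.span {u, w'} \<subseteq> gf3_space r"
    using assms span_subset_space[of "{u, w}"] span_subset_space[of "{u, w'}"] by auto
  then show ?thesis using annih_annih assms(4) annih_span gf3.subspace_span by metis
qed

text \<open>The annihilator of a hyperplane has three vectors, so any nonzero one of them describes
  it.\<close>

lemma hyper_exists:
  assumes "gf3.subspace W" "W \<subseteq> gf3_space r" "card (gf3_space r) = 3 * card W"
  obtains u where "u \<in> gf3_space r" "u \<noteq> 0" "W = hyper r u"
proof -
  have W: "card W > 0" using assms card_subspace_pos finite_subset finite_gf3_space by metis
  have "card W * card (annih r W) = card W * 3"
    using card_annih[OF assms(1,2)] assms(3) by (simp only: card_gf3_space mult.commute)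
  then have c3: "card (annih r W) = 3" using W by simp
  then have "annih r W \<noteq> {0}" by auto
  then obtain u where u: "u \<in> annih r W" "u \<noteq> 0" using gf3.subspace_0[OF subspace_annih] by blast
  have "gf3.span {u} \<subseteq> annih r W" using u by (intro gf3.span_minimal) auto
  moreover have "card (gf3.span {u}) = 3" using u by (simp add: span_single_gf3)
  ultimately have "gf3.span {u} = annih r W" using c3 card_subset_eq[OF finite_annih] by metis
  then have "W = hyper r u" using annih_annih[OF assms(1,2)] annih_span by metis
  then show ?thesis using that u annih_subset by blast
qed

text \<open>Colour classes contain both signs of each vector, so six vectors are three points.\<close>

locale two_coloring =
  fixes r :: nat and R G :: "gf3_vec set"
  assumes cover: "R \<union> G = gf3_space r - {0}" and disjoint: "R \<inter> G = {}"
    and sym: "\<And>v. v \<in> R \<Longrightarrow> - v \<in> R" "\<And>v. v \<in> G \<Longrightarrow> - v \<in> G"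
    and proper_split: "\<And>U. gf3.subspace U \<Longrightarrow> U \<subset> gf3_space r \<Longrightarrow> card U \<ge> 9 \<Longrightarrow> split R U \<or> split G U"
    and many: "\<And>W. gf3.subspace W \<Longrightarrow> W \<subseteq> gf3_space r \<Longrightarrow> card (gf3_space r) = 3 * card W \<Longrightarrow> 6 < card (R - W)"
      "\<And>W. gf3.subspace W \<Longrightarrow> W \<subseteq> gf3_space r \<Longrightarrow> card (gf3_space r) = 3 * card W \<Longrightarrow> 6 < card (G - W)"
begin

lemma swap: "two_coloring r G R"
proof
  show "G \<union> R = gf3_space r - {0}" using cover by (simp add: Un_commute)
  show "G \<inter> R = {}" using disjoint by (simp add: Int_commute)
  show "split G U \<or> split R U" if "gf3.subspace U" "U \<subset> gf3_space r" "card U \<ge> 9" for U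
    using proper_split[OF that] by (simp add: disj_commute)
qed (use sym many in auto)

end

section \<open>Dimension at least five: all hyperplanes split the same colour\<close>

locale two_coloring_ge5 = two_coloring +
  assumes r5: "r \<ge> 5"
begin

lemma swap5: "two_coloring_ge5 r G R"
  using swap r5 by (simp add: two_coloring_ge5_def two_coloring_ge5_axioms_def)

lemma card_space: "card (gf3_space r) \<ge> 243"
proof -
  have "(3::nat) ^ 5 \<le> 3 ^ r" using r5 by (intro power_increasing) auto
  then show ?thesis by (simp add: card_gf3_space)
qed

text \<open>Codimension-two subspaces now have at least 27 vectors, so \<open>not_both_split\<close>
  gives each of them exactly one colour.\<close>

lemma pencil:
  assumes "u \<in> gf3_space r" "w \<in> gf3_space r" "u \<noteq> 0" "w \<notin> gf3.span {u}"
  shows "annih r {u, w} \<subseteq> hyper r u" "annih r {u, w} \<subset> gf3_space r" "card (annih r {u, w}) \<ge> 27"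
    "split R (annih r {u, w}) \<noteq> split G (annih r {u, w})"
proof -
  show sub: "annih r {u, w} \<subseteq> hyper r u" by (auto simp: annih_def)
  have c: "card (gf3_space r) = 9 * card (annih r {u, w})"
    using card_hyper[OF assms(1,3)] card_pencil[OF assms] by simp
  then show big: "card (annih r {u, w}) \<ge> 27" using card_space by simp
  have "annih r {u, w} \<noteq> gf3_space r"
  proof
    assume eq: "annih r {u, w} = gf3_space r"
    show False using c card_space unfolding eq by linarith
  qed
  then show psub: "annih r {u, w} \<subset> gf3_space r" using annih_subset by blast
  have "annih r {u, w} - {0} \<subseteq> R \<union> G" using annih_subset cover by blast
  then show "split R (annih r {u, w}) \<noteq> split G (annih r {u, w})"
    using not_both_split[OF subspace_annih finite_annih big] proper_split[OF subspace_annih psub] big by auto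
qed

text \<open>The hyperplanes through \<open>?K\<close> other than \<open>hyper r p\<close> belong to
  the vectors \<open>w + t p\<close>. If none of them split \<open>G\<close>, all would split
  \<open>R\<close> while \<open>?K\<close> does not, so each would have at most one red point off
  \<open>?K\<close>. These are all the red points off \<open>hyper r p\<close>, contrary to
  \<open>many\<close>.\<close>

lemma other_point:
  assumes p: "p \<in> gf3_space r" "p \<noteq> 0" and w: "w \<in> gf3_space r" "w \<notin> gf3.span {p}"
    and G: "split G (annih r {p, w})"
  obtains t where "split G (hyper r (w + gf3_scale t p))"
proof (rule ccontr)
  assume "\<not> thesis"
  with that have none: "\<not> split G (hyper r (w + gf3_scale t p))" for t by blast
  let ?w = "\<lambda>t. w + gf3_scale t p"
  let ?K = "annih r {p, w}"
  have few: "card (R \<inter> hyper r (?w t) - ?K) \<le> 2" for t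
  proof -
    have wV: "?w t \<in> gf3_space r"
      using p w by (intro gf3.subspace_add[OF subspace_gf3_space] gf3.subspace_scale[OF subspace_gf3_space])
    have wp: "?w t \<notin> gf3.span {p}"
    proof
      assume "?w t \<in> gf3.span {p}"
      then have "?w t - gf3_scale t p \<in> gf3.span {p}"
        by (rule gf3.span_diff) (auto intro: gf3.span_scale gf3.span_base)
      then show False using w by simp
    qed
    then have w0: "?w t \<noteq> 0" using gf3.span_zero by metis
    have pw: "p \<notin> gf3.span {?w t}"
    proof
      assume "p \<in> gf3.span {?w t}"
      then have "p = ?w t \<or> p = - ?w t" using p unfolding span_single_gf3 by auto
      then have "?w t = p \<or> ?w t = - p" by (metis minus_minus)
      then show False using wp unfolding span_single_gf3 by auto
    qed
    have K: "?K = annih r {?w t, p}"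
    proof -
      have "gf3.span {p, w} = gf3.span {?w t, p}"
      proof (rule gf3.span_eq[THEN iffD2], intro conjI)
        have "?w t - gf3_scale t p \<in> gf3.span {?w t, p}"
          by (rule gf3.span_diff) (auto intro: gf3.span_scale gf3.span_base)
        then show "{p, w} \<subseteq> gf3.span {?w t, p}" by (auto intro: gf3.span_base)
        show "{?w t, p} \<subseteq> gf3.span {p, w}" by (auto intro!: gf3.span_add gf3.span_scale intro: gf3.span_base)
      qed
      then show ?thesis by (metis annih_span)
    qed
    have cH: "card (hyper r (?w t)) = 3 * card ?K" using card_pencil[OF wV p(1) w0 pw] K by simp
    have c: "card (gf3_space r) = 3 * card (hyper r (?w t))" using card_hyper[OF wV w0] .
    moreover have "hyper r (?w t) \<noteq> gf3_space r"
    proof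
      assume eq: "hyper r (?w t) = gf3_space r"
      show False using c card_space unfolding eq by linarith
    qed
    ultimately have "hyper r (?w t) \<subset> gf3_space r" using annih_subset by blast
    then have "split R (hyper r (?w t))"
      using none proper_split[of "hyper r (?w t)"] c card_space by auto
    moreover have "\<not> split R ?K" using pencil(4)[OF p(1) w(1) p(2) w(2)] G by simp
    moreover have "?K \<subseteq> hyper r (?w t)" unfolding K by (auto simp: annih_def)
    ultimately show ?thesis using few_off_unsplit[OF _ subspace_annih finite_annih subspace_annih _ cH] by blast
  qed
  have "R - hyper r p \<subseteq> (\<Union>t. R \<inter> hyper r (?w t) - ?K)"
  proof
    fix v assume v: "v \<in> R - hyper r p"
    then have vV: "v \<in> gf3_space r" using cover by auto
    then have d: "dot r p v \<noteq> 0" using v by (auto simp: annih_def)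
    \<comment> \<open>Nonzero scalars are their own inverses, so for this \<open>t\<close> the
      vector \<open>w + t p\<close> is orthogonal to \<open>v\<close>.\<close>
    let ?t = "- (dot r w v * dot r p v)"
    have "dot r (gf3_scale t p) v = t * dot r p v" for t
      by (simp add: dot_def gf3_scale_def sum_distrib_left mult.assoc)
    then have "dot r (?w ?t) v = 0"
      using gf3_mult_self[OF d] by (simp add: dot_add dot_diff mult.assoc)
    then have "v \<in> R \<inter> hyper r (?w ?t) - ?K" using v vV d by (auto simp: annih_def)
    then show "v \<in> (\<Union>t. R \<inter> hyper r (?w t) - ?K)" by (rule UN_I[OF UNIV_I])
  qed
  then have "card (R - hyper r p) \<le> card (\<Union>t. R \<inter> hyper r (?w t) - ?K)"
    by (intro card_mono) auto
  also have "\<dots> \<le> (\<Sum>t\<in>UNIV. card (R \<inter> hyper r (?w t) - ?K))" by (intro card_UN_le) simp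
  also have "\<dots> \<le> (\<Sum>t\<in>(UNIV :: gf3 set). 2)" using few by (intro sum_mono) auto
  also have "\<dots> = 6" by simp
  finally show False using many(1)[OF subspace_annih annih_subset card_hyper[OF p]] by simp
qed

text \<open>This is \<open>unsplit_unique\<close> read dually: through a dual point whose hyperplane
  splits \<open>R\<close> there passes at most one dual line whose subspace does not.\<close>

lemma hyper_unsplit_unique:
  assumes u: "u \<in> gf3_space r" "u \<noteq> 0" "split R (hyper r u)"
    and w: "w \<in> gf3_space r" "w \<notin> gf3.span {u}" "\<not> split R (annih r {u, w})"
    and w': "w' \<in> gf3_space r" "w' \<notin> gf3.span {u}" "\<not> split R (annih r {u, w'})"
  shows "w' \<in> gf3.span {u, w}"
proof -
  have c: "card (hyper r u) \<ge> 27" using card_hyper[OF u(1,2)] card_space by simp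
  have "annih r {u, w} = annih r {u, w'}"
    using unsplit_unique[OF u(3) subspace_annih finite_annih c
        subspace_annih _ card_pencil[OF u(1) w(1) u(2) w(2)] w(3)
        subspace_annih _ card_pencil[OF u(1) w'(1) u(2) w'(2)] w'(3)]
    pencil(1)[OF u(1) w(1) u(2) w(2)] pencil(1)[OF u(1) w'(1) u(2) w'(2)] by blast
  then have "gf3.span {u, w} = gf3.span {u, w'}" by (rule span_eq_if_pencil_eq[OF u(1) w(1) w'(1)])
  moreover have "w' \<in> gf3.span {u, w'}" by (simp add: gf3.span_base)
  ultimately show ?thesis by simp
qed

text \<open>Let a dual point or line have the colour that is split in its subspace. Through each
  point there is at most one line of the opposite colour. The exceptional line \<open>p q\<close> at
  \<open>p\<close> confines all points of colour \<open>R\<close> to the span of four vectors, while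
  \<open>q\<close> has lines of colour \<open>R\<close> that leave it.\<close>

lemma two_colours_impossible:
  assumes p: "p \<in> gf3_space r" "p \<noteq> 0" "split G (hyper r p)"
    and q: "q \<in> gf3_space r" "q \<notin> gf3.span {p}" "split R (hyper r q)"
    and pq: "split R (annih r {p, q})"
  shows False
proof -
  interpret sw: two_coloring_ge5 r G R by (rule swap5)
  have sub1: "gf3.span {a} \<subseteq> gf3.span {a, b}" "gf3.span {b} \<subseteq> gf3.span {a, b}" for a b
    by (auto intro!: gf3.span_mono)
  have nG: "\<not> split G (annih r {p, q})" using pencil(4)[OF p(1) q(1) p(2) q(2)] pq by simp
  \<comment> \<open>At \<open>p\<close> the line to \<open>q\<close> is the one exception, so all
    others have colour \<open>G\<close>.\<close>
  have pG: "split G (annih r {p, w})" if "w \<in> gf3_space r" "w \<notin> gf3.span {p, q}" for w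
  proof (rule ccontr)
    assume "\<not> ?thesis"
    moreover have "w \<notin> gf3.span {p}" using that(2) sub1(1)[of p q] by blast
    ultimately have "w \<in> gf3.span {p, q}"
      using sw.hyper_unsplit_unique[OF p q(1,2) nG that(1)] by blast
    then show False using that(2) by blast
  qed
  \<comment> \<open>Dimension five enters here: four vectors span at most 81 of at least 243
    vectors.\<close>
  have small: "\<exists>x\<in>gf3_space r. x \<notin> gf3.span S" if "finite S" "card S \<le> 4" for S
  proof (rule ccontr)
    assume "\<not> ?thesis"
    then have "gf3_space r \<subseteq> gf3.span S" by auto
    then have "card (gf3_space r) \<le> card (gf3.span S)" using finite_span_gf3[OF that(1)] by (intro card_mono) auto
    also have "\<dots> \<le> 3 ^ card S" using finite_span_gf3[OF that(1)] by simp
    also have "\<dots> \<le> 3 ^ 4" using that(2) by (intro power_increasing) auto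
    finally show False using card_space by simp
  qed
  have "card {p, q} \<le> 4" by (simp add: card_insert_if)
  then obtain w where w: "w \<in> gf3_space r" "w \<notin> gf3.span {p, q}" using small[of "{p, q}"] by blast
  then obtain t where t: "split G (hyper r (w + gf3_scale t p))"
    using other_point[OF p(1,2) w(1) _ pG[OF w]] sub1[of p q] by blast
  define p' where "p' = w + gf3_scale t p"
  have p': "p' \<in> gf3_space r" "p' \<notin> gf3.span {p, q}" "split G (hyper r p')"
  proof -
    show "p' \<in> gf3_space r" unfolding p'_def
      using w p by (intro gf3.subspace_add[OF subspace_gf3_space] gf3.subspace_scale[OF subspace_gf3_space])
    show "p' \<notin> gf3.span {p, q}"
    proof
      assume "p' \<in> gf3.span {p, q}"
      then have "p' - gf3_scale t p \<in> gf3.span {p, q}"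
        by (rule gf3.span_diff) (auto intro: gf3.span_scale gf3.span_base)
      then show False using w by (simp add: p'_def)
    qed
    show "split G (hyper r p')" using t by (simp add: p'_def)
  qed
  have p'0: "p' \<noteq> 0" using p'(2) gf3.span_zero by metis
  have p'p: "p' \<notin> gf3.span {p}" using p' sub1[of p q] by blast
  \<comment> \<open>Such a point \<open>s\<close> of colour \<open>R\<close> is joined to
    \<open>p\<close> by a line of colour \<open>G\<close>, its only exception. Its line to
    \<open>p'\<close> is a different one and therefore has colour \<open>R\<close>.\<close>
  have red: "split R (annih r {p', s})" "s \<notin> gf3.span {p'}"
    if s: "s \<in> gf3_space r" "split R (hyper r s)" "s \<notin> gf3.span {p, q}" "s \<notin> gf3.span {p, p'}" for s
  proof -
    show s': "s \<notin> gf3.span {p'}" using s(4) sub1(2)[of p' p] by blast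
    have s0: "s \<noteq> 0" using s(3) gf3.span_zero by metis
    have flip: "b \<notin> gf3.span {a}" if "a \<notin> gf3.span {b}" "b \<noteq> 0" for a b
      using that gf3.in_span_insert[of b a "{}"] unfolding gf3.span_empty by blast
    have ps: "p \<notin> gf3.span {s}" using flip[of s p] s(3) sub1[of p q] p(2) by blast
    have p's: "p' \<notin> gf3.span {s}" using flip[of s p'] s' p'0 by blast
    have sp: "s \<notin> gf3.span {p}" using s(3) sub1[of p q] by blast
    have "\<not> split R (annih r {s, p})"
      using pG[OF s(1,3)] pencil(4)[OF p(1) s(1) p(2) sp] by (simp add: insert_commute)
    moreover have "p' \<notin> gf3.span {s, p}"
    proof
      assume "p' \<in> gf3.span {s, p}"
      then have "s \<in> gf3.span (insert p' {p})"
        using gf3.in_span_insert[of p' s "{p}"] p'p by simp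
      then show False using s(4) by (simp add: insert_commute)
    qed
    ultimately have "split R (annih r {s, p'})"
      using hyper_unsplit_unique[OF s(1) s0 s(2) p(1) ps _ p'(1) p's] by blast
    then show "split R (annih r {p', s})" by (simp add: insert_commute)
  qed
  \<comment> \<open>Those lines of colour \<open>R\<close> are exceptional at \<open>p'\<close>, so
    they all coincide. If no such point exists, any \<open>s\<close> will do.\<close>
  have "\<exists>s. \<forall>q'. q' \<in> gf3_space r \<longrightarrow> split R (hyper r q') \<longrightarrow> q' \<notin> gf3.span {p, q} \<longrightarrow>
      q' \<notin> gf3.span {p, p'} \<longrightarrow> q' \<in> gf3.span {p', s}"
  proof (cases "\<exists>s. s \<in> gf3_space r \<and> split R (hyper r s) \<and> s \<notin> gf3.span {p, q} \<and> s \<notin> gf3.span {p, p'}")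
    case True
    then obtain s where s: "s \<in> gf3_space r" "split R (hyper r s)" "s \<notin> gf3.span {p, q}" "s \<notin> gf3.span {p, p'}"
      by blast
    have "q' \<in> gf3.span {p', s}"
      if q': "q' \<in> gf3_space r" "split R (hyper r q')" "q' \<notin> gf3.span {p, q}" "q' \<notin> gf3.span {p, p'}" for q'
    proof -
      have "\<not> split G (annih r {p', s})" "\<not> split G (annih r {p', q'})"
        using red[OF s] red[OF q'] pencil(4)[OF p'(1) s(1) p'0] pencil(4)[OF p'(1) q'(1) p'0] by auto
      then show ?thesis
        using sw.hyper_unsplit_unique[OF p'(1) p'0 p'(3) s(1) red(2)[OF s] _ q'(1) red(2)[OF q']] by blast
    qed
    then show ?thesis by blast
  qed blast
  then obtain s where s: "\<And>q'. q' \<in> gf3_space r \<Longrightarrow> split R (hyper r q') \<Longrightarrow> q' \<notin> gf3.span {p, q} \<Longrightarrow>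
      q' \<notin> gf3.span {p, p'} \<Longrightarrow> q' \<in> gf3.span {p', s}" by blast
  let ?X = "gf3.span {p, q, p', s}"
  have inX: "q' \<in> ?X" if "q' \<in> gf3_space r" "split R (hyper r q')" for q'
    using s[OF that] gf3.span_mono[of "{p, q}" "{p, q, p', s}"] gf3.span_mono[of "{p, p'}" "{p, q, p', s}"]
      gf3.span_mono[of "{p', s}" "{p, q, p', s}"] by blast
  have "card {p, q, p', s} \<le> 4" by (simp add: card_insert_if)
  then obtain x where x: "x \<in> gf3_space r" "x \<notin> ?X" using small[of "{p, q, p', s}"] by blast
  have pX: "p \<in> ?X" "q \<in> ?X" by (auto intro: gf3.span_base)
  have q0: "q \<noteq> 0" using q(2) gf3.span_zero by metis
  have xp: "x + p \<in> gf3_space r" "x + p \<notin> ?X"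
    using x p gf3.subspace_add[OF subspace_gf3_space] gf3.span_add_eq2[OF pX(1)] by auto
  have qX: "gf3.span {q} \<subseteq> ?X" using gf3.span_mono[of "{q}" "{p, q, p', s}"] by auto
  \<comment> \<open>The vectors \<open>x\<close> and \<open>x + p\<close> lie on different dual
    lines through \<open>q\<close>, and at most one of these fails to have colour
    \<open>R\<close>.\<close>
  have "\<exists>x'\<in>{x, x + p}. split R (annih r {q, x'})"
  proof (rule ccontr)
    assume "\<not> ?thesis"
    then have "x + p \<in> gf3.span {q, x}"
      using hyper_unsplit_unique[OF q(1) q0 q(3) x(1) _ _ xp(1)] x xp qX by blast
    then have "(x + p) - x \<in> gf3.span {q, x}"
      by (rule gf3.span_diff) (auto intro: gf3.span_base)
    then have "p \<in> gf3.span {q, x}" by simp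
    moreover have "p \<notin> gf3.span {q}"
      using q(2) p(2) gf3.in_span_insert[of p q "{}"] unfolding gf3.span_empty by blast
    ultimately have "x \<in> gf3.span {p, q}"
      using gf3.in_span_insert[of p x "{q}"] by (simp add: insert_commute)
    then show False using x(2) gf3.span_mono[of "{p, q}" "{p, q, p', s}"] by blast
  qed
  then obtain x' where x': "x' \<in> gf3_space r" "x' \<notin> ?X" "split R (annih r {q, x'})" using x xp by blast
  then obtain t where t: "split R (hyper r (x' + gf3_scale t q))"
    using sw.other_point[OF q(1) q0 x'(1) _ x'(3)] qX by blast
  have "x' + gf3_scale t q \<in> gf3_space r"
    using x' q by (intro gf3.subspace_add[OF subspace_gf3_space] gf3.subspace_scale[OF subspace_gf3_space])
  then have "x' + gf3_scale t q \<in> ?X" using inX t by blast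
  then show False using x'(2) gf3.span_add_eq2[OF gf3.span_scale[OF pX(2)]] by blast
qed

text \<open>Otherwise there are dual points of both colours. The line joining them has one of the
  colours, and exchanging \<open>R\<close> with \<open>G\<close> and \<open>p\<close> with
  \<open>q\<close> makes the two cases the same.\<close>

lemma monochromatic: "(\<forall>u\<in>gf3_space r - {0}. split R (hyper r u)) \<or> (\<forall>u\<in>gf3_space r - {0}. split G (hyper r u))"
proof (rule ccontr)
  assume "\<not> ?thesis"
  then obtain p q where p: "p \<in> gf3_space r" "p \<noteq> 0" "\<not> split R (hyper r p)"
    and q: "q \<in> gf3_space r" "q \<noteq> 0" "\<not> split G (hyper r q)" by blast
  have one: "split R (hyper r u) \<noteq> split G (hyper r u)" if "u \<in> gf3_space r" "u \<noteq> 0" for u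
  proof -
    have c: "card (gf3_space r) = 3 * card (hyper r u)" using card_hyper[OF that] .
    then have c27: "card (hyper r u) \<ge> 27" using card_space by simp
    have "hyper r u \<noteq> gf3_space r"
    proof
      assume eq: "hyper r u = gf3_space r"
      show False using c card_space unfolding eq by linarith
    qed
    then have "hyper r u \<subset> gf3_space r" using annih_subset by blast
    then have "split R (hyper r u) \<or> split G (hyper r u)" using proper_split c27 by simp
    moreover have "hyper r u - {0} \<subseteq> R \<union> G" using annih_subset cover by blast
    then have "\<not> (split R (hyper r u) \<and> split G (hyper r u))"
      by (rule not_both_split[OF subspace_annih finite_annih c27])
    ultimately show ?thesis by blast
  qed
  have pG: "split G (hyper r p)" and qR: "split R (hyper r q)" using one p q by auto
  have "hyper r (- p) = hyper r p" by (auto simp: annih_def dot_minus)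
  then have "q \<noteq> p" "q \<noteq> - p" using p(3) qR by metis+
  then have qp: "q \<notin> gf3.span {p}" using q(2) unfolding span_single_gf3 by blast
  then have pq: "p \<notin> gf3.span {q}" using p(2) gf3.in_span_insert[of p q "{}"] unfolding gf3.span_empty by blast
  interpret sw: two_coloring_ge5 r G R by (rule swap5)
  show False
  proof (cases "split R (annih r {p, q})")
    case True
    then show False using two_colours_impossible[OF p(1,2) pG q(1) qp qR] by blast
  next
    case False
    then have "split G (annih r {q, p})"
      using pencil(4)[OF p(1) q(1) p(2) qp] by (simp add: insert_commute)
    then show False using sw.two_colours_impossible[OF q(1,2) qR p(1) pq pG] by blast
  qed
qed

end

section \<open>The case of dimension four\<close>

text \<open>A largest subspace over \<open>A0\<close> that avoids \<open>p\<close> is a hyperplane: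
  for \<open>x\<close> outside its span with \<open>p\<close>, the exchange property would let it be
  enlarged by \<open>x\<close> and still avoid \<open>p\<close>.\<close>

lemma index3_extension_avoiding:
  assumes A0: "gf3.subspace A0" "A0 \<subseteq> U" and U: "gf3.subspace U" "finite U" and p: "p \<in> U" "p \<notin> A0"
  obtains A where "gf3.subspace A" "A0 \<subseteq> A" "A \<subseteq> U" "p \<notin> A" "card U = 3 * card A"
proof -
  define P where "P A \<longleftrightarrow> gf3.subspace A \<and> A0 \<subseteq> A \<and> A \<subseteq> U \<and> p \<notin> A" for A
  have "P A0" using assms by (simp add: P_def)
  moreover have "\<forall>A. P A \<longrightarrow> card A < Suc (card U)" using U by (auto simp: P_def intro!: card_mono le_imp_less_Suc)
  ultimately obtain A where A: "P A" "\<And>B. P B \<Longrightarrow> card B \<le> card A"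
    using ex_has_greatest_nat[of P A0 card "Suc (card U)"] by blast
  then have A': "gf3.subspace A" "A0 \<subseteq> A" "A \<subseteq> U" "p \<notin> A" by (auto simp: P_def)
  have finA: "finite A" using A'(3) U(2) by (rule finite_subset)
  have spA: "gf3.span A = A" using A'(1) by simp
  have "U \<subseteq> gf3.span (insert p A)"
  proof (rule ccontr)
    assume "\<not> ?thesis"
    then obtain x where x: "x \<in> U" "x \<notin> gf3.span (insert p A)" by blast
    have xA: "x \<notin> A" using x(2) gf3.span_superset by blast
    have "p \<notin> gf3.span (insert x A)"
      using gf3.in_span_insert[of p x A] A'(4) x(2) spA by auto
    moreover have "gf3.span (insert x A) \<subseteq> U" using x A' U by (intro gf3.span_minimal) auto
    moreover have "A0 \<subseteq> gf3.span (insert x A)" using A'(2) gf3.span_superset[of "insert x A"] by blast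
    ultimately have "card (gf3.span (insert x A)) \<le> card A" using A(2) by (simp add: P_def)
    moreover have "card (gf3.span (insert x A)) = 3 * card A" by (rule card_span_insert(2)[OF A'(1) finA xA])
    ultimately show False using card_subspace_pos[OF A'(1) finA] by simp
  qed
  moreover have "gf3.span (insert p A) \<subseteq> U" using p A' U by (intro gf3.span_minimal) auto
  ultimately have "card U = 3 * card A" using card_span_insert(2)[OF A'(1) finA A'(4)] by auto
  then show ?thesis using that A' by blast
qed

text \<open>The sizes of the pieces multiply to at most 27, so the smaller piece is at most a point.
  The larger one can be enlarged to nine vectors without catching that point.\<close>

lemma split_dim3:
  assumes "split S U" "gf3.subspace U" "finite U" "card U = 27"
  obtains A b where "gf3.subspace A" "A \<subseteq> U" "card A = 9" "b \<in> U" "b \<notin> A" "S \<inter> U \<subseteq> A \<union> {b, - b}"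
proof -
  note result = that
  have aux: ?thesis if AB: "gf3.subspace A" "gf3.subspace B" "A \<subset> U" "B \<subset> U" "A \<inter> B = {0}" "S \<inter> U \<subseteq> A \<union> B"
    and le: "card B \<le> card A" for A B
  proof -
    have fin: "finite A" "finite B" using AB(3,4) by (auto intro: finite_subset[OF _ assms(3)])
    have "card A * card B \<le> 27" using card_subspace_sum_le[of A B U] AB assms by auto
    moreover have "9 * 9 \<le> card A * card B" if "9 \<le> card B" using that le by (intro mult_le_mono) auto
    ultimately have B8: "card B < 9" by fastforce
    have "card B \<le> 3"
    proof (cases "B = {0}")
      case False
      then obtain x where x: "x \<in> B" "x \<noteq> 0" using gf3.subspace_0[OF AB(2)] by auto
      have sp: "gf3.span {x} \<subseteq> B" using x AB(2) by (intro gf3.span_minimal) auto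
      have c3: "card (gf3.span {x}) = 3" using x by (simp add: span_single_gf3)
      show ?thesis
      proof (cases "gf3.span {x} = B")
        case False
        then have "gf3.span {x} \<subset> B" using sp by blast
        then have "3 * card (gf3.span {x}) \<le> card B"
          using card_proper_subspace_le[OF gf3.subspace_span AB(2)] fin by blast
        then show ?thesis using c3 B8 by simp
      qed (use c3 in simp)
    qed simp
    then obtain p where p: "B = {0, p, - p}" using small_subspace[OF AB(2) fin(2)] by blast
    \<comment> \<open>If the smaller piece is \<open>{0}\<close>, any vector outside
      \<open>A\<close> serves as the point.\<close>
    have "\<exists>q\<in>U - A. B \<subseteq> {0, q, - q}"
    proof (cases "p = 0")
      case True
      then show ?thesis using p AB(3) by auto
    next
      case False
      then have "p \<notin> A" "p \<in> U" using AB p by auto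
      then show ?thesis using p by auto
    qed
    then obtain q where q: "q \<in> U" "q \<notin> A" "B \<subseteq> {0, q, - q}" by blast
    obtain A' where A': "gf3.subspace A'" "A \<subseteq> A'" "A' \<subseteq> U" "q \<notin> A'" "card U = 3 * card A'"
      using index3_extension_avoiding[OF AB(1) _ assms(2,3) q(1,2)] AB(3) by blast
    have "S \<inter> U \<subseteq> A' \<union> {q, - q}" using AB(6) A'(2) q(3) gf3.subspace_0[OF A'(1)] by blast
    then show ?thesis using result[of A' q] A' q(1) assms(4) by simp
  qed
  obtain A B where AB: "gf3.subspace A" "gf3.subspace B" "A \<subset> U" "B \<subset> U" "A \<inter> B = {0}" "S \<inter> U \<subseteq> A \<union> B"
    using assms(1) unfolding split_def by blast
  show ?thesis
  proof (cases "card B \<le> card A")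
    case True
    then show ?thesis using aux[OF AB] by blast
  next
    case False
    have "B \<inter> A = {0}" "S \<inter> U \<subseteq> B \<union> A" using AB(5,6) by blast+
    then show ?thesis using aux[OF AB(2,1,4,3)] False by simp
  qed
qed

lemma coset_card_le:
  assumes "gf3.subspace A" "finite A"
  shows "3 * card {v \<in> A. dot r u v = 1} \<le> card A"
proof (cases "\<exists>x\<in>A. dot r u x \<noteq> 0")
  case True
  then obtain x where "x \<in> A" "dot r u x \<noteq> 0" by blast
  then show ?thesis using additive_fibre_card[OF assms, of "dot r u" x 1] by (simp add: dot_add)
next
  case False
  then have empty: "{v \<in> A. dot r u v = 1} = {}" by auto
  show ?thesis unfolding empty by simp
qed

text \<open>
  The coefficients come from \<open>45 * q + 3 * s^2 + 33 * (s^2 / 3) > 27 * s^2 + 54 * s\<close>: of the 81 functionals, at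
  least 45 have section sizes as below, three are constant on the \<open>s\<close> points, and the right-hand side is
  the sum of the second moments \<open>q\<close> over all functionals.
\<close>

lemma spread_numeric:
  fixes a b c :: nat
  assumes "a \<le> 1 \<or> 5 \<le> a" "b \<le> 1 \<or> 5 \<le> b" "c \<le> 1 \<or> 5 \<le> c" "4 \<le> a + b + c" "a + b + c \<le> 12"
  shows "39 * (a + b + c)^2 + 162 * (a + b + c) < 135 * (a^2 + b^2 + c^2)"
proof -
  have val: "x \<in> {0,1,5,6,7,8,9,10,11,12}" if "x \<le> 1 \<or> 5 \<le> x" "x \<le> 12" for x :: nat
    using that by auto
  have "a \<in> {0,1,5,6,7,8,9,10,11,12}" "b \<in> {0,1,5,6,7,8,9,10,11,12}" "c \<in> {0,1,5,6,7,8,9,10,11,12}"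
    using val assms by auto
  moreover have "\<forall>a\<in>{0,1,5,6,7,8,9,10,11,12::nat}. \<forall>b\<in>{0,1,5,6,7,8,9,10,11,12}. \<forall>c\<in>{0,1,5,6,7,8,9,10,11,12}.
    4 \<le> a + b + c \<longrightarrow> a + b + c \<le> 12 \<longrightarrow> 39 * (a + b + c)^2 + 162 * (a + b + c) < 135 * (a^2 + b^2 + c^2)"
    by simp
  ultimately show ?thesis using assms(4,5) by blast
qed

lemma sum_squares_ge: "(a + b + c)^2 \<le> 3 * (a^2 + b^2 + (c::nat)^2)"
proof -
  have "(int a + int b + int c)^2 \<le> 3 * ((int a)^2 + (int b)^2 + (int c)^2)"
    using sum_squares_ge_zero[of "int a - int b" "int b - int c"] zero_le_power2[of "int a - int c"]
    by (simp add: power2_eq_square algebra_simps)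
  then have "int ((a + b + c)^2) \<le> int (3 * (a^2 + b^2 + c^2))" by simp
  then show ?thesis by (simp only: of_nat_le_iff)
qed

lemma sum_gf3: "(\<Sum>t\<in>(UNIV :: gf3 set). f t) = f 0 + f 1 + f (-1)"
  unfolding UNIV_gf3 by (simp add: add.assoc)

locale two_coloring_4 = two_coloring 4 R G for R G +
  fixes u1
  assumes R40: "card R \<le> 40" and u1: "u1 \<in> gf3_space 4" "u1 \<noteq> 0" "split G (hyper 4 u1)"
begin

text \<open>One vector is taken from each red point off the hyperplane of \<open>u1\<close>,
  normalised to value 1 of the functional.\<close>

definition Q where "Q = {v \<in> R. dot 4 u1 v = 1}"

text \<open>Unless \<open>\<phi>\<close> is a multiple of \<open>u1\<close>, the values of
  \<open>c \<phi>\<close> are the sizes of the sections of \<open>Q\<close> by three parallel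
  planes.\<close>

definition c where "c \<phi> t = card {v \<in> Q. dot 4 \<phi> v = t}"

lemma fin: "finite R" "finite G" "finite Q"
proof -
  have "R \<subseteq> gf3_space 4" "G \<subseteq> gf3_space 4" using cover by auto
  then show "finite R" "finite G" using finite_subset finite_gf3_space by blast+
  then show "finite Q" by (simp add: Q_def)
qed

lemma Q_V: "Q \<subseteq> gf3_space 4"
  using cover by (auto simp: Q_def)

lemma card_V: "card (gf3_space 4) = 81" by (simp add: card_gf3_space)

lemma card_W1: "card (hyper 4 u1) = 27"
  using card_hyper[OF u1(1,2)] card_V by simp

lemma nonzero: "v \<in> R \<Longrightarrow> v \<noteq> 0" "v \<in> G \<Longrightarrow> v \<noteq> 0"
  using cover by auto

lemma W1_structure:
  obtains A b where "gf3.subspace A" "A \<subseteq> hyper 4 u1" "card A = 9" "b \<in> hyper 4 u1" "b \<notin> A"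
    "G \<inter> hyper 4 u1 \<subseteq> A \<union> {b, - b}"
  by (rule split_dim3[OF u1(3) subspace_annih finite_annih card_W1])

lemma card_off: "card (R - hyper 4 u1) = 2 * card Q"
proof -
  have "R - hyper 4 u1 = Q \<union> uminus ` Q"
  proof
    show "R - hyper 4 u1 \<subseteq> Q \<union> uminus ` Q"
    proof
      fix v assume v: "v \<in> R - hyper 4 u1"
      then have "dot 4 u1 v \<noteq> 0" using cover by (auto simp: annih_def)
      then have "dot 4 u1 v = 1 \<or> dot 4 u1 (- v) = 1" by (cases "dot 4 u1 v" rule: gf3_cases) (auto simp: dot_minus)
      then show "v \<in> Q \<union> uminus ` Q" using v sym(1)[of v] by (auto simp: Q_def intro: image_eqI[of _ _ "- v"])
    qed
    show "Q \<union> uminus ` Q \<subseteq> R - hyper 4 u1" using sym by (auto simp: Q_def annih_def dot_minus)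
  qed
  moreover have "Q \<inter> uminus ` Q = {}" by (auto simp: Q_def dot_minus)
  ultimately have "card (R - hyper 4 u1) = card Q + card (uminus ` Q)" using fin by (simp add: card_Un_disjoint)
  also have "card (uminus ` Q) = card Q" by (simp add: card_image)
  finally show ?thesis by simp
qed

text \<open>More than six red vectors lie off the hyperplane, which gives the lower bound. Of its 26
  nonzero vectors at most \<open>8 + 2\<close> are green, so at least 16 of the at most 40 red
  vectors lie inside and at most 24 outside. The bounds exclude the even distributions
  \<open>1, 1, 1\<close> and \<open>5, 5, 5\<close>, for which the inequality of
  \<open>spread_numeric\<close> fails.\<close>

lemma card_Q: "4 \<le> card Q" "card Q \<le> 12"
proof -
  show "4 \<le> card Q" using many(1)[OF subspace_annih annih_subset card_hyper[OF u1(1,2)]] card_off by simp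
  obtain A b where A: "gf3.subspace A" "A \<subseteq> hyper 4 u1" "card A = 9"
    "b \<in> hyper 4 u1" "b \<notin> A" "G \<inter> hyper 4 u1 \<subseteq> A \<union> {b, - b}"
    by (rule W1_structure)
  have fA: "finite A" using A(2) finite_annih by (rule finite_subset)
  have "G \<inter> hyper 4 u1 \<subseteq> (A - {0}) \<union> {b, - b}" using A(6) nonzero by blast
  then have "card (G \<inter> hyper 4 u1) \<le> card ((A - {0}) \<union> {b, - b})" using fA by (intro card_mono) auto
  also have "\<dots> \<le> card (A - {0}) + card {b, - b}" by (rule card_Un_le)
  also have "\<dots> \<le> 8 + 2"
    using A gf3.subspace_0[OF A(1)] fA by (intro add_mono) (auto simp: card_insert_if)
  finally have g: "card (G \<inter> hyper 4 u1) \<le> 10" by simp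
  have "hyper 4 u1 - {0} \<subseteq> (R \<inter> hyper 4 u1) \<union> (G \<inter> hyper 4 u1)" using cover annih_subset by blast
  then have "card (hyper 4 u1 - {0}) \<le> card ((R \<inter> hyper 4 u1) \<union> (G \<inter> hyper 4 u1))" by (intro card_mono) auto
  also have "\<dots> \<le> card (R \<inter> hyper 4 u1) + card (G \<inter> hyper 4 u1)" by (rule card_Un_le)
  finally have "26 \<le> card (R \<inter> hyper 4 u1) + card (G \<inter> hyper 4 u1)"
    using card_W1 gf3.subspace_0[OF subspace_annih[of 4 "{u1}"]] by simp
  then have "16 \<le> card (R \<inter> hyper 4 u1)" using g by simp
  moreover have "card R = card (R \<inter> hyper 4 u1) + card (R - hyper 4 u1)"
    using card_Int_Diff[OF fin(1)] .
  ultimately show "card Q \<le> 12" using R40 card_off by simp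
qed

text \<open>The section lies in the plane of \<open>w\<close>, which meets the plane of
  \<open>u1\<close> in the line \<open>K\<close>. As \<open>\<phi>\<close> vanishes neither at
  \<open>b\<close> nor on all of \<open>A\<close>, three of the four points of \<open>K\<close> are
  red, so red is not split in \<open>K\<close>. A plane that splits red then has at most one red
  point off \<open>K\<close>; in one that splits green, at most four of the nine vectors with value
  1 at \<open>u1\<close> are green.\<close>

lemma strict_count:
  assumes A: "gf3.subspace A" "A \<subseteq> hyper 4 u1" "card A = 9" "b \<in> hyper 4 u1" "b \<notin> A"
    "G \<inter> hyper 4 u1 \<subseteq> A \<union> {b, - b}"
    and \<phi>: "\<phi> \<in> gf3_space 4" "dot 4 \<phi> b \<noteq> 0" "a \<in> A" "dot 4 \<phi> a \<noteq> 0"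
  shows "c \<phi> t \<le> 1 \<or> 5 \<le> c \<phi> t"
proof -
  let ?W1 = "hyper 4 u1"
  define K where "K = {v \<in> ?W1. dot 4 \<phi> v = 0}"
  define w where "w = \<phi> - gf3_scale t u1"
  have fA: "finite A" using A(2) finite_annih by (rule finite_subset)
  have dots: "dot 4 (gf3_scale t u1) v = t * dot 4 u1 v" for v
    by (simp add: dot_def gf3_scale_def sum_distrib_left mult.assoc)
  have dw: "dot 4 w v = dot 4 \<phi> v - t * dot 4 u1 v" for v by (simp add: w_def dot_diff dots)
  have wV: "w \<in> gf3_space 4" unfolding w_def
    using \<phi> u1 by (intro gf3.subspace_diff[OF subspace_gf3_space] gf3.subspace_scale[OF subspace_gf3_space])
  have "dot 4 w b \<noteq> 0" using dw[of b] \<phi>(2) A(4) by (simp add: annih_def)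
  then have w0: "w \<noteq> 0" by auto
  let ?W = "hyper 4 w"
  have cW: "card ?W = 27" using card_hyper[OF wV w0] card_V by simp
  have cK: "card K = 9"
    using additive_fibre_card[of ?W1 "dot 4 \<phi>" b 0] A(4) \<phi>(2) card_W1 unfolding K_def by (simp add: dot_add)
  have sK: "gf3.subspace K"
    using gf3.subspace_0[OF subspace_annih[of 4 "{u1}"]] gf3.subspace_add[OF subspace_annih[of 4 "{u1}"]]
    by (auto simp: subspace_gf3_iff K_def dot_add)
  have KW: "K \<subseteq> ?W" using dw by (auto simp: K_def annih_def)
  have KV: "K \<subseteq> gf3_space 4" by (auto simp: K_def annih_def)
  then have fK: "finite K" using finite_gf3_space by (rule finite_subset)
  have cKA: "3 * card (K \<inter> A) = 9"
  proof -
    have "K \<inter> A = {v \<in> A. dot 4 \<phi> v = 0}" using A(2) by (auto simp: K_def)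
    then show ?thesis using additive_fibre_card[OF A(1) fA, of "dot 4 \<phi>" a 0] \<phi> A(3) by (simp add: dot_add)
  qed
  have "K - A \<subseteq> R \<inter> K"
  proof
    fix v assume v: "v \<in> K - A"
    then have "v \<noteq> b" "v \<noteq> - b" using \<phi>(2) by (auto simp: K_def dot_minus)
    moreover have "v \<in> ?W1" using v by (simp add: K_def)
    ultimately have "v \<notin> G" using v A(6) by blast
    moreover have "v \<noteq> 0" using v gf3.subspace_0[OF A(1)] by auto
    ultimately show "v \<in> R \<inter> K" using v cover KV by blast
  qed
  then have "card (K - A) \<le> card (R \<inter> K)" using fK by (intro card_mono) auto
  moreover have "card (K - A) = 6" using card_Int_Diff[OF fK, of A] cK cKA by simp
  ultimately have R6: "6 \<le> card (R \<inter> K)" by simp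
  \<comment> \<open>Two proper subspaces of a line hold at most four nonzero vectors, but six are
    red.\<close>
  have nsK: "\<not> split R K"
  proof
    assume "split R K"
    then obtain C D where CD: "gf3.subspace C" "gf3.subspace D" "C \<subset> K" "D \<subset> K" "R \<inter> K \<subseteq> C \<union> D"
      unfolding split_def by blast
    have fCD: "finite C" "finite D" using CD(3,4) by (auto intro: finite_subset[OF _ fK])
    have le3: "card C \<le> 3" "card D \<le> 3"
      using card_proper_subspace_le[OF CD(1) sK CD(3) fK] card_proper_subspace_le[OF CD(2) sK CD(4) fK] cK by auto
    have "R \<inter> K \<subseteq> (C - {0}) \<union> (D - {0})" using CD(5) nonzero by blast
    then have "card (R \<inter> K) \<le> card ((C - {0}) \<union> (D - {0}))" using fCD by (intro card_mono) auto
    also have "\<dots> \<le> card (C - {0}) + card (D - {0})" by (rule card_Un_le)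
    also have "\<dots> \<le> 4" using le3 fCD gf3.subspace_0[OF CD(1)] gf3.subspace_0[OF CD(2)] by simp
    finally show False using R6 by simp
  qed
  have WV: "?W \<subset> gf3_space 4" using annih_subset[of 4 "{w}"] cW card_V by auto
  have ceq: "c \<phi> t = card (Q \<inter> ?W)"
  proof -
    have "{v \<in> Q. dot 4 \<phi> v = t} = Q \<inter> ?W" using dw cover by (auto simp: Q_def annih_def)
    then show ?thesis by (simp add: c_def)
  qed
  consider "split R ?W" | "split G ?W" using proper_split[OF subspace_annih WV] cW by auto
  then show ?thesis
  proof cases
    case 1
    then have "card (R \<inter> ?W - K) \<le> 2"
      using few_off_unsplit[OF _ subspace_annih finite_annih sK KW _ nsK] cW cK by simp
    moreover have "(Q \<inter> ?W) \<union> uminus ` (Q \<inter> ?W) \<subseteq> R \<inter> ?W - K"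
      using sym(1) subspace_neg_iff[OF subspace_annih] by (auto simp: Q_def K_def annih_def dot_minus)
    then have "card ((Q \<inter> ?W) \<union> uminus ` (Q \<inter> ?W)) \<le> card (R \<inter> ?W - K)" using fin by (intro card_mono) auto
    moreover have "(Q \<inter> ?W) \<inter> uminus ` (Q \<inter> ?W) = {}" by (auto simp: Q_def dot_minus)
    then have "card ((Q \<inter> ?W) \<union> uminus ` (Q \<inter> ?W)) = card (Q \<inter> ?W) + card (Q \<inter> ?W)"
      using fin by (simp add: card_Un_disjoint card_image)
    ultimately show ?thesis using ceq by simp
  next
    case 2
    obtain A2 b2 where A2: "gf3.subspace A2" "A2 \<subseteq> ?W" "card A2 = 9"
      "b2 \<in> ?W" "b2 \<notin> A2" "G \<inter> ?W \<subseteq> A2 \<union> {b2, - b2}"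
      by (rule split_dim3[OF 2 subspace_annih finite_annih cW])
    have fA2: "finite A2" using A2(2) finite_annih by (rule finite_subset)
    let ?Wq = "{v \<in> ?W. dot 4 u1 v = 1}"
    have "K \<noteq> ?W" using cK cW by auto
    then obtain x where x: "x \<in> ?W" "x \<notin> K" using KW by blast
    then have "dot 4 u1 x \<noteq> 0" using dw[of x] by (auto simp: annih_def K_def)
    then have cWq: "3 * card ?Wq = 27"
      using additive_fibre_card[OF subspace_annih finite_annih, where L = "dot 4 u1" and ?x0.0 = x and t = 1 and r1 = 4 and Y1 = "{w}"]
        x cW by (simp add: dot_add)
    have "G \<inter> ?Wq \<subseteq> {v \<in> A2. dot 4 u1 v = 1} \<union> {v \<in> {b2, - b2}. dot 4 u1 v = 1}" using A2(6) by blast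
    then have "card (G \<inter> ?Wq) \<le> card ({v \<in> A2. dot 4 u1 v = 1} \<union> {v \<in> {b2, - b2}. dot 4 u1 v = 1})"
      using fA2 by (intro card_mono) auto
    also have "\<dots> \<le> card {v \<in> A2. dot 4 u1 v = 1} + card {v \<in> {b2, - b2}. dot 4 u1 v = 1}" by (rule card_Un_le)
    \<comment> \<open>The value 1 is taken by at most a third of the nine vectors of
      \<open>A2\<close>, and by at most one of the two signs of \<open>b2\<close>.\<close>
    also have "\<dots> \<le> 3 + 1"
    proof (intro add_mono)
      show "card {v \<in> A2. dot 4 u1 v = 1} \<le> 3" using coset_card_le[OF A2(1) fA2, of 4 u1] A2(3) by simp
      have "{v \<in> {b2, - b2}. dot 4 u1 v = 1} \<subseteq> (if dot 4 u1 b2 = 1 then {b2} else {- b2})"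
        by (auto simp: dot_minus)
      then have "card {v \<in> {b2, - b2}. dot 4 u1 v = 1} \<le> card (if dot 4 u1 b2 = 1 then {b2} else {- b2})"
        by (intro card_mono) auto
      also have "\<dots> = 1" by simp
      finally show "card {v \<in> {b2, - b2}. dot 4 u1 v = 1} \<le> 1" .
    qed
    finally have g: "card (G \<inter> ?Wq) \<le> 4" by simp
    have "?Wq \<subseteq> (Q \<inter> ?W) \<union> (G \<inter> ?Wq)"
    proof
      fix v assume v: "v \<in> ?Wq"
      then have "v \<noteq> 0" by auto
      moreover have "v \<in> gf3_space 4" using v by (simp add: annih_def)
      ultimately show "v \<in> (Q \<inter> ?W) \<union> (G \<inter> ?Wq)" using v cover by (auto simp: Q_def)
    qed
    then have "card ?Wq \<le> card ((Q \<inter> ?W) \<union> (G \<inter> ?Wq))" using fin by (intro card_mono) auto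
    also have "\<dots> \<le> card (Q \<inter> ?W) + card (G \<inter> ?Wq)" by (rule card_Un_le)
    finally show ?thesis using ceq cWq g by simp
  qed
qed

lemma sum_c: "c \<phi> 0 + c \<phi> 1 + c \<phi> (-1) = card Q"
proof -
  have "(\<Sum>t\<in>UNIV. card {v \<in> Q. dot 4 \<phi> v = t}) = card (\<Union>t. {v \<in> Q. dot 4 \<phi> v = t})"
    using fin by (intro card_UN_disjoint[symmetric]) auto
  also have "(\<Union>t. {v \<in> Q. dot 4 \<phi> v = t}) = Q" by auto
  finally show ?thesis by (simp add: sum_gf3 c_def)
qed

definition q where "q \<phi> = (c \<phi> 0)^2 + (c \<phi> 1)^2 + (c \<phi> (-1))^2"

lemma q_pairs: "q \<phi> = card {x \<in> Q \<times> Q. dot 4 \<phi> (fst x) = dot 4 \<phi> (snd x)}"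
proof -
  let ?F = "\<lambda>t. {v \<in> Q. dot 4 \<phi> v = t}"
  have "{x \<in> Q \<times> Q. dot 4 \<phi> (fst x) = dot 4 \<phi> (snd x)} = (\<Union>t. ?F t \<times> ?F t)" by auto
  also have "card \<dots> = (\<Sum>t\<in>UNIV. card (?F t \<times> ?F t))"
    using fin by (intro card_UN_disjoint) auto
  also have "\<dots> = q \<phi>" by (simp add: sum_gf3 card_cartesian_product q_def c_def power2_eq_square)
  finally show ?thesis by simp
qed

text \<open>Summation over pairs of points comes first: distinct points agree under the 27
  functionals that kill their difference, and equal ones under all 81.\<close>

lemma sum_q: "(\<Sum>\<phi>\<in>gf3_space 4. q \<phi>) = 27 * (card Q)^2 + 54 * card Q"
proof -
  have "(\<Sum>\<phi>\<in>gf3_space 4. q \<phi>) = (\<Sum>x\<in>Q \<times> Q. card {\<phi> \<in> gf3_space 4. dot 4 \<phi> (fst x) = dot 4 \<phi> (snd x)})"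
    unfolding q_pairs
    using sum.swap_restrict[of "gf3_space 4" "Q \<times> Q" "\<lambda>_ _. 1 :: nat" "\<lambda>\<phi> x. dot 4 \<phi> (fst x) = dot 4 \<phi> (snd x)"] fin
    by simp
  also have "\<dots> = (\<Sum>x\<in>Q \<times> Q. 27 + (if fst x = snd x then 54 else 0))"
  proof (rule sum.cong)
    fix x assume x: "x \<in> Q \<times> Q"
    show "card {\<phi> \<in> gf3_space 4. dot 4 \<phi> (fst x) = dot 4 \<phi> (snd x)} = 27 + (if fst x = snd x then 54 else 0)"
    proof (cases "fst x = snd x")
      case True
      then show ?thesis using card_V by simp
    next
      case False
      let ?d = "fst x - snd x"
      have "fst x \<in> gf3_space 4" "snd x \<in> gf3_space 4" using x Q_V by auto
      then have "?d \<in> gf3_space 4" by (rule gf3.subspace_diff[OF subspace_gf3_space])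
      moreover have "?d \<noteq> 0" using False by simp
      ultimately have "card (hyper 4 ?d) = 27" using card_hyper[of ?d 4] card_V by simp
      moreover have "hyper 4 ?d = {\<phi> \<in> gf3_space 4. dot 4 \<phi> (fst x) = dot 4 \<phi> (snd x)}"
        by (auto simp: annih_def dot_diff dot_commute[of 4 "fst x"] dot_commute[of 4 "snd x"])
      ultimately show ?thesis using False by simp
    qed
  qed simp
  also have "\<dots> = 27 * (card Q)^2 + (\<Sum>x\<in>Q \<times> Q. if fst x = snd x then 54 else 0)"
    by (simp add: sum.distrib card_cartesian_product power2_eq_square)
  also have "(\<Sum>x\<in>Q \<times> Q. if fst x = snd x then 54 else 0) = 54 * card {x \<in> Q \<times> Q. fst x = snd x}"
    using fin by (simp add: sum.inter_filter[symmetric])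
  also have "{x \<in> Q \<times> Q. fst x = snd x} = (\<lambda>v. (v, v)) ` Q" by auto
  also have "card \<dots> = card Q" by (intro card_image inj_onI) simp
  finally show ?thesis .
qed

lemma contradiction: False
proof -
  obtain A b where A: "gf3.subspace A" "A \<subseteq> hyper 4 u1" "card A = 9" "b \<in> hyper 4 u1" "b \<notin> A"
    "G \<inter> hyper 4 u1 \<subseteq> A \<union> {b, - b}"
    by (rule W1_structure)
  let ?s = "card Q"
  \<comment> \<open>These are the functionals to which \<open>strict_count\<close> applies; at least
    \<open>81 - 27 - 9\<close> of them exist. Exactly 45 are kept below, so that the remaining
    classes have known sizes.\<close>
  define S where "S = gf3_space 4 - (hyper 4 b \<union> annih 4 A)"
  have AV: "A \<subseteq> gf3_space 4" using A(2) annih_subset by blast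
  have b: "b \<in> gf3_space 4" "b \<noteq> 0" using A(1,4,5) gf3.subspace_0 annih_subset by blast+
  have "card (hyper 4 b \<union> annih 4 A) \<le> card (hyper 4 b) + card (annih 4 A)" by (rule card_Un_le)
  also have "\<dots> = 27 + 9" using card_hyper[OF b] card_V card_annih[OF A(1) AV] A(3) by simp
  finally have "card (hyper 4 b \<union> annih 4 A) \<le> 36" by simp
  moreover have "card S = 81 - card (hyper 4 b \<union> annih 4 A)"
    unfolding S_def using annih_subset card_V by (subst card_Diff_subset) auto
  ultimately have "45 \<le> card S" by simp
  then obtain S' where S': "S' \<subseteq> S" "card S' = 45" using obtain_subset_with_card_n by metis
  have fS': "finite S'" using S'(2) card.infinite by fastforce
  \<comment> \<open>Multiples of \<open>u1\<close> are constant on \<open>Q\<close>, so all of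
    \<open>Q\<close> is one section. They annihilate \<open>A\<close> and therefore do not belong to
    \<open>S\<close>.\<close>
  define T where "T = gf3.span {u1}"
  have T: "T \<subseteq> annih 4 A" unfolding T_def
    using u1 A(2) by (intro gf3.span_minimal[OF _ subspace_annih]) (auto simp: annih_def dot_commute)
  have cT: "card T = 3" using u1 by (simp add: T_def span_single_gf3)
  have fT: "finite T" by (simp add: T_def span_single_gf3)
  have disjT: "S' \<inter> T = {}" using S'(1) T by (auto simp: S_def)
  define U where "U = gf3_space 4 - (S' \<union> T)"
  have sub: "S' \<union> T \<subseteq> gf3_space 4" using S'(1) T annih_subset[of 4 A] by (auto simp: S_def)
  have cU: "card U = 33"
    unfolding U_def using sub fS' fT card_V S'(2) cT disjT by (simp add: card_Diff_subset card_Un_disjoint)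
  have qS: "39 * ?s^2 + 162 * ?s < 135 * q \<phi>" if "\<phi> \<in> S'" for \<phi>
  proof -
    have "\<phi> \<in> S" using that S'(1) by blast
    then have "\<phi> \<in> gf3_space 4" "dot 4 \<phi> b \<noteq> 0" "\<exists>a\<in>A. dot 4 \<phi> a \<noteq> 0"
      by (auto simp: S_def annih_def dot_commute)
    then have "c \<phi> t \<le> 1 \<or> 5 \<le> c \<phi> t" for t using strict_count[OF A] by blast
    then show ?thesis
      using spread_numeric[of "c \<phi> 0" "c \<phi> 1" "c \<phi> (-1)"] card_Q unfolding sum_c q_def by blast
  qed
  have qT: "?s^2 \<le> q \<phi>" if "\<phi> \<in> T" for \<phi>
  proof -
    obtain t where t: "\<phi> = gf3_scale t u1" using \<open>\<phi> \<in> T\<close> unfolding T_def gf3.span_singleton by blast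
    have "dot 4 \<phi> v = t" if "v \<in> Q" for v
    proof -
      have "dot 4 (gf3_scale t u1) v = t * dot 4 u1 v"
        by (simp add: dot_def gf3_scale_def sum_distrib_left mult.assoc)
      then show ?thesis using that t by (simp add: Q_def)
    qed
    then have "{x \<in> Q \<times> Q. dot 4 \<phi> (fst x) = dot 4 \<phi> (snd x)} = Q \<times> Q" by auto
    then show ?thesis by (simp add: q_pairs card_cartesian_product power2_eq_square)
  qed
  have qU: "?s^2 \<le> 3 * q \<phi>" for \<phi>
    using sum_squares_ge[of "c \<phi> 0" "c \<phi> 1" "c \<phi> (-1)"] unfolding sum_c q_def .
  have "(\<Sum>\<phi>\<in>gf3_space 4. q \<phi>) = (\<Sum>\<phi>\<in>S' \<union> T. q \<phi>) + (\<Sum>\<phi>\<in>U. q \<phi>)"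
    unfolding U_def using sum.subset_diff[OF sub finite_gf3_space, of q] by simp
  also have "(\<Sum>\<phi>\<in>S' \<union> T. q \<phi>) = (\<Sum>\<phi>\<in>S'. q \<phi>) + (\<Sum>\<phi>\<in>T. q \<phi>)"
    by (rule sum.union_disjoint[OF fS' fT disjT])
  finally have tot: "27 * ?s^2 + 54 * ?s = (\<Sum>\<phi>\<in>S'. q \<phi>) + (\<Sum>\<phi>\<in>T. q \<phi>) + (\<Sum>\<phi>\<in>U. q \<phi>)"
    unfolding sum_q .
  have "45 * (39 * ?s^2 + 162 * ?s) < 135 * (\<Sum>\<phi>\<in>S'. q \<phi>)"
  proof -
    have "S' \<noteq> {}" using S'(2) by auto
    then have "(\<Sum>\<phi>\<in>S'. 39 * ?s^2 + 162 * ?s) < (\<Sum>\<phi>\<in>S'. 135 * q \<phi>)"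
      using fS' qS by (intro sum_strict_mono) auto
    then show ?thesis using S'(2) by (simp add: sum_distrib_left)
  qed
  moreover have "3 * ?s^2 \<le> (\<Sum>\<phi>\<in>T. q \<phi>)"
    using sum_bounded_below[of T "?s^2" q] qT cT by simp
  moreover have "33 * ?s^2 \<le> 3 * (\<Sum>\<phi>\<in>U. q \<phi>)"
    using sum_bounded_below[of U "?s^2" "\<lambda>\<phi>. 3 * q \<phi>"] qU cU by (simp add: sum_distrib_left)
  \<comment> \<open>The three parts contribute more than \<open>13 * s2 + 54 * s\<close>, at least
    \<open>3 * s2\<close> and at least \<open>11 * s2\<close>, which exceeds the exact
    total.\<close>
  moreover have False if "x + y + z = 27 * s2 + 54 * s" "45 * (39 * s2 + 162 * s) < 135 * x" "3 * s2 \<le> y" "33 * s2 \<le> 3 * z"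
    for x y z s2 s :: nat
    using that by simp
  ultimately show False using tot by metis
qed

end

section \<open>Two-colourings in all dimensions from four on\<close>

lemma (in two_coloring) no_hyperplane_all_split:
  assumes "\<forall>u\<in>gf3_space r - {0}. split R (hyper r u)" "\<not> split R (gf3_space r)" "r \<ge> 4"
  shows False
proof -
  have "(3::nat) ^ 4 \<le> 3 ^ r" using assms(3) by (intro power_increasing) auto
  then have big: "27 \<le> card (gf3_space r)" by (simp add: card_gf3_space)
  interpret split_hyperplanes "gf3_space r" R
  proof
    show "split R W" if W: "gf3.subspace W" "W \<subseteq> gf3_space r" "card (gf3_space r) = 3 * card W" for W
    proof -
      obtain u where "u \<in> gf3_space r" "u \<noteq> 0" "W = hyper r u" using hyper_exists[OF W] by blast
      then show ?thesis using assms(1) by blast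
    qed
  qed (use cover sym big assms(2) in auto)
  obtain W where "gf3.subspace W" "W \<subseteq> gf3_space r" "card (gf3_space r) = 3 * card W" "card (R - W) \<le> 6"
    using few_off_hyperplane by blast
  then show False using many(1) by fastforce
qed

text \<open>The smaller colour has at most 40 of the 80 nonzero vectors. A hyperplane that does not
  split it splits the other one, which \<open>two_coloring_4\<close> excludes.\<close>

lemma (in two_coloring) dim4_impossible:
  assumes "r = 4" "card R \<le> card G" "\<not> split R (gf3_space r)"
  shows False
proof (rule no_hyperplane_all_split)
  show "\<forall>u\<in>gf3_space r - {0}. split R (hyper r u)"
  proof (rule ccontr)
    assume "\<not> ?thesis"
    then obtain u where u: "u \<in> gf3_space 4" "u \<noteq> 0" "\<not> split R (hyper 4 u)" using assms(1) by blast
    have c: "card (hyper 4 u) = 27" using card_hyper[OF u(1,2)] by (simp add: card_gf3_space)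
    have "hyper 4 u \<noteq> gf3_space 4" using c by (auto simp: card_gf3_space)
    then have "hyper 4 u \<subset> gf3_space r" using annih_subset assms(1) by blast
    then have G: "split G (hyper 4 u)" using proper_split[of "hyper 4 u"] u(3) c by simp
    have fRG: "finite R" "finite G" using cover finite_gf3_space[of r] by (metis finite_Diff finite_Un)+
    have "card R + card G = card (gf3_space r - {0})"
      using card_Un_disjoint[OF fRG disjoint] cover by simp
    also have "\<dots> = 80" using assms(1) gf3.subspace_0[OF subspace_gf3_space] by (simp add: card_gf3_space)
    finally have "card R \<le> 40" using assms(2) by simp
    interpret two_coloring 4 R G using two_coloring_axioms assms(1) by simp
    interpret two_coloring_4 R G u using \<open>card R \<le> 40\<close> u G by unfold_locales
    show False by (rule contradiction)
  qed
qed (use assms in auto)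

theorem (in two_coloring) impossible:
  assumes "r \<ge> 4" "\<not> split R (gf3_space r)" "\<not> split G (gf3_space r)"
  shows False
proof -
  interpret sw: two_coloring r G R by (rule swap)
  show False
  proof (cases "r = 4")
    case True
    then show False using dim4_impossible sw.dim4_impossible assms by linarith
  next
    case False
    interpret two_coloring_ge5 r R G using False assms(1) by unfold_locales simp
    show False using monochromatic no_hyperplane_all_split sw.no_hyperplane_all_split assms by blast
  qed
qed

section \<open>Representations of matroids by vectors\<close>

global_interpretation gf3p: vector_space_pair gf3_scale gf3_scale
  by unfold_locales

lemma independent_iff_card_span:
  assumes "finite B"
  shows "gf3.independent B \<longleftrightarrow> card (gf3.span B) \<ge> 3 ^ card B"
proof
  assume "gf3.independent B"
  then show "card (gf3.span B) \<ge> 3 ^ card B" using card_span_independent assms by simp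
next
  assume le: "card (gf3.span B) \<ge> 3 ^ card B"
  show "gf3.independent B"
  proof
    assume "gf3.dependent B"
    then obtain b where b: "b \<in> B" "b \<in> gf3.span (B - {b})" unfolding gf3.dependent_def by blast
    then have "gf3.span B = gf3.span (B - {b})" using gf3.span_redundant[OF b(2)] by (simp add: insert_absorb)
    then have "card (gf3.span B) \<le> 3 ^ card (B - {b})" using finite_span_gf3[of "B - {b}"] assms by simp
    also have "\<dots> < 3 ^ card B" using b assms card_gt_0_iff[of B] by (intro power_strict_increasing) (auto simp: card_Diff_singleton)
    finally show False using le by simp
  qed
qed

lemma independent_Un:
  assumes X: "finite X" "gf3.independent X" and Y: "finite Y" "gf3.independent Y"
    and meet: "gf3.span X \<inter> gf3.span Y = {0}"
  shows "gf3.independent (X \<union> Y)"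
proof -
  have "X \<inter> Y = {}"
  proof (rule ccontr)
    assume "X \<inter> Y \<noteq> {}"
    then obtain v where v: "v \<in> X" "v \<in> Y" by blast
    then have "v \<in> gf3.span X \<inter> gf3.span Y" by (auto intro: gf3.span_base)
    then have "v = 0" using meet by blast
    then show False using v X(2) gf3.dependent_zero by blast
  qed
  then have "3 ^ card (X \<union> Y) = card (gf3.span X) * card (gf3.span Y)"
    using card_span_independent[OF X] card_span_independent[OF Y] X Y by (simp add: card_Un_disjoint power_add)
  also have "\<dots> \<le> card (gf3.span (X \<union> Y))"
    using finite_span_gf3[of "X \<union> Y"] X Y meet
    by (intro card_subspace_sum_le) (auto intro: gf3.span_mono[THEN subsetD, rotated])
  finally show ?thesis using independent_iff_card_span[of "X \<union> Y"] X Y by simp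
qed

text \<open>By uniqueness of coordinates, a common vector has its support in both disjoint sets, so
  it is 0.\<close>

lemma span_Int_independent:
  assumes "gf3.independent (X \<union> Y)" "X \<inter> Y = {}"
  shows "gf3.span X \<inter> gf3.span Y = {0}"
proof -
  have "w = 0" if w: "w \<in> gf3.span X" "w \<in> gf3.span Y" for w
  proof -
    have X: "gf3.representation (X \<union> Y) w = gf3.representation X w"
      and Y: "gf3.representation (X \<union> Y) w = gf3.representation Y w"
      using w assms by (auto intro!: gf3.representation_extend)
    have zero: "gf3.representation X w b = 0" for b
    proof (cases "b \<in> X")
      case True
      then have "b \<notin> Y" using assms(2) by auto
      then have "gf3.representation Y w b = 0" using gf3.representation_ne_zero[of Y w b] by blast
      then show ?thesis using X Y by metis
    next
      case False
      then show ?thesis using gf3.representation_ne_zero[of X w b] by blast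
    qed
    have "gf3.independent X" using assms(1) by (rule gf3.independent_mono) blast
    then have "(\<Sum>b | gf3.representation X w b \<noteq> 0. gf3_scale (gf3.representation X w b) b) = w"
      using w(1) by (rule gf3.sum_nonzero_representation_eq)
    then show ?thesis using zero by simp
  qed
  then show ?thesis using gf3.span_zero by blast
qed

text \<open>Spans do not see signs, so a dependence in \<open>Y\<close> becomes one in
  \<open>X\<close>. The last assumption prevents two members of \<open>Y\<close> from collapsing to
  the same member of \<open>X\<close>.\<close>

lemma independent_signs:
  assumes X: "gf3.independent X"
    and pm: "\<And>y. y \<in> Y \<Longrightarrow> y \<in> X \<or> - y \<in> X" and no: "\<And>y. y \<in> Y \<Longrightarrow> - y \<in> Y \<Longrightarrow> y = 0"
  shows "gf3.independent Y"
proof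
  assume "gf3.dependent Y"
  then obtain y where y: "y \<in> Y" "y \<in> gf3.span (Y - {y})" unfolding gf3.dependent_def by blast
  have 0: "0 \<notin> X" using X gf3.dependent_zero by blast
  obtain x where x: "x \<in> X" "x = y \<or> x = - y" using pm[OF y(1)] by auto
  have "z \<in> gf3.span (X - {x})" if z: "z \<in> Y - {y}" for z
  proof -
    obtain w where w: "w \<in> X" "w = z \<or> w = - z" using pm[of z] z by auto
    have "w \<noteq> x"
    proof
      assume "w = x"
      then have "z = - y" using w(2) x(2) z by (metis DiffE insertI1 minus_minus)
      then have "y = 0" using no[of y] y(1) z by auto
      then show False using x 0 by simp
    qed
    then have "w \<in> gf3.span (X - {x})" using w by (auto intro: gf3.span_base)
    then show ?thesis using w(2) gf3.span_neg minus_minus by metis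
  qed
  then have "gf3.span (Y - {y}) \<subseteq> gf3.span (X - {x})" by (intro gf3.span_minimal) auto
  then have "y \<in> gf3.span (X - {x})" using y by blast
  then have "x \<in> gf3.span (X - {x})" using x(2) gf3.span_neg by blast
  then show False using X x(1) unfolding gf3.dependent_def by blast
qed

text \<open>\<open>S\<close> consists of the representing vectors together with their negatives.\<close>

definition represents :: "'a pre_matroid \<Rightarrow> ('a \<Rightarrow> gf3_vec) \<Rightarrow> gf3_vec set \<Rightarrow> bool" where
  "represents M \<rho> S \<longleftrightarrow> finite (ground M) \<and> indep M = {I. I \<subseteq> ground M \<and> gf3.independent (\<rho> ` I)}
     \<and> (\<forall>e\<in>ground M. \<rho> e \<noteq> 0) \<and> (\<forall>e\<in>ground M. \<forall>e'\<in>ground M. \<rho> e = \<rho> e' \<or> \<rho> e = - \<rho> e' \<longrightarrow> e = e')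
     \<and> S = \<rho> ` ground M \<union> uminus ` \<rho> ` ground M"

text \<open>The labelling is forgotten: by \<open>isomorphic_if_reps\<close> the vector set alone
  determines the matroid up to isomorphism.\<close>

definition reps :: "'a pre_matroid \<Rightarrow> gf3_vec set \<Rightarrow> bool" where
  "reps M S \<longleftrightarrow> (\<exists>\<rho>. represents M \<rho> S)"

lemma representsD:
  assumes "represents M \<rho> S"
  shows "finite (ground M)" "I \<in> indep M \<longleftrightarrow> I \<subseteq> ground M \<and> gf3.independent (\<rho> ` I)"
    "e \<in> ground M \<Longrightarrow> \<rho> e \<noteq> 0" "inj_on \<rho> (ground M)"
    "e \<in> ground M \<Longrightarrow> e' \<in> ground M \<Longrightarrow> \<rho> e = - \<rho> e' \<Longrightarrow> e = e'"
    "e \<in> ground M \<Longrightarrow> \<rho> e \<in> S" "v \<in> S \<Longrightarrow> - v \<in> S" "finite S" "0 \<notin> S"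
    "v \<in> S \<Longrightarrow> \<exists>e\<in>ground M. v = \<rho> e \<or> v = - \<rho> e"
  using assms unfolding represents_def inj_on_def by auto

lemma repsD:
  assumes "reps M S"
  shows "finite S" "0 \<notin> S" "v \<in> S \<Longrightarrow> - v \<in> S" "finite (ground M)"
proof -
  obtain \<rho> where \<rho>: "represents M \<rho> S" using assms unfolding reps_def by blast
  show "finite S" "0 \<notin> S" "v \<in> S \<Longrightarrow> - v \<in> S" "finite (ground M)"
    using representsD(1,7,8,9)[OF \<rho>] by simp_all
qed

lemma represents_iso:
  assumes M: "represents M \<rho> S" and f: "bij_betw f (ground M) (ground N)" "indep N = (\<lambda>I. f ` I) ` indep M"
  shows "represents N (\<rho> \<circ> the_inv_into (ground M) f) S"
proof -
  let ?g = "the_inv_into (ground M) f"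
  have inj: "inj_on f (ground M)" and im: "f ` ground M = ground N" using f(1) by (auto simp: bij_betw_def)
  have g: "bij_betw ?g (ground N) (ground M)" using f(1) by (rule bij_betw_the_inv_into)
  then have gim: "?g ` ground N = ground M" and ginj: "inj_on ?g (ground N)" by (auto simp: bij_betw_def)
  have fg: "f ` ?g ` J = J" if "J \<subseteq> ground N" for J
    using that inj im by (force simp: f_the_inv_into_f image_image)
  have gf: "?g ` f ` I = I" if "I \<subseteq> ground M" for I
    using that inj by (force simp: the_inv_into_f_f image_image)
  have "indep N = {J. J \<subseteq> ground N \<and> gf3.independent ((\<rho> \<circ> ?g) ` J)}"
  proof (intro equalityI subsetI)
    fix J assume "J \<in> indep N"
    then obtain I where I: "I \<in> indep M" "J = f ` I" using f(2) by auto
    then have "I \<subseteq> ground M" "gf3.independent (\<rho> ` I)" using representsD(2)[OF M] by auto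
    then show "J \<in> {J. J \<subseteq> ground N \<and> gf3.independent ((\<rho> \<circ> ?g) ` J)}"
    proof -
      have "(\<rho> \<circ> ?g) ` J = \<rho> ` I" using gf[OF \<open>I \<subseteq> ground M\<close>] I(2) by (simp only: image_comp[symmetric])
      moreover have "J \<subseteq> ground N" using I(2) \<open>I \<subseteq> ground M\<close> im by blast
      ultimately show ?thesis using \<open>gf3.independent (\<rho> ` I)\<close> by simp
    qed
  next
    fix J assume "J \<in> {J. J \<subseteq> ground N \<and> gf3.independent ((\<rho> \<circ> ?g) ` J)}"
    then have J: "J \<subseteq> ground N" "gf3.independent (\<rho> ` ?g ` J)" by (simp_all only: image_comp mem_Collect_eq simp_thms)
    then have "?g ` J \<in> indep M" using representsD(2)[OF M] gim by blast
    then show "J \<in> indep N" unfolding f(2) using fg[OF J(1)] by (metis image_eqI)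
  qed
  moreover have "finite (ground N)" using representsD(1)[OF M] im by (metis finite_imageI)
  moreover have gin: "?g e \<in> ground M" if "e \<in> ground N" for e using that gim by blast
  moreover have "e = e'" if "e \<in> ground N" "e' \<in> ground N" "\<rho> (?g e) = \<rho> (?g e') \<or> \<rho> (?g e) = - \<rho> (?g e')" for e e'
  proof -
    have "?g e = ?g e'"
      using that gin representsD(4,5)[OF M] unfolding inj_on_def by metis
    then show ?thesis using that ginj by (auto dest: inj_onD)
  qed
  moreover have "S = (\<rho> \<circ> ?g) ` ground N \<union> uminus ` (\<rho> \<circ> ?g) ` ground N"
    using M gim unfolding represents_def by (metis image_comp)
  ultimately show ?thesis using representsD(3)[OF M] unfolding represents_def by simp
qed

lemma reps_iso:
  assumes "reps M S" "isomorphic M N"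
  shows "reps N S"
proof -
  obtain \<rho> where \<rho>: "represents M \<rho> S" using assms(1) unfolding reps_def by blast
  obtain f where "bij_betw f (ground M) (ground N)" "indep N = (\<lambda>I. f ` I) ` indep M"
    using assms(2) unfolding isomorphic_def by blast
  then show ?thesis using represents_iso[OF \<rho>] unfolding reps_def by blast
qed

text \<open>Elements are matched when their vectors agree up to sign, and independence is
  insensitive to signs.\<close>

lemma isomorphic_if_reps:
  assumes "reps M S" "reps N S"
  shows "isomorphic M N"
proof -
  obtain \<rho> \<sigma> where M: "represents M \<rho> S" and N: "represents N \<sigma> S" using assms unfolding reps_def by blast
  have "\<exists>e'\<in>ground N. \<rho> e = \<sigma> e' \<or> \<rho> e = - \<sigma> e'" if "e \<in> ground M" for e
    using representsD(10)[OF N representsD(6)[OF M that]] .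
  then obtain f where f: "\<And>e. e \<in> ground M \<Longrightarrow> f e \<in> ground N \<and> (\<rho> e = \<sigma> (f e) \<or> \<rho> e = - \<sigma> (f e))" by metis
  have inj: "inj_on f (ground M)"
  proof (rule inj_onI)
    fix x y assume h: "x \<in> ground M" "y \<in> ground M" "f x = f y"
    then have "\<rho> x = \<rho> y \<or> \<rho> x = - \<rho> y" using f[of x] f[of y] by auto
    then show "x = y" using h representsD(4,5)[OF M] unfolding inj_on_def by metis
  qed
  have im: "f ` ground M = ground N"
  proof
    show "f ` ground M \<subseteq> ground N" using f by auto
    show "ground N \<subseteq> f ` ground M"
    proof
      fix e' assume e': "e' \<in> ground N"
      then obtain e where e: "e \<in> ground M" "\<sigma> e' = \<rho> e \<or> \<sigma> e' = - \<rho> e"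
        using representsD(10)[OF M representsD(6)[OF N e']] by blast
      then have "\<sigma> e' = \<sigma> (f e) \<or> \<sigma> e' = - \<sigma> (f e)" using f[of e] by auto
      then have "e' = f e" using e e' f[of e] representsD(4,5)[OF N] unfolding inj_on_def by metis
      then show "e' \<in> f ` ground M" using e by blast
    qed
  qed
  have ind: "gf3.independent (\<rho> ` I) \<longleftrightarrow> gf3.independent (\<sigma> ` f ` I)" if I: "I \<subseteq> ground M" for I
  proof
    assume *: "gf3.independent (\<rho> ` I)"
    show "gf3.independent (\<sigma> ` f ` I)"
    proof (rule independent_signs[OF *])
      fix y assume "y \<in> \<sigma> ` f ` I"
      then obtain e where e: "e \<in> I" "y = \<sigma> (f e)" by blast
      then show "y \<in> \<rho> ` I \<or> - y \<in> \<rho> ` I" using f[of e] I by (metis imageI minus_minus subsetD)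
      assume "- y \<in> \<sigma> ` f ` I"
      then obtain e' where e': "e' \<in> I" "- y = \<sigma> (f e')" by blast
      then have "f e' = f e" using e f I representsD(5)[OF N, of "f e'" "f e"] by auto
      then show "y = 0" using e e' by simp
    qed
  next
    assume *: "gf3.independent (\<sigma> ` f ` I)"
    show "gf3.independent (\<rho> ` I)"
    proof (rule independent_signs[OF *])
      fix y assume "y \<in> \<rho> ` I"
      then obtain e where e: "e \<in> I" "y = \<rho> e" by blast
      then show "y \<in> \<sigma> ` f ` I \<or> - y \<in> \<sigma> ` f ` I" using f[of e] I by (metis imageI minus_minus subsetD)
      assume "- y \<in> \<rho> ` I"
      then obtain e' where e': "e' \<in> I" "- y = \<rho> e'" by blast
      then have "e' = e" using e I representsD(5)[OF M, of e' e] by auto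
      then show "y = 0" using e e' by simp
    qed
  qed
  have "indep N = (\<lambda>I. f ` I) ` indep M"
  proof (intro equalityI subsetI)
    fix J assume J: "J \<in> indep N"
    then have "J \<subseteq> f ` ground M" using representsD(2)[OF N] im by auto
    then obtain I where I: "I \<subseteq> ground M" "J = f ` I" by (auto simp: subset_image_iff)
    then have "I \<in> indep M" using J ind[OF I(1)] representsD(2)[OF M] representsD(2)[OF N] by auto
    then show "J \<in> (\<lambda>I. f ` I) ` indep M" using I by blast
  next
    fix J assume "J \<in> (\<lambda>I. f ` I) ` indep M"
    then obtain I where I: "I \<in> indep M" "J = f ` I" by blast
    then have "I \<subseteq> ground M" "gf3.independent (\<rho> ` I)" using representsD(2)[OF M] by auto
    then show "J \<in> indep N" using I ind im representsD(2)[OF N] by auto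
  qed
  then show ?thesis unfolding isomorphic_def bij_betw_def using inj im by blast
qed

text \<open>To pull back the images of independent sets they must lie in the ground set, where the
  bijection is injective.\<close>

lemma isomorphic_sym: "isomorphic M N \<Longrightarrow> indep M \<subseteq> Pow (ground M) \<Longrightarrow> isomorphic N M"
proof -
  assume "isomorphic M N" and sub: "indep M \<subseteq> Pow (ground M)"
  then obtain f where f: "bij_betw f (ground M) (ground N)" "indep N = (\<lambda>I. f ` I) ` indep M"
    unfolding isomorphic_def by blast
  let ?g = "the_inv_into (ground M) f"
  have inj: "inj_on f (ground M)" using f(1) by (simp add: bij_betw_def)
  have gf: "?g ` f ` I = I" if "I \<in> indep M" for I
  proof -
    have "?g (f x) = x" if "x \<in> I" for x using that sub \<open>I \<in> indep M\<close> inj by (intro the_inv_into_f_f) auto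
    then show ?thesis by (force simp: image_image)
  qed
  have "(\<lambda>I. ?g ` I) ` indep N = (\<lambda>I. ?g ` f ` I) ` indep M" using f(2) by (simp add: image_image)
  also have "\<dots> = indep M" using gf by simp
  finally show ?thesis unfolding isomorphic_def using bij_betw_the_inv_into[OF f(1)] by metis
qed

text \<open>One nonzero vector is chosen on each line. Together with the negatives, these are all
  nonzero vectors on the lines of \<open>T\<close>.\<close>

lemma reps_PG3:
  assumes T: "T \<subseteq> ground (PG3 k)"
  shows "reps (restriction (PG3 k) T) (\<Union>T - {0})"
proof -
  define \<rho> where "\<rho> l = (SOME v. v \<in> l \<and> v \<noteq> 0)" for l :: "gf3_vec set"
  have line: "\<exists>v\<in>gf3_space k. v \<noteq> 0 \<and> l = gf3.span {v}" if "l \<in> T" for l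
    using that T by (auto simp: PG3_def)
  have \<rho>: "\<rho> l \<in> l \<and> \<rho> l \<noteq> 0 \<and> l = gf3.span {\<rho> l} \<and> \<rho> l \<in> gf3_space k" if l: "l \<in> T" for l
  proof -
    obtain v where v: "v \<in> gf3_space k" "v \<noteq> 0" "l = gf3.span {v}" using line[OF l] by blast
    then have "\<exists>w. w \<in> l \<and> w \<noteq> 0" by (auto simp: span_single_gf3)
    then have *: "\<rho> l \<in> l \<and> \<rho> l \<noteq> 0" unfolding \<rho>_def by (rule someI_ex)
    then have "\<rho> l = v \<or> \<rho> l = - v" using v by (auto simp: span_single_gf3)
    moreover have "gf3.span {- v} = gf3.span {v}" by (auto simp: span_single_gf3)
    moreover have "- v \<in> gf3_space k" using v gf3.subspace_neg[OF subspace_gf3_space] by blast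
    ultimately show ?thesis using * v by metis
  qed
  have "finite (ground (PG3 k))"
  proof -
    have "ground (PG3 k) \<subseteq> (\<lambda>v. gf3.span {v}) ` gf3_space k" by (auto simp: PG3_def)
    then show ?thesis by (rule finite_subset) simp
  qed
  then have finT: "finite T" using T finite_subset by blast
  have g: "ground (restriction (PG3 k) T) = T" using T by (auto simp: restriction_def)
  have eqD: "l = l'" if "l \<in> T" "l' \<in> T" "\<rho> l = \<rho> l' \<or> \<rho> l = - \<rho> l'" for l l'
  proof -
    have "gf3.span {\<rho> l} = gf3.span {\<rho> l'}" using that by (auto simp: span_single_gf3)
    then show ?thesis using \<rho> that by metis
  qed
  have ind: "indep (restriction (PG3 k) T) = {I. I \<subseteq> T \<and> gf3.independent (\<rho> ` I)}"
  proof (intro equalityI subsetI)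
    fix I assume "I \<in> indep (restriction (PG3 k) T)"
    then obtain X where X: "gf3.independent X" "I = (\<lambda>v. gf3.span {v}) ` X" "I \<subseteq> T"
      by (auto simp: restriction_def PG3_def)
    have "gf3.independent (\<rho> ` I)"
    proof (rule independent_signs[OF X(1)])
      fix y assume "y \<in> \<rho> ` I"
      then obtain v where v: "v \<in> X" "y = \<rho> (gf3.span {v})" "gf3.span {v} \<in> T" using X by auto
      then have "y \<in> gf3.span {v}" "y \<noteq> 0" using \<rho> by auto
      then show "y \<in> X \<or> - y \<in> X" using v(1) by (auto simp: span_single_gf3)
      assume "- y \<in> \<rho> ` I"
      then obtain l where l: "l \<in> I" "- y = \<rho> l" by auto
      then have "\<rho> (gf3.span {v}) = - \<rho> l" using v(2) by (metis minus_minus)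
      then have "gf3.span {v} = l" using eqD[of "gf3.span {v}" l] v(3) l(1) X(3) by blast
      then show "y = 0" using l v by simp
    qed
    then show "I \<in> {I. I \<subseteq> T \<and> gf3.independent (\<rho> ` I)}" using X by simp
  next
    fix I assume I: "I \<in> {I. I \<subseteq> T \<and> gf3.independent (\<rho> ` I)}"
    have "gf3.span {\<rho> l} = l" if "l \<in> I" for l using I \<rho>[of l] that by auto
    then have "(\<lambda>v. gf3.span {v}) ` \<rho> ` I = I" by (simp add: image_image)
    moreover have "\<rho> ` I \<subseteq> gf3_space k" using I \<rho> by auto
    ultimately have "I \<in> indep (PG3 k)" using I unfolding PG3_def
      by (metis (mono_tags, lifting) mem_Collect_eq pre_matroid.select_convs(2))
    then show "I \<in> indep (restriction (PG3 k) T)" using I by (simp add: restriction_def)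
  qed
  have S: "\<Union>T - {0} = \<rho> ` T \<union> uminus ` \<rho> ` T"
  proof -
    have "v \<in> \<Union>T - {0} \<longleftrightarrow> (\<exists>l\<in>T. v = \<rho> l \<or> v = - \<rho> l)" for v
    proof -
      have "v \<in> l \<and> v \<noteq> 0 \<longleftrightarrow> v = \<rho> l \<or> v = - \<rho> l" if l: "l \<in> T" for l
      proof -
        have "v \<in> l \<longleftrightarrow> v \<in> {0, \<rho> l, - \<rho> l}" using \<rho>[OF l] span_single_gf3 by metis
        then show ?thesis using \<rho>[OF l] by auto
      qed
      then show ?thesis by auto
    qed
    then show ?thesis by auto
  qed
  have "represents (restriction (PG3 k) T) \<rho> (\<Union>T - {0})"
    unfolding represents_def g using finT ind \<rho> eqD S by blast
  then show ?thesis unfolding reps_def by blast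
qed

section \<open>Comatroids as sets of vectors\<close>

definition lines :: "gf3_vec set \<Rightarrow> gf3_vec set set" where
  "lines S = (\<lambda>v. gf3.span {v}) ` S"

lemma lines_subset: "S \<subseteq> gf3_space k - {0} \<Longrightarrow> lines S \<subseteq> ground (PG3 k)"
  by (auto simp: lines_def PG3_def)

lemma Union_lines:
  assumes "0 \<notin> S" "\<And>v. v \<in> S \<Longrightarrow> - v \<in> S"
  shows "\<Union>(lines S) - {0} = S"
  using assms by (auto simp: lines_def span_single_gf3)

lemma reps_lines:
  assumes "S \<subseteq> gf3_space k - {0}" "\<And>v. v \<in> S \<Longrightarrow> - v \<in> S"
  shows "reps (restriction (PG3 k) (lines S)) S"
proof -
  have "0 \<notin> S" using assms by auto
  then show ?thesis using reps_PG3[OF lines_subset[OF assms(1)]] Union_lines[OF _ assms(2)] by simp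
qed

lemma Union_PG3_subset:
  assumes "T \<subseteq> ground (PG3 k)"
  shows "\<Union>T \<subseteq> gf3_space k"
proof
  fix v assume "v \<in> \<Union>T"
  then obtain w where w: "w \<in> gf3_space k" "v \<in> gf3.span {w}" using assms by (auto simp: PG3_def)
  then show "v \<in> gf3_space k" using span_subset_space[of "{w}" k] by blast
qed

text \<open>Distinct lines share only 0, so complementing a set of lines complements its set of
  nonzero vectors.\<close>

lemma Union_PG3_Diff:
  assumes "T \<subseteq> ground (PG3 k)"
  shows "\<Union>(ground (PG3 k) - T) - {0} = gf3_space k - {0} - (\<Union>T - {0})"
proof (intro equalityI subsetI)
  have eq: "l = gf3.span {v}" if "l \<in> ground (PG3 k)" "v \<in> l" "v \<noteq> 0" for l v
    using that unfolding PG3_def by (auto simp: span_single_gf3)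
  {
    fix v assume v: "v \<in> \<Union>(ground (PG3 k) - T) - {0}"
    then obtain l where l: "l \<in> ground (PG3 k)" "l \<notin> T" "v \<in> l" "v \<noteq> 0" by blast
    have "v \<notin> \<Union>T"
    proof
      assume "v \<in> \<Union>T"
      then obtain l' where "l' \<in> T" "v \<in> l'" by blast
      then have "l' = l" using eq[of l' v] eq[of l v] l assms by blast
      then show False using \<open>l' \<in> T\<close> l by simp
    qed
    then show "v \<in> gf3_space k - {0} - (\<Union>T - {0})" using l Union_PG3_subset[of "ground (PG3 k)" k] by blast
  next
    fix v assume v: "v \<in> gf3_space k - {0} - (\<Union>T - {0})"
    then have "gf3.span {v} \<in> ground (PG3 k)" by (auto simp: PG3_def)
    moreover have "v \<in> gf3.span {v}" by (simp add: gf3.span_base)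
    ultimately show "v \<in> \<Union>(ground (PG3 k) - T) - {0}" using v by blast
  }
qed

lemma is_complementD:
  assumes "is_complement k M N"
  obtains S where "S \<subseteq> gf3_space k - {0}" "reps M S" "reps N (gf3_space k - {0} - S)"
proof -
  obtain T where T: "T \<subseteq> ground (PG3 k)" "isomorphic (restriction (PG3 k) T) M" "isomorphic (deletion (PG3 k) T) N"
    using assms unfolding is_complement_def by blast
  have 1: "reps M (\<Union>T - {0})" using reps_iso[OF reps_PG3[OF T(1)] T(2)] .
  have "reps (deletion (PG3 k) T) (\<Union>(ground (PG3 k) - T) - {0})"
    unfolding deletion_def by (rule reps_PG3) blast
  then have 2: "reps N (gf3_space k - {0} - (\<Union>T - {0}))"
    using reps_iso[OF _ T(3)] Union_PG3_Diff[OF T(1)] by metis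
  show ?thesis using that[OF _ 1 2] Union_PG3_subset[OF T(1)] by blast
qed

lemma is_complementI:
  assumes "S \<subseteq> gf3_space k" "reps M S" "reps N (gf3_space k - {0} - S)"
  shows "is_complement k M N"
proof -
  let ?T = "lines S"
  have S: "S \<subseteq> gf3_space k - {0}" using assms(1) repsD(2)[OF assms(2)] by blast
  have T: "?T \<subseteq> ground (PG3 k)" using lines_subset[OF S] .
  have US: "\<Union>?T - {0} = S" using Union_lines repsD(2,3)[OF assms(2)] by metis
  have "reps (restriction (PG3 k) ?T) S" using reps_PG3[OF T] US by simp
  then have 1: "isomorphic (restriction (PG3 k) ?T) M" using isomorphic_if_reps assms(2) by blast
  have "reps (deletion (PG3 k) ?T) (\<Union>(ground (PG3 k) - ?T) - {0})"
    unfolding deletion_def by (rule reps_PG3) blast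
  then have "reps (deletion (PG3 k) ?T) (gf3_space k - {0} - S)" unfolding Union_PG3_Diff[OF T] US .
  then have "isomorphic (deletion (PG3 k) ?T) N" using isomorphic_if_reps assms(3) by blast
  then show ?thesis unfolding is_complement_def using T 1 by blast
qed

text \<open>The copy is shifted beyond the finite set \<open>F\<close>, which provides the disjoint
  ground sets that direct sums require.\<close>

lemma nat_copy:
  fixes M :: "'a pre_matroid" and F :: "nat set"
  assumes "reps M S" "finite F"
  obtains N :: "nat pre_matroid" where "reps N S" "isomorphic M N" "ground N \<inter> F = {}"
proof -
  have fM: "finite (ground M)" using repsD(4)[OF assms(1)] .
  obtain n where n: "\<forall>x\<in>F. x < n" using assms(2) finite_nat_set_iff_bounded by blast
  obtain h where h: "bij_betw h (ground M) {0..<card (ground M)}" using ex_bij_betw_finite_nat[OF fM] by blast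
  let ?f = "\<lambda>x. n + h x"
  define N where "N = \<lparr>ground = ?f ` ground M, indep = (\<lambda>I. ?f ` I) ` indep M\<rparr>"
  have "inj_on ?f (ground M)" using h by (auto simp: bij_betw_def inj_on_def)
  then have "isomorphic M N" unfolding isomorphic_def N_def by (intro exI[of _ ?f]) (simp add: bij_betw_def)
  moreover have "ground N \<inter> F = {}" using n by (auto simp: N_def)
  ultimately show ?thesis using that reps_iso[OF assms(1)] by blast
qed

lemma exists_reps:
  assumes "S \<subseteq> gf3_space k - {0}" "\<And>v. v \<in> S \<Longrightarrow> - v \<in> S"
  obtains N :: "nat pre_matroid" where "reps N S"
  by (rule nat_copy[OF reps_lines[OF assms] finite.emptyI]) (auto intro: that)

lemma nat_comatroid_wf:
  "nat_comatroid N \<Longrightarrow> finite (ground N) \<and> indep N \<subseteq> Pow (ground N) \<and> {} \<in> indep N"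
proof (induction rule: nat_comatroid.induct)
  case (direct_sum M N)
  have "{} \<union> {} \<in> indep (direct_sum M N)" unfolding direct_sum_def using direct_sum.IH by auto
  then show ?case using direct_sum.IH by (auto simp: direct_sum_def)
next
  case (complement M t N)
  obtain S where "reps N (gf3_space t - {0} - S)" using is_complementD[OF complement.hyps(3)] by blast
  then obtain \<rho> where \<rho>: "represents N \<rho> (gf3_space t - {0} - S)" unfolding reps_def by blast
  show ?case using representsD(1)[OF \<rho>] representsD(2)[OF \<rho>] by (auto simp: gf3.independent_empty)
next
  case (isomorphic M N)
  then obtain f where f: "bij_betw f (ground M) (ground N)" "indep N = (\<lambda>I. f ` I) ` indep M"
    unfolding isomorphic_def by blast
  have "finite (ground N)" using f(1) isomorphic.IH bij_betw_finite by blast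
  moreover have "indep N \<subseteq> Pow (ground N)"
  proof
    fix J assume "J \<in> indep N"
    then obtain I where "I \<in> indep M" "J = f ` I" using f(2) by auto
    then have "J \<subseteq> f ` ground M" using isomorphic.IH by blast
    then show "J \<in> Pow (ground N)" using bij_betw_imp_surj_on[OF f(1)] by simp
  qed
  moreover have "{} \<in> indep N" using isomorphic.IH f(2) by auto
  ultimately show ?case by blast
qed auto

text \<open>Any other choice of \<open>N\<close> on the natural numbers serves as well, by
  \<open>comat_nat_comatroid\<close>.\<close>

definition comat :: "gf3_vec set \<Rightarrow> bool" where
  "comat S \<longleftrightarrow> (\<exists>N. nat_comatroid N \<and> reps N S)"

lemma comat_if_ternary_comatroid:
  assumes "ternary_comatroid M" "reps M S"
  shows "comat S"
proof -
  obtain N where N: "nat_comatroid N" "isomorphic N M" using assms(1) unfolding ternary_comatroid_def by blast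
  have "isomorphic M N" using isomorphic_sym[OF N(2)] nat_comatroid_wf[OF N(1)] by blast
  then show ?thesis using reps_iso[OF assms(2)] N(1) unfolding comat_def by blast
qed

lemma ternary_comatroid_if_comat:
  assumes "comat S" "reps M S"
  shows "ternary_comatroid M"
proof -
  obtain N where "nat_comatroid N" "reps N S" using assms(1) unfolding comat_def by blast
  then show ?thesis using isomorphic_if_reps[OF _ assms(2)] unfolding ternary_comatroid_def by blast
qed

lemma comat_nat_comatroid:
  assumes "comat S" "reps N S"
  shows "nat_comatroid N"
proof -
  obtain N' where "nat_comatroid N'" "reps N' S" using assms(1) unfolding comat_def by blast
  then show ?thesis using nat_comatroid.isomorphic[OF _ isomorphic_if_reps[OF _ assms(2)]] by blast
qed

section \<open>Direct sums and trivially meeting spans\<close>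

lemma represents_direct_sum:
  assumes M: "represents M \<rho> S1" and N: "represents N \<sigma> S2" and disj: "ground M \<inter> ground N = {}"
    and meet: "gf3.span S1 \<inter> gf3.span S2 = {0}"
  shows "represents (direct_sum M N) (\<lambda>e. if e \<in> ground M then \<rho> e else \<sigma> e) (S1 \<union> S2)"
proof -
  let ?\<tau> = "\<lambda>e. if e \<in> ground M then \<rho> e else \<sigma> e"
  have \<tau>M: "?\<tau> ` I = \<rho> ` I" if "I \<subseteq> ground M" for I using that by (intro image_cong) auto
  have \<tau>N: "?\<tau> ` I = \<sigma> ` I" if "I \<subseteq> ground N" for I using that disj by (intro image_cong) auto
  have ne: "v \<noteq> w" if "v \<in> S1" "w \<in> S2" for v w
  proof
    assume "v = w"
    then have "v \<in> gf3.span S1 \<inter> gf3.span S2" using that by (auto intro: gf3.span_base)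
    then have "v = 0" using meet by blast
    then show False using that representsD(9)[OF M] by simp
  qed
  have "indep (direct_sum M N) = {I. I \<subseteq> ground M \<union> ground N \<and> gf3.independent (?\<tau> ` I)}"
  proof (intro equalityI subsetI)
    fix K assume "K \<in> indep (direct_sum M N)"
    then obtain I J where IJ: "K = I \<union> J" "I \<in> indep M" "J \<in> indep N" by (auto simp: direct_sum_def)
    then have IJ': "I \<subseteq> ground M" "gf3.independent (\<rho> ` I)" "J \<subseteq> ground N" "gf3.independent (\<sigma> ` J)"
      using representsD(2)[OF M] representsD(2)[OF N] by auto
    have "?\<tau> ` K = \<rho> ` I \<union> \<sigma> ` J" unfolding IJ(1) image_Un \<tau>M[OF IJ'(1)] \<tau>N[OF IJ'(3)] ..
    moreover have "gf3.independent (\<rho> ` I \<union> \<sigma> ` J)"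
    proof (rule independent_Un)
      show "finite (\<rho> ` I)" "finite (\<sigma> ` J)"
        using IJ' representsD(1)[OF M] representsD(1)[OF N] finite_subset by blast+
      have sub: "\<rho> ` I \<subseteq> S1" "\<sigma> ` J \<subseteq> S2" using IJ' representsD(6)[OF M] representsD(6)[OF N] by auto
      have "gf3.span (\<rho> ` I) \<inter> gf3.span (\<sigma> ` J) \<subseteq> {0}"
        using meet gf3.span_mono[OF sub(1)] gf3.span_mono[OF sub(2)] by blast
      then show "gf3.span (\<rho> ` I) \<inter> gf3.span (\<sigma> ` J) = {0}" using gf3.span_zero by blast
    qed (use IJ' in auto)
    ultimately show "K \<in> {I. I \<subseteq> ground M \<union> ground N \<and> gf3.independent (?\<tau> ` I)}" using IJ(1) IJ' by auto
  next
    fix K assume K: "K \<in> {I. I \<subseteq> ground M \<union> ground N \<and> gf3.independent (?\<tau> ` I)}"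
    then have indK: "gf3.independent (?\<tau> ` K)" by simp
    have "gf3.independent (?\<tau> ` (K \<inter> ground M))" "gf3.independent (?\<tau> ` (K \<inter> ground N))"
      by (rule gf3.independent_mono[OF indK], blast)+
    then have "K \<inter> ground M \<in> indep M" "K \<inter> ground N \<in> indep N"
      using representsD(2)[OF M] representsD(2)[OF N] \<tau>M[of "K \<inter> ground M"] \<tau>N[of "K \<inter> ground N"] by auto
    moreover have "K = (K \<inter> ground M) \<union> (K \<inter> ground N)" using K by blast
    ultimately show "K \<in> indep (direct_sum M N)" unfolding direct_sum_def by auto
  qed
  moreover have "e = e'" if e: "e \<in> ground M \<union> ground N" "e' \<in> ground M \<union> ground N" "?\<tau> e = ?\<tau> e' \<or> ?\<tau> e = - ?\<tau> e'" for e e'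
  proof -
    have M1: "\<rho> x \<in> S1" "- \<rho> x \<in> S1" if "x \<in> ground M" for x using that representsD(6,7)[OF M] by auto
    have N1: "\<sigma> x \<in> S2" "- \<sigma> x \<in> S2" if "x \<in> ground N" for x using that representsD(6,7)[OF N] by auto
    have "e \<in> ground M \<longleftrightarrow> e' \<in> ground M"
    proof (rule ccontr)
      assume "\<not> ?thesis"
      then consider "e \<in> ground M" "e' \<notin> ground M" "e' \<in> ground N" | "e \<notin> ground M" "e \<in> ground N" "e' \<in> ground M"
        using e(1,2) by blast
      then show False
      proof cases
        case 1
        then have "\<rho> e = \<sigma> e' \<or> \<rho> e = - \<sigma> e'" using e(3) by simp
        then show False using ne M1[OF 1(1)] N1[OF 1(3)] by blast
      next
        case 2
        then have "\<sigma> e = \<rho> e' \<or> \<sigma> e = - \<rho> e'" using e(3) by simp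
        then show False using ne M1[OF 2(3)] N1[OF 2(2)] by metis
      qed
    qed
    then show ?thesis
      using e representsD(4,5)[OF M] representsD(4,5)[OF N] unfolding inj_on_def by (metis UnE)
  qed
  moreover have "S1 \<union> S2 = ?\<tau> ` (ground M \<union> ground N) \<union> uminus ` ?\<tau> ` (ground M \<union> ground N)"
  proof -
    have "S1 = \<rho> ` ground M \<union> uminus ` \<rho> ` ground M" "S2 = \<sigma> ` ground N \<union> uminus ` \<sigma> ` ground N"
      using M N unfolding represents_def by auto
    then show ?thesis unfolding image_Un \<tau>M[OF order_refl] \<tau>N[OF order_refl] by blast
  qed
  moreover have "?\<tau> e \<noteq> 0" if "e \<in> ground M \<union> ground N" for e
    using that representsD(3)[OF M] representsD(3)[OF N] by auto
  ultimately show ?thesis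
    using representsD(1)[OF M] representsD(1)[OF N] unfolding represents_def
    by (simp add: direct_sum_def)
qed

lemma comat_Un:
  assumes "comat S1" "comat S2" "gf3.span S1 \<inter> gf3.span S2 = {0}"
  shows "comat (S1 \<union> S2)"
proof -
  obtain M where M: "nat_comatroid M" "reps M S1" using assms(1) unfolding comat_def by blast
  obtain N0 where N0: "nat_comatroid N0" "reps N0 S2" using assms(2) unfolding comat_def by blast
  obtain N :: "nat pre_matroid" where N: "reps N S2" "ground N \<inter> ground M = {}"
    using nat_copy[OF N0(2) repsD(4)[OF M(2)]] by blast
  have "nat_comatroid N" using comat_nat_comatroid[OF assms(2) N(1)] .
  then have "nat_comatroid (direct_sum M N)" using M N by (intro nat_comatroid.direct_sum) auto
  moreover have "ground M \<inter> ground N = {}" using N(2) by blast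
  then have "reps (direct_sum M N) (S1 \<union> S2)"
    using represents_direct_sum[OF _ _ _ assms(3)] M(2) N(1) unfolding reps_def by blast
  ultimately show ?thesis unfolding comat_def by blast
qed

text \<open>In any representation of a direct sum the two sides span trivially meeting subspaces:
  bases of the sides are together independent in the matroid, hence as vectors.\<close>

lemma direct_sum_reps:
  assumes M: "indep M \<subseteq> Pow (ground M)" "{} \<in> indep M" and N: "indep N \<subseteq> Pow (ground N)" "{} \<in> indep N"
    and disj: "ground M \<inter> ground N = {}" and S: "reps (direct_sum M N) S"
  obtains S1 S2 where "S = S1 \<union> S2" "reps M S1" "reps N S2" "gf3.span S1 \<inter> gf3.span S2 = {0}"
proof -
  obtain \<tau> where \<tau>: "represents (direct_sum M N) \<tau> S" using S unfolding reps_def by blast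
  have g: "ground (direct_sum M N) = ground M \<union> ground N" by (simp add: direct_sum_def)
  have indM: "I \<in> indep M \<longleftrightarrow> I \<subseteq> ground M \<and> I \<in> indep (direct_sum M N)" for I
  proof
    assume "I \<in> indep M"
    moreover from this have "I \<union> {} \<in> indep (direct_sum M N)" unfolding direct_sum_def using N(2) by auto
    ultimately show "I \<subseteq> ground M \<and> I \<in> indep (direct_sum M N)" using M(1) by auto
  next
    assume I: "I \<subseteq> ground M \<and> I \<in> indep (direct_sum M N)"
    then obtain I1 J1 where "I = I1 \<union> J1" "I1 \<in> indep M" "J1 \<in> indep N" by (auto simp: direct_sum_def)
    moreover from this have "J1 = {}" using I N(1) disj by blast
    ultimately show "I \<in> indep M" by simp
  qed
  have indN: "I \<in> indep N \<longleftrightarrow> I \<subseteq> ground N \<and> I \<in> indep (direct_sum M N)" for I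
  proof
    assume "I \<in> indep N"
    moreover from this have "{} \<union> I \<in> indep (direct_sum M N)" unfolding direct_sum_def using M(2) by auto
    ultimately show "I \<subseteq> ground N \<and> I \<in> indep (direct_sum M N)" using N(1) by auto
  next
    assume I: "I \<subseteq> ground N \<and> I \<in> indep (direct_sum M N)"
    then obtain I1 J1 where "I = I1 \<union> J1" "I1 \<in> indep M" "J1 \<in> indep N" by (auto simp: direct_sum_def)
    moreover from this have "I1 = {}" using I M(1) disj by blast
    ultimately show "I \<in> indep N" by simp
  qed
  have ind: "I \<in> indep (direct_sum M N) \<longleftrightarrow> I \<subseteq> ground M \<union> ground N \<and> gf3.independent (\<tau> ` I)" for I
    using representsD(2)[OF \<tau>, of I] unfolding g .
  define S1 where "S1 = \<tau> ` ground M \<union> uminus ` \<tau> ` ground M"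
  define S2 where "S2 = \<tau> ` ground N \<union> uminus ` \<tau> ` ground N"
  have fin: "finite (ground M)" "finite (ground N)" using representsD(1)[OF \<tau>] g by auto
  have pair: "e = e'" if "e \<in> ground M \<union> ground N" "e' \<in> ground M \<union> ground N" "\<tau> e = \<tau> e' \<or> \<tau> e = - \<tau> e'" for e e'
    using that representsD(4,5)[OF \<tau>] unfolding g inj_on_def by metis
  have nz: "\<tau> e \<noteq> 0" if "e \<in> ground M \<union> ground N" for e using representsD(3)[OF \<tau>] that g by simp
  have "represents M \<tau> S1"
    unfolding represents_def S1_def using fin indM ind pair nz by auto
  moreover have "represents N \<tau> S2"
    unfolding represents_def S2_def using fin indN ind pair nz by auto
  moreover have "S = S1 \<union> S2"
  proof -
    have "S = \<tau> ` (ground M \<union> ground N) \<union> uminus ` \<tau> ` (ground M \<union> ground N)"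
      using \<tau> unfolding represents_def g by simp
    then show ?thesis unfolding S1_def S2_def image_Un by blast
  qed
  moreover have "gf3.span S1 \<inter> gf3.span S2 = {0}"
  proof -
    have basis: "\<exists>I\<subseteq>E. gf3.independent (\<tau> ` I) \<and> gf3.span (\<tau> ` E \<union> uminus ` \<tau> ` E) \<subseteq> gf3.span (\<tau> ` I)" for E
    proof -
      obtain B where B: "B \<subseteq> \<tau> ` E" "gf3.independent B" "\<tau> ` E \<subseteq> gf3.span B"
        using gf3.maximal_independent_subset by blast
      then obtain I where I: "I \<subseteq> E" "B = \<tau> ` I" by (auto simp: subset_image_iff)
      have "\<tau> ` E \<union> uminus ` \<tau> ` E \<subseteq> gf3.span B" using B(3) by (auto intro: gf3.span_neg)
      then have "gf3.span (\<tau> ` E \<union> uminus ` \<tau> ` E) \<subseteq> gf3.span B" by (intro gf3.span_minimal) auto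
      then show ?thesis using I B by blast
    qed
    obtain I where I: "I \<subseteq> ground M" "gf3.independent (\<tau> ` I)" "gf3.span S1 \<subseteq> gf3.span (\<tau> ` I)"
      using basis[of "ground M"] unfolding S1_def by blast
    obtain J where J: "J \<subseteq> ground N" "gf3.independent (\<tau> ` J)" "gf3.span S2 \<subseteq> gf3.span (\<tau> ` J)"
      using basis[of "ground N"] unfolding S2_def by blast
    have "I \<in> indep M" using I indM ind by blast
    moreover have "J \<in> indep N" using J indN ind by blast
    ultimately have "I \<union> J \<in> indep (direct_sum M N)" unfolding direct_sum_def by auto
    then have "gf3.independent (\<tau> ` I \<union> \<tau> ` J)" using ind[of "I \<union> J"] by (simp add: image_Un)
    moreover have "\<tau> ` I \<inter> \<tau> ` J = {}" using pair I(1) J(1) disj by blast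
    ultimately have "gf3.span (\<tau> ` I) \<inter> gf3.span (\<tau> ` J) = {0}" by (rule span_Int_independent)
    then show ?thesis using I(3) J(3) gf3.span_zero by blast
  qed
  ultimately show ?thesis using that unfolding reps_def by blast
qed

section \<open>Linear images and complements inside a subspace\<close>

abbreviation linear3 :: "(gf3_vec \<Rightarrow> gf3_vec) \<Rightarrow> bool" where
  "linear3 \<equiv> Vector_Spaces.linear gf3_scale gf3_scale"

lemma linear3_minus: "linear3 g \<Longrightarrow> g (- v) = - g v"
  by (rule gf3p.linear_neg)

lemma independent_linear_image_iff:
  assumes g: "linear3 g" "inj_on g U" "gf3.subspace U" "X \<subseteq> U" "finite X"
  shows "gf3.independent (g ` X) \<longleftrightarrow> gf3.independent X"
proof -
  have sp: "gf3.span X \<subseteq> U" using g(3,4) by (simp add: gf3.span_minimal)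
  have "card (gf3.span (g ` X)) = card (gf3.span X)"
    using gf3p.linear_span_image[OF g(1), of X] inj_on_subset[OF g(2) sp] by (simp add: card_image)
  moreover have "card (g ` X) = card X" using inj_on_subset[OF g(2,4)] by (simp add: card_image)
  ultimately show ?thesis using independent_iff_card_span[of X] independent_iff_card_span[of "g ` X"] g(5) by simp
qed

lemma represents_linear:
  assumes M: "represents M \<rho> S" and g: "linear3 g" "inj_on g U" "gf3.subspace U" "S \<subseteq> U"
  shows "represents M (g \<circ> \<rho>) (g ` S)"
proof -
  have \<rho>U: "\<rho> e \<in> U" "- \<rho> e \<in> U" if "e \<in> ground M" for e
    using representsD(6)[OF M that] representsD(7)[OF M] g(4) by auto
  have gm: "g (- v) = - g v" for v by (rule linear3_minus[OF g(1)])
  have "gf3.independent ((g \<circ> \<rho>) ` I) \<longleftrightarrow> gf3.independent (\<rho> ` I)" if "I \<subseteq> ground M" for I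
  proof -
    have "\<rho> ` I \<subseteq> U" using that \<rho>U by blast
    moreover have "finite (\<rho> ` I)" using that representsD(1)[OF M] finite_subset by blast
    ultimately show ?thesis using independent_linear_image_iff[OF g(1,2,3)] by (simp only: image_comp[symmetric])
  qed
  then have "indep M = {I. I \<subseteq> ground M \<and> gf3.independent ((g \<circ> \<rho>) ` I)}"
    using representsD(2)[OF M] by blast
  moreover have "g (\<rho> e) \<noteq> 0" if "e \<in> ground M" for e
  proof -
    have "g 0 = 0" by (rule gf3p.linear_0[OF g(1)])
    then show ?thesis
      using inj_onD[OF g(2), of "\<rho> e" 0] \<rho>U(1)[OF that] gf3.subspace_0[OF g(3)] representsD(3)[OF M that] by auto
  qed
  moreover have "e = e'" if e: "e \<in> ground M" "e' \<in> ground M" "g (\<rho> e) = g (\<rho> e') \<or> g (\<rho> e) = - g (\<rho> e')" for e e'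
  proof -
    have "g (\<rho> e) = g (\<rho> e') \<or> g (\<rho> e) = g (- \<rho> e')" using e(3) gm by simp
    then have "\<rho> e = \<rho> e' \<or> \<rho> e = - \<rho> e'" using inj_onD[OF g(2)] \<rho>U e(1,2) by blast
    then show ?thesis using e representsD(4,5)[OF M] unfolding inj_on_def by metis
  qed
  moreover have "g ` S = (g \<circ> \<rho>) ` ground M \<union> uminus ` (g \<circ> \<rho>) ` ground M"
  proof -
    have S: "S = \<rho> ` ground M \<union> uminus ` \<rho> ` ground M" using M unfolding represents_def by blast
    have "g ` uminus ` \<rho> ` ground M = uminus ` (g \<circ> \<rho>) ` ground M" by (simp add: image_image gm)
    then show ?thesis unfolding S image_Un by (simp add: image_comp)
  qed
  ultimately show ?thesis using representsD(1)[OF M] unfolding represents_def by simp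
qed

lemma reps_linear:
  assumes "reps M S" "linear3 g" "inj_on g U" "gf3.subspace U" "S \<subseteq> U"
  shows "reps M (g ` S)"
  using assms(1) represents_linear[OF _ assms(2-5)] unfolding reps_def by blast

lemma card_eq_linear_iso:
  assumes U: "gf3.subspace U" "finite U" and W: "gf3.subspace W" "finite W" and c: "card U = card W"
  obtains g where "linear3 g" "inj_on g U" "g ` U = W"
proof -
  obtain B where B: "B \<subseteq> U" "finite B" "gf3.independent B" "gf3.span B = gf3.span U" "card (gf3.span U) = 3 ^ card B"
    using finite_subspace_basis[OF order_refl U] by blast
  obtain C where C: "C \<subseteq> W" "finite C" "gf3.independent C" "gf3.span C = gf3.span W" "card (gf3.span W) = 3 ^ card C"
    using finite_subspace_basis[OF order_refl W] by blast
  have spU: "gf3.span U = U" and spW: "gf3.span W = W" using U W by simp_all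
  have dU: "gf3.dim U = card B" using gf3.dim_span_eq_card_independent[OF B(3)] B(4) spU by simp
  have dW: "gf3.dim W = card C" using gf3.dim_span_eq_card_independent[OF C(3)] C(4) spW by simp
  have "(3::nat) ^ card B = 3 ^ card C" using B(5) C(5) c spU spW by simp
  then have BC: "card B = card C" by simp
  have "\<exists>f. linear3 f \<and> f ` B = C \<and> f ` U = W \<and> inj_on f U"
    by (rule gf3p.finite_basis_to_basis_subspace_isomorphism[OF U(1) W(1) _ B(2,1,3) _ _ C(2,1,3)])
      (use dU dW BC B(4) C(4) spU spW in auto)
  then show ?thesis using that by blast
qed

lemma rank_card_le:
  assumes M: "represents M \<rho> S" and A: "gf3.subspace A" "finite A" "S \<subseteq> A"
  shows "3 ^ rank M \<le> card A"
proof -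
  have "{} \<in> indep M" using representsD(2)[OF M] gf3.independent_empty by simp
  moreover have "indep M \<subseteq> Pow (ground M)" using representsD(2)[OF M] by blast
  moreover from this have fin: "finite (indep M)" using representsD(1)[OF M] finite_subset by blast
  moreover have "{I \<in> indep M. I \<subseteq> ground M} = indep M" using \<open>indep M \<subseteq> Pow (ground M)\<close> by blast
  ultimately have "rank M \<in> card ` indep M"
    unfolding rank_def rank_of_def using Max_in[of "card ` indep M"] by (metis empty_iff finite_imageI image_is_empty)
  then obtain I where I: "I \<in> indep M" "card I = rank M" by auto
  then have I': "I \<subseteq> ground M" "gf3.independent (\<rho> ` I)" using representsD(2)[OF M] by auto
  have "card (\<rho> ` I) = rank M" using I(2) inj_on_subset[OF representsD(4)[OF M] I'(1)] by (simp add: card_image)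
  moreover have "finite (\<rho> ` I)" using I'(1) representsD(1)[OF M] finite_subset by blast
  ultimately have "card (gf3.span (\<rho> ` I)) = 3 ^ rank M" using card_span_independent I'(2) by metis
  moreover have "gf3.span (\<rho> ` I) \<subseteq> A"
    using I'(1) representsD(6)[OF M] A by (intro gf3.span_minimal) auto
  ultimately show ?thesis using card_mono[OF A(2)] by metis
qed

text \<open>Complements of comatroids exist only in the spaces \<open>gf3_space k\<close>. A linear
  isomorphism carries \<open>U\<close> to one of these, and its left inverse brings the complement
  back.\<close>

lemma comat_complement:
  assumes S: "comat S" "S \<subseteq> U" and U: "gf3.subspace U" "finite U"
  shows "comat (U - {0} - S)"
proof -
  obtain N where N: "nat_comatroid N" "reps N S" using S(1) unfolding comat_def by blast
  obtain B where B: "finite B" "gf3.span B = gf3.span U" "card (gf3.span U) = 3 ^ card B"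
    using finite_subspace_basis[OF order_refl U] by metis
  define k where "k = card B"
  have cU: "card U = card (gf3_space k)" using B(3) gf3.span_eq_iff[THEN iffD2, OF U(1)] by (simp add: k_def card_gf3_space)
  obtain g where g: "linear3 g" "inj_on g U" "g ` U = gf3_space k"
    using card_eq_linear_iso[OF U subspace_gf3_space finite_gf3_space cU] by blast
  obtain h where h: "linear3 h" "\<forall>v\<in>U. h (g v) = v"
    using gf3p.linear_exists_left_inverse_on[OF g(1) U(1) g(2)] by blast
  have hinj: "inj_on h (gf3_space k)"
  proof (rule inj_onI)
    fix x y assume "x \<in> gf3_space k" "y \<in> gf3_space k" "h x = h y"
    moreover from this obtain x' y' where "x' \<in> U" "y' \<in> U" "x = g x'" "y = g y'" unfolding g(3)[symmetric] by blast
    ultimately show "x = y" using h(2) by auto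
  qed
  have gS: "reps N (g ` S)" using reps_linear[OF N(2) g(1,2) U(1) S(2)] .
  have sub: "g ` S \<subseteq> gf3_space k" using g(3) S(2) by blast
  let ?G = "gf3_space k - {0} - g ` S"
  have Gsym: "- v \<in> ?G" if "v \<in> ?G" for v
    using that repsD(3)[OF gS, of "- v"] gf3.subspace_neg[OF subspace_gf3_space, of v k] by auto
  obtain N' :: "nat pre_matroid" where N': "reps N' ?G" by (rule exists_reps[of ?G k]) (use Gsym in auto)
  have "is_complement k N N'" using is_complementI[OF sub gS N'] .
  moreover have "rank N \<le> k"
  proof -
    obtain \<rho> where "represents N \<rho> (g ` S)" using gS unfolding reps_def by blast
    then have "3 ^ rank N \<le> card (gf3_space k)" using rank_card_le[OF _ subspace_gf3_space finite_gf3_space sub] by blast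
    then show ?thesis by (simp add: card_gf3_space)
  qed
  ultimately have "nat_comatroid N'" using nat_comatroid.complement N(1) by blast
  moreover have "reps N' (h ` ?G)" using reps_linear[OF N' h(1) hinj subspace_gf3_space] by blast
  moreover have "h ` ?G = U - {0} - S"
  proof -
    have "?G = g ` (U - {0} - S)"
    proof -
      have "g 0 = 0" by (rule gf3p.linear_0[OF g(1)])
      then have "g ` (U - {0} - S) = g ` U - g ` {0} - g ` S"
        using g(2) S(2) gf3.subspace_0[OF U(1)] by (auto simp: inj_on_def subset_eq)
      then show ?thesis using g(3) \<open>g 0 = 0\<close> by simp
    qed
    moreover have "h ` g ` X = X" if "X \<subseteq> U" for X using that h(2) by (force simp: image_image)
    then have "h ` g ` (U - {0} - S) = U - {0} - S" by blast
    ultimately show ?thesis by simp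
  qed
  ultimately show ?thesis unfolding comat_def by auto
qed

section \<open>Comparing two representations of one matroid\<close>

lemma span_representation_iff:
  assumes M: "represents M \<rho> S" and J: "J \<in> indep M" and e: "e \<in> ground M"
  shows "\<rho> e \<in> gf3.span (\<rho> ` J) \<longleftrightarrow> e \<in> J \<or> insert e J \<notin> indep M"
proof (cases "e \<in> J")
  case True
  then show ?thesis by (simp add: gf3.span_base)
next
  case False
  have J': "J \<subseteq> ground M" "gf3.independent (\<rho> ` J)" using J representsD(2)[OF M] by auto
  have "\<rho> e \<notin> \<rho> ` J"
    using False J'(1) e representsD(4)[OF M] by (auto dest: inj_onD)
  then have "gf3.independent (insert (\<rho> e) (\<rho> ` J)) \<longleftrightarrow> \<rho> e \<notin> gf3.span (\<rho> ` J)"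
    using J'(2) by (simp add: gf3.independent_insert)
  then show ?thesis using False J' e representsD(2)[OF M, of "insert e J"] by simp
qed

text \<open>Being a maximal independent subset of \<open>I\<close> is a property of the matroid, so
  a basis found in one representation spans in the other.\<close>

lemma common_basis:
  assumes X: "represents M \<sigma> X" and S: "represents M \<rho> S" and I: "I \<subseteq> ground M"
  obtains J where "J \<subseteq> I" "J \<in> indep M" "gf3.span (\<sigma> ` J) = gf3.span (\<sigma> ` I)" "gf3.span (\<rho> ` J) = gf3.span (\<rho> ` I)"
proof -
  obtain B where B: "B \<subseteq> \<sigma> ` I" "gf3.independent B" "\<sigma> ` I \<subseteq> gf3.span B"
    using gf3.maximal_independent_subset by blast
  then obtain J where J: "J \<subseteq> I" "B = \<sigma> ` J" by (auto simp: subset_image_iff)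
  have Jind: "J \<in> indep M" using J B(2) I representsD(2)[OF X] by auto
  have in\<sigma>: "\<sigma> e \<in> gf3.span (\<sigma> ` J)" if "e \<in> I" for e using that B(3) J by blast
  have in\<rho>: "\<rho> e \<in> gf3.span (\<rho> ` J)" if "e \<in> I" for e
    using in\<sigma>[OF that] span_representation_iff[OF X Jind] span_representation_iff[OF S Jind] that I by blast
  have "gf3.span (\<sigma> ` J) = gf3.span (\<sigma> ` I)"
    using in\<sigma> J(1) by (intro antisym gf3.span_mono gf3.span_minimal) auto
  moreover have "gf3.span (\<rho> ` J) = gf3.span (\<rho> ` I)"
    using in\<rho> J(1) by (intro antisym gf3.span_mono gf3.span_minimal) auto
  ultimately show ?thesis using that J(1) Jind by blast
qed

lemma span_transfer:
  assumes X: "represents M \<sigma> X" and S: "represents M \<rho> S" and I: "I \<subseteq> ground M"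
  shows "e \<in> ground M \<Longrightarrow> \<rho> e \<in> gf3.span (\<rho> ` I) \<longleftrightarrow> \<sigma> e \<in> gf3.span (\<sigma> ` I)"
    and "card (gf3.span (\<rho> ` I)) = card (gf3.span (\<sigma> ` I))"
proof -
  obtain J where J: "J \<subseteq> I" "J \<in> indep M" "gf3.span (\<sigma> ` J) = gf3.span (\<sigma> ` I)" "gf3.span (\<rho> ` J) = gf3.span (\<rho> ` I)"
    using common_basis[OF X S I] by blast
  show "\<rho> e \<in> gf3.span (\<rho> ` I) \<longleftrightarrow> \<sigma> e \<in> gf3.span (\<sigma> ` I)" if "e \<in> ground M"
    using span_representation_iff[OF X J(2) that] span_representation_iff[OF S J(2) that] J by simp
  have c: "card (gf3.span (\<tau> ` J)) = 3 ^ card J" if "represents M \<tau> Y" for \<tau> Y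
  proof -
    have "J \<subseteq> ground M" "gf3.independent (\<tau> ` J)" using J(2) representsD(2)[OF that] by auto
    moreover have "finite J" using representsD(1)[OF that] \<open>J \<subseteq> ground M\<close> by (rule rev_finite_subset)
    moreover have "card (\<tau> ` J) = card J"
      using inj_on_subset[OF representsD(4)[OF that] \<open>J \<subseteq> ground M\<close>] by (rule card_image)
    ultimately show ?thesis using card_span_independent[of "\<tau> ` J"] by simp
  qed
  show "card (gf3.span (\<rho> ` I)) = card (gf3.span (\<sigma> ` I))" using c[OF X] c[OF S] J by simp
qed

lemma represents_signs:
  assumes M: "represents M \<sigma> X" and pm: "\<And>e. e \<in> ground M \<Longrightarrow> \<tau> e = \<sigma> e \<or> \<tau> e = - \<sigma> e"
  shows "represents M \<tau> X"
proof -
  have pair: "e = e'" if "e \<in> ground M" "e' \<in> ground M" "\<tau> e = \<tau> e' \<or> \<tau> e = - \<tau> e'" for e e'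
  proof -
    have "\<sigma> e = \<sigma> e' \<or> \<sigma> e = - \<sigma> e'" using that(3) pm[OF that(1)] pm[OF that(2)] by (metis minus_minus)
    then show ?thesis using representsD(4,5)[OF M] that unfolding inj_on_def by metis
  qed
  have nz: "\<tau> e \<noteq> 0" if "e \<in> ground M" for e using pm[OF that] representsD(3)[OF M that] by auto
  have "gf3.independent (\<tau> ` I) \<longleftrightarrow> gf3.independent (\<sigma> ` I)" if I: "I \<subseteq> ground M" for I
  proof
    assume *: "gf3.independent (\<sigma> ` I)"
    show "gf3.independent (\<tau> ` I)"
    proof (rule independent_signs[OF *])
      show "y \<in> \<sigma> ` I \<or> - y \<in> \<sigma> ` I" if "y \<in> \<tau> ` I" for y
      proof -
        obtain e where "e \<in> I" "y = \<tau> e" using \<open>y \<in> \<tau> ` I\<close> by blast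
        moreover from this have "e \<in> ground M" using I by blast
        ultimately show ?thesis using pm[of e] by (metis imageI minus_minus)
      qed
      show "y = 0" if "y \<in> \<tau> ` I" "- y \<in> \<tau> ` I" for y
      proof -
        obtain a b where ab: "a \<in> I" "b \<in> I" "y = \<tau> a" "- y = \<tau> b" using \<open>y \<in> \<tau> ` I\<close> \<open>- y \<in> \<tau> ` I\<close> by blast
        then have "\<tau> b = - \<tau> a" by simp
        then have "b = a" using pair[of b a] ab I by blast
        then show ?thesis using ab by simp
      qed
    qed
  next
    assume *: "gf3.independent (\<tau> ` I)"
    show "gf3.independent (\<sigma> ` I)"
    proof (rule independent_signs[OF *])
      show "y \<in> \<tau> ` I \<or> - y \<in> \<tau> ` I" if "y \<in> \<sigma> ` I" for y
      proof -
        obtain e where "e \<in> I" "y = \<sigma> e" using \<open>y \<in> \<sigma> ` I\<close> by blast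
        moreover from this have "e \<in> ground M" using I by blast
        ultimately show ?thesis using pm[of e] by (metis imageI minus_minus)
      qed
      show "y = 0" if "y \<in> \<sigma> ` I" "- y \<in> \<sigma> ` I" for y
      proof -
        obtain a b where ab: "a \<in> I" "b \<in> I" "y = \<sigma> a" "- y = \<sigma> b" using \<open>y \<in> \<sigma> ` I\<close> \<open>- y \<in> \<sigma> ` I\<close> by blast
        then have "\<sigma> b = - \<sigma> a" by simp
        then have "b = a" using representsD(5)[OF M, of b a] ab I by blast
        then show ?thesis using ab by simp
      qed
    qed
  qed
  then have "indep M = {I. I \<subseteq> ground M \<and> gf3.independent (\<tau> ` I)}" using representsD(2)[OF M] by blast
  moreover have "X = \<tau> ` ground M \<union> uminus ` \<tau> ` ground M"
  proof -
    have "X = \<sigma> ` ground M \<union> uminus ` \<sigma> ` ground M" using M unfolding represents_def by blast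
    moreover have "v \<in> \<sigma> ` ground M \<union> uminus ` \<sigma> ` ground M \<longleftrightarrow> (\<exists>e\<in>ground M. v = \<sigma> e \<or> v = - \<sigma> e)" for v by auto
    moreover have "v \<in> \<tau> ` ground M \<union> uminus ` \<tau> ` ground M \<longleftrightarrow> (\<exists>e\<in>ground M. v = \<tau> e \<or> v = - \<tau> e)" for v by auto
    moreover have "v = \<sigma> e \<or> v = - \<sigma> e \<longleftrightarrow> v = \<tau> e \<or> v = - \<tau> e" if "e \<in> ground M" for v e using pm[OF that] by auto
    ultimately show ?thesis by blast
  qed
  ultimately show ?thesis using representsD(1)[OF M] nz pair unfolding represents_def by blast
qed

section \<open>Comatroids split in every subspace\<close>

text \<open>At most two points are involved, and each becomes a piece; 0 stands in for a missing
  point.\<close>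

lemma small_split:
  assumes U: "gf3.subspace U" "finite U" "card U \<ge> 9" and Y: "Y \<subseteq> U - {0}" "\<And>v. v \<in> Y \<Longrightarrow> - v \<in> Y" "card Y \<le> 4"
  shows "split Y U"
proof -
  have fY: "finite Y" using Y(1) U(2) finite_subset by blast
  have sp: "gf3.span {v} \<subset> U" if "v \<in> U" for v
  proof -
    have "gf3.span {v} \<subseteq> U" using that U(1) by (simp add: gf3.span_minimal)
    moreover have "card (gf3.span {v}) \<le> 3" by (simp add: span_single_gf3 card_insert_if)
    ultimately show ?thesis using U(3) by auto
  qed
  have "\<exists>p q. p \<in> U \<and> q \<in> U \<and> Y \<subseteq> {p, - p, q, - q} \<and> gf3.span {p} \<inter> gf3.span {q} = {0}"
  proof (cases "Y = {}")
    case True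
    then show ?thesis using gf3.subspace_0[OF U(1)] by (intro exI[of _ 0]) simp
  next
    case False
    then obtain p where p: "p \<in> Y" by blast
    show ?thesis
    proof (cases "Y \<subseteq> {p, - p}")
      case True
      then show ?thesis using p Y(1) gf3.subspace_0[OF U(1)] by (intro exI[of _ p] exI[of _ 0]) (auto simp: span_single_gf3)
    next
      case False
      then obtain q where q: "q \<in> Y" "q \<noteq> p" "q \<noteq> - p" by blast
      have q': "p \<noteq> - q" using q(3) by (metis minus_minus)
      have "p \<noteq> 0" "q \<noteq> 0" using p q Y(1) by auto
      then have "card {p, - p, q, - q} = 4" using q q' by auto
      moreover have "{p, - p, q, - q} \<subseteq> Y" using p q Y(2) by auto
      ultimately have "{p, - p, q, - q} = Y" using Y(3) fY card_seteq by metis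
      moreover have "gf3.span {p} \<inter> gf3.span {q} = {0}" using q q' \<open>p \<noteq> 0\<close> \<open>q \<noteq> 0\<close> by (auto simp: span_single_gf3)
      moreover have "p \<in> U" "q \<in> U" using p q(1) Y(1) by auto
      ultimately show ?thesis by (metis order_refl)
    qed
  qed
  then obtain p q where pq: "p \<in> U" "q \<in> U" "Y \<subseteq> {p, - p, q, - q}" "gf3.span {p} \<inter> gf3.span {q} = {0}" by blast
  show ?thesis
  proof (rule splitI[OF gf3.subspace_span gf3.subspace_span sp[OF pq(1)] sp[OF pq(2)] pq(4)])
    show "Y \<inter> U \<subseteq> gf3.span {p} \<union> gf3.span {q}" using pq(3) by (auto simp: span_single_gf3)
  qed
qed

lemma split_Int: "split (S \<inter> U) U \<longleftrightarrow> split S U"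
  unfolding split_def by (simp add: Int_assoc)

text \<open>Nine vectors form a projective line of four points, and one of the colours has at most
  two of them.\<close>

lemma plane_good:
  assumes U: "gf3.subspace U" "finite U" "card U = 9" and S: "0 \<notin> S" "\<And>v. v \<in> S \<Longrightarrow> - v \<in> S"
  shows "split S U \<or> split (U - {0} - S) U"
proof -
  let ?P = "S \<inter> U" and ?N = "U - {0} - S"
  have "card ?P + card ?N = card (?P \<union> ?N)" using U(2) by (subst card_Un_disjoint) auto
  also have "?P \<union> ?N = U - {0}" using S(1) by auto
  also have "card (U - {0}) = 8" using U gf3.subspace_0[OF U(1)] by simp
  finally have "card ?P \<le> 4 \<or> card ?N \<le> 4" by linarith
  then show ?thesis
  proof
    assume "card ?P \<le> 4"
    moreover have "- v \<in> ?P" if "v \<in> ?P" for v using that S(2) gf3.subspace_neg[OF U(1)] by blast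
    ultimately have "split ?P U" using S(1) U by (intro small_split) auto
    then show ?thesis using split_Int by blast
  next
    assume "card ?N \<le> 4"
    moreover have "- v \<in> ?N" if "v \<in> ?N" for v
      using that S(2)[of "- v"] gf3.subspace_neg[OF U(1), of v] by auto
    ultimately show ?thesis using U small_split[of U ?N] by auto
  qed
qed

lemma nonspanning_split:
  assumes U: "gf3.subspace U" "finite U" "card U \<ge> 9" and ns: "gf3.span (S \<inter> U) \<noteq> U"
  shows "split S U"
proof (rule splitI[of "gf3.span (S \<inter> U)" "{0}"])
  have "gf3.span (S \<inter> U) \<subseteq> U" using U(1) by (intro gf3.span_minimal) auto
  then show "gf3.span (S \<inter> U) \<subset> U" using ns by blast
  show "{0} \<subset> U" using gf3.subspace_0[OF U(1)] U(3) by (intro psubsetI) auto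
  show "S \<inter> U \<subseteq> gf3.span (S \<inter> U) \<union> {0}" using gf3.span_superset by blast
qed (use gf3.span_zero in auto)

lemma coordinate_zero_iff:
  assumes B: "gf3.independent B" "finite B" and v: "v \<in> gf3.span B" and b: "b \<in> B"
  shows "v \<in> gf3.span (B - {b}) \<longleftrightarrow> gf3.representation B v b = 0"
proof
  assume "v \<in> gf3.span (B - {b})"
  then have "gf3.representation B v = gf3.representation (B - {b}) v"
    using B by (intro gf3.representation_extend) auto
  then show "gf3.representation B v b = 0" using gf3.representation_ne_zero[of "B - {b}" v b] by auto
next
  assume 0: "gf3.representation B v b = 0"
  have "v = (\<Sum>x\<in>B. gf3_scale (gf3.representation B v x) x)"
    using gf3.sum_representation_eq[OF B(1) v B(2) order_refl] by simp
  also have "\<dots> = (\<Sum>x\<in>B - {b}. gf3_scale (gf3.representation B v x) x)"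
    using B(2) b 0 by (simp add: sum.remove)
  also have "\<dots> \<in> gf3.span (B - {b})" by (intro gf3.span_sum gf3.span_scale gf3.span_base)
  finally show "v \<in> gf3.span (B - {b})" .
qed

text \<open>Subtracting the common coordinate times the sum of the basis clears both coordinates.
  Equality of coordinates thus becomes membership in a span, which the matroid can see.\<close>

lemma coordinate_eq_iff:
  assumes B: "gf3.independent B" "finite B" and v: "v \<in> gf3.span B" and b: "b \<in> B" "c \<in> B" "b \<noteq> c"
  shows "v \<in> gf3.span (insert (\<Sum>x\<in>B. x) (B - {b, c})) \<longleftrightarrow> gf3.representation B v b = gf3.representation B v c"
proof
  let ?s = "\<Sum>x\<in>B. x"
  let ?D = "{v \<in> gf3.span B. gf3.representation B v b = gf3.representation B v c}"
  assume vs: "v \<in> gf3.span (insert ?s (B - {b, c}))"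
  have s: "?s \<in> gf3.span B" by (intro gf3.span_sum gf3.span_base)
  have rs: "gf3.representation B ?s x = 1" if "x \<in> B" for x
  proof -
    have "gf3.representation B ?s x = (\<Sum>y\<in>B. gf3.representation B y x)"
      using gf3.representation_sum[OF B(1), of B "\<lambda>x. x"] by (simp add: gf3.span_base)
    also have "\<dots> = (\<Sum>y\<in>B. if y = x then 1 else 0)"
      using gf3.representation_basis[OF B(1)] by (intro sum.cong) auto
    finally show ?thesis using that B(2) by simp
  qed
  have "gf3.subspace ?D"
    using B(1) by (auto simp: subspace_gf3_iff gf3.span_zero gf3.span_add gf3.representation_zero gf3.representation_add)
  moreover have "insert ?s (B - {b, c}) \<subseteq> ?D"
    using s rs b B(1) by (auto simp: gf3.span_base gf3.representation_basis)
  ultimately have "gf3.span (insert ?s (B - {b, c})) \<subseteq> ?D" by (intro gf3.span_minimal)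
  then show "gf3.representation B v b = gf3.representation B v c" using vs by blast
next
  let ?s = "\<Sum>x\<in>B. x"
  assume eq: "gf3.representation B v b = gf3.representation B v c"
  let ?r = "gf3.representation B v"
  have "v = (\<Sum>x\<in>B. gf3_scale (?r x) x)"
    using gf3.sum_representation_eq[OF B(1) v B(2) order_refl] by simp
  also have "\<dots> = gf3_scale (?r b) ?s + (\<Sum>x\<in>B. gf3_scale (?r x - ?r b) x)"
    by (simp add: gf3.scale_left_diff_distrib sum_subtractf gf3.scale_sum_right)
  also have "(\<Sum>x\<in>B. gf3_scale (?r x - ?r b) x) = (\<Sum>x\<in>B - {b, c}. gf3_scale (?r x - ?r b) x)"
    using B(2) eq by (intro sum.mono_neutral_right) auto
  also have "gf3_scale (?r b) ?s + \<dots> \<in> gf3.span (insert ?s (B - {b, c}))"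
    by (intro gf3.span_add gf3.span_sum gf3.span_scale gf3.span_base) auto
  finally show "v \<in> gf3.span (insert ?s (B - {b, c}))" .
qed

text \<open>
  Over a field with three elements, a vector is determined up to sign by the zero coordinates and the
  equal pairs of coordinates, and a spanning circuit detects both. Together with \<open>full_support_sum\<close>
  this gives the instance of unique representability that is needed.
\<close>

lemma spanning_circuit_unique:
  assumes X: "represents M \<sigma> X" and S: "represents M \<rho> S" and J: "J \<in> indep M"
    and e0: "e0 \<in> ground M" "\<sigma> e0 = (\<Sum>j\<in>J. \<sigma> j)" "\<rho> e0 = (\<Sum>j\<in>J. \<rho> j)"
    and L: "linear3 L" "\<And>j. j \<in> J \<Longrightarrow> L (\<sigma> j) = \<rho> j"
    and e: "e \<in> ground M" "\<sigma> e \<in> gf3.span (\<sigma> ` J)"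
  shows "\<rho> e = L (\<sigma> e) \<or> \<rho> e = - L (\<sigma> e)"
proof -
  have J': "J \<subseteq> ground M" "gf3.independent (\<sigma> ` J)" "gf3.independent (\<rho> ` J)"
    using J representsD(2)[OF X] representsD(2)[OF S] by auto
  have fJ: "finite J" using J'(1) representsD(1)[OF X] finite_subset by blast
  have inj: "inj_on \<sigma> J" "inj_on \<rho> J"
    using inj_on_subset[OF representsD(4)[OF X] J'(1)] inj_on_subset[OF representsD(4)[OF S] J'(1)] by auto
  have \<rho>e: "\<rho> e \<in> gf3.span (\<rho> ` J)" using span_transfer(1)[OF X S J'(1) e(1)] e(2) by blast
  define x where "x j = gf3.representation (\<sigma> ` J) (\<sigma> e) (\<sigma> j)" for j
  define x' where "x' j = gf3.representation (\<rho> ` J) (\<rho> e) (\<rho> j)" for j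
  have \<sigma>sum: "\<sigma> e = (\<Sum>j\<in>J. gf3_scale (x j) (\<sigma> j))"
    using gf3.sum_representation_eq[OF J'(2) e(2) _ order_refl] fJ inj by (simp add: x_def sum.reindex)
  have \<rho>sum: "\<rho> e = (\<Sum>j\<in>J. gf3_scale (x' j) (\<rho> j))"
    using gf3.sum_representation_eq[OF J'(3) \<rho>e _ order_refl] fJ inj by (simp add: x'_def sum.reindex)
  have zero: "x j = 0 \<longleftrightarrow> x' j = 0" if "j \<in> J" for j
  proof -
    have im: "\<sigma> ` (J - {j}) = \<sigma> ` J - {\<sigma> j}" "\<rho> ` (J - {j}) = \<rho> ` J - {\<rho> j}"
      using inj that by (auto dest: inj_onD)
    have "J - {j} \<subseteq> ground M" using J'(1) by blast
    then have "\<rho> e \<in> gf3.span (\<rho> ` J - {\<rho> j}) \<longleftrightarrow> \<sigma> e \<in> gf3.span (\<sigma> ` J - {\<sigma> j})"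
      using span_transfer(1)[OF X S _ e(1), of "J - {j}"] unfolding im by blast
    then show ?thesis
      using coordinate_zero_iff[OF J'(2) _ e(2), of "\<sigma> j"] coordinate_zero_iff[OF J'(3) _ \<rho>e, of "\<rho> j"] fJ that
      by (simp add: x_def x'_def)
  qed
  have equal: "x i = x j \<longleftrightarrow> x' i = x' j" if ij: "i \<in> J" "j \<in> J" "i \<noteq> j" for i j
  proof -
    have im: "\<sigma> ` (insert e0 (J - {i, j})) = insert (\<Sum>x\<in>\<sigma> ` J. x) (\<sigma> ` J - {\<sigma> i, \<sigma> j})"
      "\<rho> ` (insert e0 (J - {i, j})) = insert (\<Sum>x\<in>\<rho> ` J. x) (\<rho> ` J - {\<rho> i, \<rho> j})"
      using inj ij e0 by (auto dest: inj_onD simp: sum.reindex)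
    have ne: "\<sigma> i \<noteq> \<sigma> j" "\<rho> i \<noteq> \<rho> j" using inj ij by (auto dest: inj_onD)
    have "insert e0 (J - {i, j}) \<subseteq> ground M" using J'(1) e0 by blast
    then have "\<rho> e \<in> gf3.span (insert (\<Sum>x\<in>\<rho> ` J. x) (\<rho> ` J - {\<rho> i, \<rho> j}))
        \<longleftrightarrow> \<sigma> e \<in> gf3.span (insert (\<Sum>x\<in>\<sigma> ` J. x) (\<sigma> ` J - {\<sigma> i, \<sigma> j}))"
      using span_transfer(1)[OF X S _ e(1), of "insert e0 (J - {i, j})"] unfolding im by blast
    then show ?thesis
      using coordinate_eq_iff[OF J'(2) _ e(2) _ _ ne(1)] coordinate_eq_iff[OF J'(3) _ \<rho>e _ _ ne(2)] fJ ij
      by (simp add: x_def x'_def)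
  qed
  have "\<exists>s. (s = 1 \<or> s = -1) \<and> (\<forall>j\<in>J. x' j = s * x j)"
  proof (cases "\<exists>i\<in>J. x i \<noteq> 0")
    case True
    then obtain i where i: "i \<in> J" "x i \<noteq> 0" by blast
    then have i': "x' i \<noteq> 0" using zero by blast
    define s where "s = x' i * x i"
    have s: "s = 1 \<or> s = -1" using i i' unfolding s_def
      by (cases "x i" rule: gf3_cases; cases "x' i" rule: gf3_cases) auto
    have "x' j = s * x j" if j: "j \<in> J" for j
    proof (cases "x j = 0")
      case True
      then show ?thesis using zero[OF j] by simp
    next
      case False
      then have j': "x' j \<noteq> 0" using zero[OF j] by blast
      show ?thesis
      proof (cases "x j = x i")
        case True
        then have "x' j = x' i" using equal[of j i] i(1) j by (cases "j = i") auto
        then show ?thesis using True gf3_mult_self[OF i(2)] by (simp add: s_def mult.assoc)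
      next
        case ne: False
        then have "x' j \<noteq> x' i" using equal[of j i] i(1) j by auto
        then have "x' j = - x' i" "x j = - x i" using gf3_neq_imp_minus i i' j' False ne by metis+
        then show ?thesis using gf3_mult_self[OF i(2)] by (simp add: s_def mult.assoc)
      qed
    qed
    then show ?thesis using s by blast
  next
    case False
    then show ?thesis using zero by (intro exI[of _ 1]) auto
  qed
  then obtain s where s: "s = 1 \<or> s = -1" "\<And>j. j \<in> J \<Longrightarrow> x' j = s * x j" by blast
  have "L (\<sigma> e) = (\<Sum>j\<in>J. gf3_scale (x j) (\<rho> j))"
    unfolding \<sigma>sum using L by (simp add: gf3p.linear_sum gf3p.linear_scale)
  moreover have "\<rho> e = (\<Sum>j\<in>J. gf3_scale s (gf3_scale (x j) (\<rho> j)))"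
    unfolding \<rho>sum using s(2) by (intro sum.cong) auto
  ultimately have "\<rho> e = gf3_scale s (L (\<sigma> e))" by (simp add: gf3.scale_sum_right)
  then show ?thesis using s(1) by auto
qed

text \<open>Suppose all signed sums lie in \<open>A\<close> or \<open>C\<close>, with
  \<open>v\<close> in \<open>A\<close>. Since \<open>x\<close>, \<open>y\<close>, \<open>z\<close>
  avoid both subspaces, changing one sign leads from \<open>A\<close> to \<open>C\<close> and a
  second change leads back. So \<open>A\<close> contains the pairwise sums of \<open>x\<close>,
  \<open>y\<close>, \<open>z\<close>, and with them \<open>- x\<close>.\<close>

lemma full_support_sum:
  assumes B: "gf3.independent B" "finite B" "card B \<ge> 3"
    and A: "gf3.subspace A" and C: "gf3.subspace C" and BAC: "B \<inter> (A \<union> C) = {}"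
  obtains s where "\<And>b. b \<in> B \<Longrightarrow> s b = 1 \<or> s b = (-1 :: gf3)" "(\<Sum>b\<in>B. gf3_scale (s b) b) \<notin> A \<union> C"
proof (rule ccontr)
  assume "\<not> thesis"
  with that have all: "(\<Sum>b\<in>B. gf3_scale (s b) b) \<in> A \<union> C" if "\<And>b. b \<in> B \<Longrightarrow> s b = 1 \<or> s b = -1" for s
    using that by blast
  obtain T where T: "T \<subseteq> B" "card T = 3" using B(3) obtain_subset_with_card_n by metis
  then obtain x y z where xyz: "T = {x, y, z}" "x \<noteq> y" "x \<noteq> z" "y \<noteq> z" by (auto simp: card_3_iff)
  then have B': "x \<in> B" "y \<in> B" "z \<in> B" using T(1) by auto
  define v where "v = (\<Sum>b\<in>B. b)"
  \<comment> \<open>Changing the sign of \<open>b\<close> adds \<open>b\<close> once more, because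
    \<open>- b = b + b\<close>.\<close>
  have flips: "v + (\<Sum>b\<in>F. b) \<in> A \<union> C" if F: "F \<subseteq> B" for F
  proof -
    have "(\<Sum>b\<in>B. gf3_scale (if b \<in> F then -1 else 1) b) = (\<Sum>b\<in>B. b + (if b \<in> F then b else 0))"
      by (intro sum.cong) (auto simp: vec_add_self)
    also have "\<dots> = v + (\<Sum>b\<in>F. b)"
      using F B(2) by (simp add: sum.distrib v_def sum.If_cases Int_absorb1)
    finally show ?thesis using all[of "\<lambda>b. if b \<in> F then -1 else 1"] by auto
  qed
  have f: "v \<in> A \<union> C" "v + x \<in> A \<union> C" "v + y \<in> A \<union> C" "v + z \<in> A \<union> C"
    "v + (x + y) \<in> A \<union> C" "v + (x + z) \<in> A \<union> C" "v + (y + z) \<in> A \<union> C"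
    using flips[of "{}"] flips[of "{x}"] flips[of "{y}"] flips[of "{z}"] flips[of "{x, y}"] flips[of "{x, z}"]
      flips[of "{y, z}"] B' xyz by simp_all
  have no: "b \<notin> A" "b \<notin> C" if "b \<in> B" for b using BAC that by auto
  have aux: False if A: "gf3.subspace A" and C: "gf3.subspace C" and no: "x \<notin> A" "x \<notin> C" "y \<notin> A" "y \<notin> C" "z \<notin> A" "z \<notin> C"
    and v: "v \<in> A" and f: "v + x \<in> A \<union> C" "v + y \<in> A \<union> C" "v + z \<in> A \<union> C"
      "v + (x + y) \<in> A \<union> C" "v + (x + z) \<in> A \<union> C" "v + (y + z) \<in> A \<union> C" for A C
  proof -
    have step: "w + b \<in> C" if "w \<in> A" "b \<notin> A" "w + b \<in> A \<union> C" for w b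
      using that gf3.subspace_diff[OF A, of "w + b" w] by auto
    have step': "w + b \<in> A" if "w \<in> C" "b \<notin> C" "w + b \<in> A \<union> C" for w b
      using that gf3.subspace_diff[OF C, of "w + b" w] by auto
    have c: "v + x \<in> C" "v + y \<in> C" "v + z \<in> C" using step v no f by blast+
    have a: "v + x + y \<in> A" "v + x + z \<in> A" "v + y + z \<in> A"
      using step'[OF c(1) no(4)] step'[OF c(1) no(6)] step'[OF c(2) no(6)] f by (simp_all add: add.assoc)
    have xyz: "x + y \<in> A" "x + z \<in> A" "y + z \<in> A"
      using gf3.subspace_diff[OF A a(1) v] gf3.subspace_diff[OF A a(2) v] gf3.subspace_diff[OF A a(3) v]
      by (simp_all add: algebra_simps)
    have mem: "(x + y) + (x + z) - (y + z) \<in> A"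
      by (rule gf3.subspace_diff[OF A gf3.subspace_add[OF A xyz(1,2)] xyz(3)])
    have "(x + y) + (x + z) - (y + z) = x + x" by (simp add: algebra_simps)
    then have "(x + y) + (x + z) - (y + z) = - x" unfolding vec_add_self .
    then have "- x \<in> A" using mem by metis
    then show False using no(1) subspace_neg_iff[OF A, of x] by blast
  qed
  show False
  proof (cases "v \<in> A")
    case True
    show False by (rule aux[OF A C _ _ _ _ _ _ True]) (use no B' f in auto)
  next
    case False
    then have "v \<in> C" using f by blast
    show False by (rule aux[OF C A _ _ _ _ _ _ \<open>v \<in> C\<close>]) (use no B' f in auto)
  qed
qed

text \<open>Take \<open>x\<close> outside both subspaces. For \<open>a\<close> in \<open>A\<close>,
  neither \<open>x + a\<close> nor \<open>x - a\<close> lies in \<open>A\<close>, and they are not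
  both in \<open>C\<close> since they add up to \<open>- x\<close>. One of them together with
  \<open>x\<close> therefore yields \<open>a\<close>.\<close>

lemma span_complement_Un:
  assumes U: "gf3.subspace U" and A: "gf3.subspace A" "A \<subset> U" and C: "gf3.subspace C" "C \<subset> U"
  shows "gf3.span (U - (A \<union> C)) = U"
proof
  show "gf3.span (U - (A \<union> C)) \<subseteq> U" using U by (intro gf3.span_minimal) auto
  have "\<exists>x\<in>U. x \<notin> A \<union> C"
  proof (rule ccontr)
    assume "\<not> ?thesis"
    then have cov: "U \<subseteq> A \<union> C" by blast
    obtain a where a: "a \<in> U" "a \<notin> A" using A(2) by blast
    obtain c where c: "c \<in> U" "c \<notin> C" using C(2) by blast
    have "a \<in> C" "c \<in> A" using cov a c by blast+
    moreover have "a + c \<in> A \<union> C" using cov a c gf3.subspace_add[OF U] by blast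
    ultimately show False
      using a c gf3.subspace_diff[OF A(1), of "a + c" c] gf3.subspace_diff[OF C(1), of "a + c" a] by auto
  qed
  then obtain x where x: "x \<in> U" "x \<notin> A" "x \<notin> C" by blast
  have xs: "x \<in> gf3.span (U - (A \<union> C))" using x by (auto intro: gf3.span_base)
  have key: "a \<in> gf3.span (U - (A \<union> C))" if A: "gf3.subspace A" and C: "gf3.subspace C" and a: "a \<in> A" "a \<in> U"
    and x: "x \<in> U" "x \<notin> A" "x \<notin> C" and xs: "x \<in> gf3.span (U - (A \<union> C))" for A C a
  proof -
    have "x + a \<notin> A" using a x gf3.subspace_diff[OF A, of "x + a" a] by auto
    have "x - a \<notin> A" using a x gf3.subspace_add[OF A, of "x - a" a] by auto
    have "x + a \<notin> C \<or> x - a \<notin> C"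
    proof (rule ccontr)
      assume "\<not> ?thesis"
      then have "(x + a) + (x - a) \<in> C" using gf3.subspace_add[OF C] by blast
      moreover have "(x + a) + (x - a) = - x" using vec_add_self[of x] by (simp add: algebra_simps)
      ultimately show False using x subspace_neg_iff[OF C] by simp
    qed
    then show ?thesis
    proof
      assume "x + a \<notin> C"
      then have "x + a \<in> gf3.span (U - (A \<union> C))"
        using \<open>x + a \<notin> A\<close> a x gf3.subspace_add[OF U] by (auto intro: gf3.span_base)
      then have "(x + a) - x \<in> gf3.span (U - (A \<union> C))" using xs by (rule gf3.span_diff)
      then show ?thesis by simp
    next
      assume "x - a \<notin> C"
      then have "x - a \<in> gf3.span (U - (A \<union> C))"
        using \<open>x - a \<notin> A\<close> a x gf3.subspace_diff[OF U] by (auto intro: gf3.span_base)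
      then have "x - (x - a) \<in> gf3.span (U - (A \<union> C))" by (rule gf3.span_diff[OF xs])
      then show ?thesis by simp
    qed
  qed
  show "U \<subseteq> gf3.span (U - (A \<union> C))"
  proof
    fix u assume u: "u \<in> U"
    consider "u \<in> A" | "u \<in> C" | "u \<notin> A \<union> C" by blast
    then show "u \<in> gf3.span (U - (A \<union> C))"
    proof cases
      case 1
      then show ?thesis using key[OF A(1) C(1) _ u x xs] by blast
    next
      case 2
      then show ?thesis using key[OF C(1) A(1) _ u x(1,3,2)] xs by (simp add: Un_commute)
    next
      case 3
      then show ?thesis using u by (auto intro: gf3.span_base)
    qed
  qed
qed

text \<open>A split of the represented colour is visible in the matroid. A split of the other colour
  is not, but then \<open>X\<close> contains everything off two proper subspaces, hence a spanning
  circuit, and this makes the two representations equivalent on the relevant elements.\<close>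

lemma good_transfer:
  assumes X: "represents M \<sigma> X" and S: "represents M \<rho> S" and U: "gf3.subspace U" "finite U" "card U \<ge> 9"
    and good: "\<And>U0. gf3.subspace U0 \<Longrightarrow> U0 \<subseteq> gf3.span X \<Longrightarrow> card U0 \<ge> 9 \<Longrightarrow> split X U0 \<or> split (U0 - {0} - X) U0"
  shows "split S U \<or> split (U - {0} - S) U"
proof (cases "gf3.span (S \<inter> U) = U")
  case False
  then show ?thesis using nonspanning_split[OF U] by blast
next
  case span: True
  define E where "E = {e \<in> ground M. \<rho> e \<in> U}"
  have EM: "E \<subseteq> ground M" by (auto simp: E_def)
  have fE: "finite E" using EM representsD(1)[OF X] by (rule finite_subset)
  have SU: "v \<in> S \<inter> U \<Longrightarrow> \<exists>e\<in>E. v = \<rho> e \<or> v = - \<rho> e" for v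
    using representsD(10)[OF S, of v] subspace_neg_iff[OF U(1)] by (auto simp: E_def)
  have spE: "gf3.span (\<rho> ` E) = U"
  proof
    show "gf3.span (\<rho> ` E) \<subseteq> U" using U(1) by (intro gf3.span_minimal) (auto simp: E_def)
    have "S \<inter> U \<subseteq> gf3.span (\<rho> ` E)" using SU by (metis gf3.span_base gf3.span_neg imageI subsetI)
    then have "gf3.span (S \<inter> U) \<subseteq> gf3.span (\<rho> ` E)" by (intro gf3.span_minimal) auto
    then show "U \<subseteq> gf3.span (\<rho> ` E)" using span by simp
  qed
  define U0 where "U0 = gf3.span (\<sigma> ` E)"
  have U0: "gf3.subspace U0" "finite U0" "card U0 = card U"
    using finite_span_gf3[of "\<sigma> ` E"] fE span_transfer(2)[OF X S EM] spE by (auto simp: U0_def)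
  have U0X: "U0 \<subseteq> gf3.span X"
    unfolding U0_def using representsD(6)[OF X] EM by (intro gf3.span_mono) auto
  have memU0: "\<sigma> e \<in> U0 \<longleftrightarrow> e \<in> E" if "e \<in> ground M" for e
    using span_transfer(1)[OF X S EM that] spE that by (auto simp: U0_def E_def)
  consider "split X U0" | "split (U0 - {0} - X) U0" using good[OF U0(1) U0X] U0(3) U(3) by auto
  then show ?thesis
  proof cases
    \<comment> \<open>Bases of the two sides are together independent in the matroid, so in the
      other representation the sides again span proper subspaces that meet trivially.\<close>
    case 1
    then obtain A B where AB: "gf3.subspace A" "gf3.subspace B" "A \<subset> U0" "B \<subset> U0" "A \<inter> B = {0}" "X \<inter> U0 \<subseteq> A \<union> B"
      unfolding split_def by blast
    define IA where "IA = {e \<in> E. \<sigma> e \<in> A}"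
    define IB where "IB = {e \<in> E. \<sigma> e \<in> B}"
    have I: "IA \<subseteq> ground M" "IB \<subseteq> ground M" using EM by (auto simp: IA_def IB_def)
    obtain JA where JA: "JA \<subseteq> IA" "JA \<in> indep M" "gf3.span (\<sigma> ` JA) = gf3.span (\<sigma> ` IA)" "gf3.span (\<rho> ` JA) = gf3.span (\<rho> ` IA)"
      by (rule common_basis[OF X S I(1)])
    obtain JB where JB: "JB \<subseteq> IB" "JB \<in> indep M" "gf3.span (\<sigma> ` JB) = gf3.span (\<sigma> ` IB)" "gf3.span (\<rho> ` JB) = gf3.span (\<rho> ` IB)"
      by (rule common_basis[OF X S I(2)])
    have spA: "gf3.span (\<sigma> ` IA) \<subseteq> A" "gf3.span (\<sigma> ` IB) \<subseteq> B"
      using AB(1,2) by - (rule gf3.span_minimal; auto simp: IA_def IB_def)+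
    have meet: "gf3.span (\<sigma> ` JA) \<inter> gf3.span (\<sigma> ` JB) = {0}"
      using spA AB(5) JA(3) JB(3) gf3.span_zero by blast
    have fJ: "finite JA" "finite JB" using JA(1) JB(1) fE by (auto simp: IA_def IB_def intro: finite_subset)
    have indJ: "gf3.independent (\<sigma> ` JA)" "gf3.independent (\<sigma> ` JB)"
      using JA(2) JB(2) representsD(2)[OF X] by auto
    have "gf3.independent (\<sigma> ` (JA \<union> JB))"
      unfolding image_Un by (rule independent_Un) (use fJ indJ meet in auto)
    moreover have JM: "JA \<union> JB \<subseteq> ground M" using JA(1) JB(1) I by blast
    ultimately have "JA \<union> JB \<in> indep M" using representsD(2)[OF X] by blast
    then have "gf3.independent (\<rho> ` JA \<union> \<rho> ` JB)" using representsD(2)[OF S] by (simp add: image_Un)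
    moreover have "\<rho> ` JA \<inter> \<rho> ` JB = {}"
    proof -
      have False if "a \<in> JA" "a \<in> JB" for a
      proof -
        have "\<sigma> a \<in> A \<inter> B" using that JA(1) JB(1) by (auto simp: IA_def IB_def)
        then show False using AB(5) representsD(3)[OF X, of a] that JM by blast
      qed
      then show ?thesis using representsD(4)[OF S] JM unfolding inj_on_def by blast
    qed
    ultimately have meet': "gf3.span (\<rho> ` IA) \<inter> gf3.span (\<rho> ` IB) = {0}"
      using span_Int_independent JA(4) JB(4) by metis
    have proper: "gf3.span (\<rho> ` F) \<subset> U" if F: "F \<subseteq> E" "gf3.span (\<sigma> ` F) \<subseteq> D" "D \<subset> U0" for F D
    proof -
      have "gf3.span (\<rho> ` F) \<subseteq> gf3.span (\<rho> ` E)" using F(1) by (intro gf3.span_mono) auto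
      then have "gf3.span (\<rho> ` F) \<subseteq> U" using spE by simp
      moreover have "card (gf3.span (\<sigma> ` F)) < card U0" using F(2,3) U0(2) by (intro psubset_card_mono) auto
      then have "card (gf3.span (\<rho> ` F)) < card U" using span_transfer(2)[OF X S, of F] F(1) EM U0(3) by auto
      ultimately show ?thesis by auto
    qed
    have "split S U"
    proof (rule splitI[OF gf3.subspace_span gf3.subspace_span proper[OF _ spA(1) AB(3)] proper[OF _ spA(2) AB(4)] meet'])
      show "IA \<subseteq> E" "IB \<subseteq> E" by (auto simp: IA_def IB_def)
      show "S \<inter> U \<subseteq> gf3.span (\<rho> ` IA) \<union> gf3.span (\<rho> ` IB)"
      proof
        fix v assume "v \<in> S \<inter> U"
        then obtain e where e: "e \<in> E" "v = \<rho> e \<or> v = - \<rho> e" using SU by blast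
        then have eM: "e \<in> ground M" using EM by blast
        have "\<sigma> e \<in> X \<inter> U0" using memU0[OF eM] representsD(6)[OF X eM] e(1) by blast
        then have "e \<in> IA \<or> e \<in> IB" using AB(6) e(1) by (auto simp: IA_def IB_def)
        then have "\<rho> e \<in> gf3.span (\<rho> ` IA) \<or> \<rho> e \<in> gf3.span (\<rho> ` IB)" by (auto intro: gf3.span_base)
        then show "v \<in> gf3.span (\<rho> ` IA) \<union> gf3.span (\<rho> ` IB)" using e(2) gf3.span_neg by blast
      qed
    qed
    then show ?thesis by blast
  next
    case 2
    then obtain A C where AC: "gf3.subspace A" "gf3.subspace C" "A \<subset> U0" "C \<subset> U0" "A \<inter> C = {0}"
      "(U0 - {0} - X) \<inter> U0 \<subseteq> A \<union> C" unfolding split_def by blast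
    have inX: "x \<in> X" if "x \<in> U0" "x \<notin> A \<union> C" for x
      using that AC(6) gf3.subspace_0[OF AC(1)] by blast
    define F where "F = {e \<in> E. \<sigma> e \<notin> A \<union> C}"
    have FM: "F \<subseteq> ground M" using EM by (auto simp: F_def)
    have spF: "gf3.span (\<sigma> ` F) = U0"
    proof -
      have "U0 - (A \<union> C) \<subseteq> gf3.span (\<sigma> ` F)"
      proof
        fix x assume x: "x \<in> U0 - (A \<union> C)"
        then obtain e where e: "e \<in> ground M" "x = \<sigma> e \<or> x = - \<sigma> e"
          using inX representsD(10)[OF X] by blast
        then have "\<sigma> e \<in> U0" "\<sigma> e \<notin> A \<union> C"
          using x subspace_neg_iff[OF U0(1)] subspace_neg_iff[OF AC(1)] subspace_neg_iff[OF AC(2)] by auto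
        then have "e \<in> F" using memU0[OF e(1)] by (simp add: F_def)
        then show "x \<in> gf3.span (\<sigma> ` F)" using e(2) by (auto intro: gf3.span_base gf3.span_neg)
      qed
      then have "gf3.span (U0 - (A \<union> C)) \<subseteq> gf3.span (\<sigma> ` F)" by (intro gf3.span_minimal) auto
      moreover have "gf3.span (\<sigma> ` F) \<subseteq> U0" unfolding U0_def by (intro gf3.span_mono) (auto simp: F_def)
      ultimately show ?thesis using span_complement_Un[OF U0(1) AC(1,3,2,4)] by blast
    qed
    obtain J where J: "J \<subseteq> F" "J \<in> indep M" "gf3.span (\<sigma> ` J) = gf3.span (\<sigma> ` F)"
      "gf3.span (\<rho> ` J) = gf3.span (\<rho> ` F)"
      by (rule common_basis[OF X S FM])
    have JM: "J \<subseteq> ground M" using J(1) FM by blast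
    have fJ: "finite J" using JM representsD(1)[OF X] by (rule finite_subset)
    have spJ: "gf3.span (\<sigma> ` J) = U0" using J(3) spF by simp
    have spJ': "gf3.span (\<rho> ` J) = U"
    proof -
      have "gf3.span (\<rho> ` J) \<subseteq> gf3.span (\<rho> ` E)" using J(1) by (intro gf3.span_mono) (auto simp: F_def)
      then have "gf3.span (\<rho> ` J) \<subseteq> U" using spE by simp
      moreover have "card (gf3.span (\<rho> ` J)) = card U" using span_transfer(2)[OF X S JM] spJ U0(3) by simp
      ultimately show ?thesis using card_subset_eq[OF U(2)] by blast
    qed
    have ind: "gf3.independent (\<sigma> ` J)" "gf3.independent (\<rho> ` J)"
      using J(2) representsD(2)[OF X] representsD(2)[OF S] by auto
    have injJ: "inj_on \<sigma> J" "inj_on \<rho> J"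
      using inj_on_subset[OF representsD(4)[OF X] JM] inj_on_subset[OF representsD(4)[OF S] JM] .
    have cJ: "card U = 3 ^ card J"
      using card_span_independent[OF _ ind(1)] fJ spJ injJ(1) U0(3) by (simp add: card_image)
    show ?thesis
    \<comment> \<open>The circuit needs three basis vectors. With fewer, \<open>U\<close> is a line,
      where \<open>plane_good\<close> applies.\<close>
    proof (cases "card J \<ge> 3")
      case False
      then have "card U \<le> 3 ^ 2" unfolding cJ by (intro power_increasing) auto
      then have "card U = 9" using U(3) by simp
      then show ?thesis using plane_good[OF U(1,2)] representsD(7,9)[OF S] by blast
    next
      case True
      have fB: "finite (\<sigma> ` J)" "card (\<sigma> ` J) \<ge> 3" using fJ True injJ(1) by (simp_all add: card_image)
      have disj: "\<sigma> ` J \<inter> (A \<union> C) = {}" using J(1) by (auto simp: F_def)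
      obtain s where s: "\<And>b. b \<in> \<sigma> ` J \<Longrightarrow> s b = 1 \<or> s b = -1" "(\<Sum>b\<in>\<sigma> ` J. gf3_scale (s b) b) \<notin> A \<union> C"
        using full_support_sum[OF ind(1) fB AC(1,2) disj] by blast
      define x where "x = (\<Sum>j\<in>J. gf3_scale (s (\<sigma> j)) (\<sigma> j))"
      have xAC: "x \<notin> A \<union> C" using s(2) injJ(1) by (simp add: x_def sum.reindex)
      have "x \<in> gf3.span (\<sigma> ` J)" unfolding x_def by (intro gf3.span_sum gf3.span_scale gf3.span_base) auto
      then have xU0: "x \<in> U0" using spJ by simp
      obtain e0 where e0: "e0 \<in> ground M" "x = \<sigma> e0 \<or> x = - \<sigma> e0"
        \<comment> \<open>As \<open>x\<close> avoids \<open>A\<close> and \<open>C\<close>, it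
          belongs to \<open>X\<close>, so some element \<open>e0\<close> represents it and completes
          \<open>J\<close> to a circuit.\<close>
        using representsD(10)[OF X inX[OF xU0 xAC]] by blast
      have s': "s (\<sigma> j) = 1 \<or> s (\<sigma> j) = -1" if "j \<in> J" for j using s(1) that by blast
      have rx: "gf3.representation (\<sigma> ` J) x (\<sigma> j) \<noteq> 0" if "j \<in> J" for j
      proof -
        have "gf3.representation (\<sigma> ` J) x (\<sigma> j)
            = (\<Sum>i\<in>J. gf3.representation (\<sigma> ` J) (gf3_scale (s (\<sigma> i)) (\<sigma> i)) (\<sigma> j))"
          unfolding x_def by (subst gf3.representation_sum[OF ind(1)]) (auto intro: gf3.span_scale gf3.span_base)
        also have "\<dots> = (\<Sum>i\<in>J. if i = j then s (\<sigma> j) else 0)"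
        proof (rule sum.cong)
          fix i assume i: "i \<in> J"
          have "gf3.representation (\<sigma> ` J) (gf3_scale (s (\<sigma> i)) (\<sigma> i)) (\<sigma> j)
              = s (\<sigma> i) * gf3.representation (\<sigma> ` J) (\<sigma> i) (\<sigma> j)"
            using i by (subst gf3.representation_scale[OF ind(1)]) (auto intro: gf3.span_base)
          also have "\<dots> = (if i = j then s (\<sigma> j) else 0)"
            using gf3.representation_basis[OF ind(1), of "\<sigma> i"] i that injJ(1) by (auto dest: inj_onD)
          finally show "gf3.representation (\<sigma> ` J) (gf3_scale (s (\<sigma> i)) (\<sigma> i)) (\<sigma> j) = (if i = j then s (\<sigma> j) else 0)" .
        qed simp
        also have "\<dots> = s (\<sigma> j)" using that fJ by simp
        finally show ?thesis using s'[OF that] by auto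
      qed
      have e0n: "\<sigma> e0 \<notin> gf3.span (\<sigma> ` (J - {j}))" if "j \<in> J" for j
      proof -
        have im: "\<sigma> ` (J - {j}) = \<sigma> ` J - {\<sigma> j}" using injJ that by (auto dest: inj_onD)
        have "x \<notin> gf3.span (\<sigma> ` J - {\<sigma> j})"
          using coordinate_zero_iff[OF ind(1) fB(1), of x "\<sigma> j"] rx[OF that] xU0 spJ that by auto
        then show ?thesis unfolding im using e0(2) gf3.span_neg by blast
      qed
      have \<rho>e0: "\<rho> e0 \<in> gf3.span (\<rho> ` J)"
      proof -
        have "\<sigma> e0 \<in> gf3.span (\<sigma> ` J)" using e0(2) xU0 spJ subspace_neg_iff[OF U0(1)] by auto
        then show ?thesis using span_transfer(1)[OF X S JM e0(1)] by blast
      qed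
      define d where "d j = gf3.representation (\<rho> ` J) (\<rho> e0) (\<rho> j)" for j
      have d: "d j = 1 \<or> d j = -1" if "j \<in> J" for j
      proof -
        have im: "\<rho> ` (J - {j}) = \<rho> ` J - {\<rho> j}" using injJ that by (auto dest: inj_onD)
        have "J - {j} \<subseteq> ground M" using JM by blast
        then have "\<rho> e0 \<notin> gf3.span (\<rho> ` J - {\<rho> j})"
          using span_transfer(1)[OF X S _ e0(1), of "J - {j}"] e0n[OF that] unfolding im by blast
        then have "d j \<noteq> 0"
          using coordinate_zero_iff[OF ind(2) _ \<rho>e0, of "\<rho> j"] fJ that by (simp add: d_def)
        then show ?thesis by (cases "d j" rule: gf3_cases) auto
      qed
      have \<rho>sum: "\<rho> e0 = (\<Sum>j\<in>J. gf3_scale (d j) (\<rho> j))"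
        using gf3.sum_representation_eq[OF ind(2) \<rho>e0 _ order_refl] fJ injJ by (simp add: d_def sum.reindex)
      have e0J: "e0 \<notin> J"
      proof
        assume "e0 \<in> J"
        obtain j where j: "j \<in> J" "j \<noteq> e0" using True fJ
          by (metis card_le_Suc0_iff_eq not_less_eq_eq numeral_3_eq_3 Suc_leD \<open>e0 \<in> J\<close>)
        then have "\<sigma> e0 \<in> gf3.span (\<sigma> ` (J - {j}))" using \<open>e0 \<in> J\<close> by (auto intro: gf3.span_base)
        then show False using e0n[OF j(1)] by blast
      qed
      \<comment> \<open>Signs are adjusted in both representations so that \<open>e0\<close> becomes
        the plain sum of the elements of \<open>J\<close>.\<close>
      define \<sigma>' where "\<sigma>' e = (if e \<in> J then gf3_scale (s (\<sigma> e)) (\<sigma> e) else if e = e0 then x else \<sigma> e)" for e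
      define \<rho>' where "\<rho>' e = (if e \<in> J then gf3_scale (d e) (\<rho> e) else \<rho> e)" for e
      have pm\<sigma>: "\<sigma>' e = \<sigma> e \<or> \<sigma>' e = - \<sigma> e" for e using s'[of e] e0(2) by (auto simp: \<sigma>'_def)
      have pm\<rho>: "\<rho>' e = \<rho> e \<or> \<rho>' e = - \<rho> e" for e using d[of e] by (auto simp: \<rho>'_def)
      have X': "represents M \<sigma>' X" using represents_signs[OF X pm\<sigma>] .
      have S': "represents M \<rho>' S" using represents_signs[OF S pm\<rho>] .
      have e0': "\<sigma>' e0 = (\<Sum>j\<in>J. \<sigma>' j)" "\<rho>' e0 = (\<Sum>j\<in>J. \<rho>' j)"
        using e0J \<rho>sum by (simp_all add: \<sigma>'_def \<rho>'_def x_def)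
      have ind': "gf3.independent (\<sigma>' ` J)" "gf3.independent (\<rho>' ` J)"
        using J(2) representsD(2)[OF X'] representsD(2)[OF S'] by auto
      have inj': "inj_on \<sigma>' J" "inj_on \<rho>' J"
        using inj_on_subset[OF representsD(4)[OF X'] JM] inj_on_subset[OF representsD(4)[OF S'] JM] .
      have spsub: "gf3.span (f ` J) \<subseteq> gf3.span (g ` J)" if "\<And>e. f e = g e \<or> f e = - g e" for f g :: "'a \<Rightarrow> gf3_vec"
        using that by (intro gf3.span_minimal) (auto, metis gf3.span_base gf3.span_neg imageI)
      have sp': "gf3.span (\<sigma>' ` J) = U0" "gf3.span (\<rho>' ` J) = U"
        using spsub[of \<sigma>' \<sigma>] spsub[of \<sigma> \<sigma>'] spsub[of \<rho>' \<rho>] spsub[of \<rho> \<rho>'] pm\<sigma> pm\<rho> spJ spJ' by (metis minus_minus subset_antisym)+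
      obtain L where L: "linear3 L" "\<forall>v\<in>\<sigma>' ` J. L v = \<rho>' (the_inv_into J \<sigma>' v)"
        using gf3p.linear_independent_extend[OF ind'(1), of "\<lambda>v. \<rho>' (the_inv_into J \<sigma>' v)"] by blast
      have L\<sigma>: "L (\<sigma>' j) = \<rho>' j" if "j \<in> J" for j
        using L(2) that inj'(1) by (simp add: the_inv_into_f_f)
      have LJ: "L ` \<sigma>' ` J = \<rho>' ` J" using L\<sigma> by (force simp: image_image)
      have LU: "L ` U0 = U" using gf3p.linear_span_image[OF L(1), of "\<sigma>' ` J"] LJ sp' by simp
      have Linj: "inj_on L U0" using LU U0 U(2) by (simp add: eq_card_imp_inj_on)
      have LA: "gf3.subspace (L ` A)" "gf3.subspace (L ` C)"
        using gf3p.linear_subspace_image[OF L(1)] AC(1,2) by blast+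
      have Lprop: "L ` D \<subset> U" if "D \<subset> U0" for D
      proof -
        have "L ` D \<subseteq> U" using LU that by blast
        moreover have "L ` D \<noteq> L ` U0" using inj_on_image_eq_iff[OF Linj, of D U0] that by blast
        ultimately show ?thesis using LU by blast
      qed
      have "split (U - {0} - S) U"
      proof (rule splitI[OF LA Lprop[OF AC(3)] Lprop[OF AC(4)]])
        have "L ` A \<inter> L ` C = L ` (A \<inter> C)"
          using inj_on_image_Int[OF Linj, of A C] AC(3,4) by blast
        then show "L ` A \<inter> L ` C = {0}" using AC(5) gf3p.linear_0[OF L(1)] by simp
        show "(U - {0} - S) \<inter> U \<subseteq> L ` A \<union> L ` C"
        proof
          fix u assume u: "u \<in> (U - {0} - S) \<inter> U"
          then obtain w where w: "w \<in> U0" "u = L w" using LU by blast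
          \<comment> \<open>Off \<open>A\<close> and \<open>C\<close> every vector of
            \<open>U0\<close> represents an element, which \<open>L\<close> maps to its vector in
            \<open>S\<close> up to sign by \<open>spanning_circuit_unique\<close>. So only vectors
            of \<open>A\<close> and \<open>C\<close> can have images outside
            \<open>S\<close>.\<close>
          have "w \<in> A \<union> C"
          proof (rule ccontr)
            assume "w \<notin> A \<union> C"
            then obtain e where e: "e \<in> ground M" "w = \<sigma>' e \<or> w = - \<sigma>' e"
              using representsD(10)[OF X' inX[OF w(1)]] by blast
            then have "\<sigma>' e \<in> gf3.span (\<sigma>' ` J)" using w(1) sp'(1) subspace_neg_iff[OF U0(1)] by auto
            then have "\<rho>' e = L (\<sigma>' e) \<or> \<rho>' e = - L (\<sigma>' e)"
              using spanning_circuit_unique[OF X' S' J(2) e0(1) e0' L(1) L\<sigma> e(1)] by blast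
            then have "u = \<rho>' e \<or> u = - \<rho>' e" using e(2) w(2) linear3_minus[OF L(1)] by auto
            then have "u \<in> S" using representsD(6)[OF S' e(1)] representsD(7)[OF S'] by blast
            then show False using u by blast
          qed
          then show "u \<in> L ` A \<union> L ` C" using w(2) by blast
        qed
      qed
      then show ?thesis by blast
    qed
  qed
qed

text \<open>For a direct sum, \<open>U\<close> lies in the span of one summand or is split by both
  spans. For a complement, the claim is symmetric in the colours within the embedding where the
  complement is taken, and \<open>good_transfer\<close> carries it to every other one.\<close>

theorem comatroid_good:
  assumes "nat_comatroid N" "reps N S" "gf3.subspace U" "finite U" "card U \<ge> 9"
  shows "split S U \<or> split (U - {0} - S) U"
  using assms
proof (induction arbitrary: S U rule: nat_comatroid.induct)
  case U00
  then have "S = {}" unfolding reps_def represents_def by auto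
  then show ?case using nonspanning_split[OF U00(2,3,4), of S] U00(4) by (cases "U = {0}") auto
next
  case (direct_sum M N)
  have wf: "indep M \<subseteq> Pow (ground M)" "{} \<in> indep M" "indep N \<subseteq> Pow (ground N)" "{} \<in> indep N"
    using nat_comatroid_wf direct_sum.hyps(1,2) by blast+
  obtain S1 S2 where S: "S = S1 \<union> S2" "reps M S1" "reps N S2" "gf3.span S1 \<inter> gf3.span S2 = {0}"
    using direct_sum_reps[OF wf direct_sum.hyps(3) direct_sum.prems(1)] by blast
  have sub: "S1 \<subseteq> gf3.span S1" "S2 \<subseteq> gf3.span S2" by (simp_all add: gf3.span_superset)
  have cong: "split S U \<or> split (U - {0} - S) U"
    if "split S' U \<or> split (U - {0} - S') U" "S \<inter> U = S' \<inter> U" for S'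
  proof -
    have "U - {0} - S = U - {0} - S'" using that(2) by blast
    moreover have "split S U = split S' U" using that(2) split_Int by metis
    ultimately show ?thesis using that(1) by simp
  qed
  have z: "0 \<notin> S1" "0 \<notin> S2" using repsD(2) S(2,3) by blast+
  consider "U \<subseteq> gf3.span S1" | "U \<subseteq> gf3.span S2" | "\<not> U \<subseteq> gf3.span S1" "\<not> U \<subseteq> gf3.span S2" by blast
  then show ?case
  proof cases
    case 1
    then have "S2 \<inter> U \<subseteq> {0}" using S(4) sub by blast
    then have "S \<inter> U = S1 \<inter> U" using S(1) z by blast
    then show ?thesis using cong direct_sum.IH(1)[OF S(2) direct_sum.prems(2-4)] by blast
  next
    case 2
    then have "S1 \<inter> U \<subseteq> {0}" using S(4) sub by blast
    then have "S \<inter> U = S2 \<inter> U" using S(1) z by blast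
    then show ?thesis using cong direct_sum.IH(2)[OF S(3) direct_sum.prems(2-4)] by blast
  next
    case 3
    have "split S U"
    proof (rule splitI[of "gf3.span S1 \<inter> U" "gf3.span S2 \<inter> U"])
      show "gf3.subspace (gf3.span S1 \<inter> U)" "gf3.subspace (gf3.span S2 \<inter> U)"
        using direct_sum.prems(2) by (auto intro: gf3.subspace_inter)
      show "gf3.span S1 \<inter> U \<inter> (gf3.span S2 \<inter> U) = {0}"
        using S(4) gf3.subspace_0[OF direct_sum.prems(2)] by blast
    qed (use 3 S(1) sub in blast)+
    then show ?thesis by blast
  qed
next
  case (complement M t N)
  obtain S0 where S0: "S0 \<subseteq> gf3_space t - {0}" "reps M S0" "reps N (gf3_space t - {0} - S0)"
    using is_complementD[OF complement.hyps(3)] by blast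
  let ?X = "gf3_space t - {0} - S0"
  obtain \<sigma> where \<sigma>: "represents N \<sigma> ?X" using S0(3) unfolding reps_def by blast
  obtain \<rho> where \<rho>: "represents N \<rho> S" using complement.prems(1) unfolding reps_def by blast
  show ?case
  proof (rule good_transfer[OF \<sigma> \<rho> complement.prems(2-4)])
    fix U0 assume U0: "gf3.subspace U0" "U0 \<subseteq> gf3.span ?X" "card U0 \<ge> 9"
    have "gf3.span ?X \<subseteq> gf3_space t" by (rule span_subset_space) blast
    then have sub: "U0 \<subseteq> gf3_space t" using U0(2) by blast
    then have "finite U0" using finite_gf3_space by (rule finite_subset)
    then have "split S0 U0 \<or> split (U0 - {0} - S0) U0" using complement.IH[OF S0(2) U0(1) _ U0(3)] by blast
    moreover have "(U0 - {0} - S0) \<inter> U0 = ?X \<inter> U0" "S0 \<inter> U0 = (U0 - {0} - ?X) \<inter> U0" using sub S0(1) by blast+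
    ultimately show "split ?X U0 \<or> split (U0 - {0} - ?X) U0" using split_Int by metis
  qed
next
  case (isomorphic M N)
  have "isomorphic N M" using isomorphic_sym[OF isomorphic.hyps(2)] nat_comatroid_wf[OF isomorphic.hyps(1)] by blast
  then show ?case using isomorphic.IH reps_iso[OF isomorphic.prems(1)] isomorphic.prems(2-4) by blast
qed

section \<open>Flats and cocircuits\<close>

lemma represents_restriction:
  assumes M: "represents M \<rho> S" and U: "gf3.subspace U"
  shows "represents (restriction M {e \<in> ground M. \<rho> e \<in> U}) \<rho> (S \<inter> U)"
proof -
  let ?F = "{e \<in> ground M. \<rho> e \<in> U}"
  have g: "ground (restriction M ?F) = ?F" by (auto simp: restriction_def)
  have "indep (restriction M ?F) = {I. I \<subseteq> ?F \<and> gf3.independent (\<rho> ` I)}"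
    using representsD(2)[OF M] by (auto simp: restriction_def)
  moreover have "S \<inter> U = \<rho> ` ?F \<union> uminus ` \<rho> ` ?F"
  proof -
    have "v \<in> S \<inter> U \<longleftrightarrow> (\<exists>e\<in>?F. v = \<rho> e \<or> v = - \<rho> e)" for v
      using representsD(6,7,10)[OF M] subspace_neg_iff[OF U] by (auto; metis)
    then show ?thesis by auto
  qed
  moreover have "e = e'" if "e \<in> ?F" "e' \<in> ?F" "\<rho> e = \<rho> e' \<or> \<rho> e = - \<rho> e'" for e e'
    using that representsD(4,5)[OF M] unfolding inj_on_def by blast
  ultimately show ?thesis
    using representsD(1,3)[OF M] unfolding represents_def g by simp
qed

lemma flat_subspace:
  assumes M: "represents M \<rho> S" and U: "gf3.subspace U"
  shows "flat M {e \<in> ground M. \<rho> e \<in> U}"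
proof -
  let ?F = "{e \<in> ground M. \<rho> e \<in> U}"
  have finI: "finite {I \<in> indep M. I \<subseteq> X}" for X
  proof (rule finite_subset)
    show "{I \<in> indep M. I \<subseteq> X} \<subseteq> Pow (ground M)" using representsD(2)[OF M] by blast
  qed (use representsD(1)[OF M] in simp)
  have "rank_of M ?F < rank_of M (insert x ?F)" if x: "x \<in> ground M - ?F" for x
  proof -
    have "{} \<in> {I \<in> indep M. I \<subseteq> ?F}" using representsD(2)[OF M] gf3.independent_empty by simp
    then have "Max (card ` {I \<in> indep M. I \<subseteq> ?F}) \<in> card ` {I \<in> indep M. I \<subseteq> ?F}"
      using finI by (intro Max_in) auto
    then obtain I where I: "I \<in> indep M" "I \<subseteq> ?F" "card I = rank_of M ?F" unfolding rank_of_def by auto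
    have I': "I \<subseteq> ground M" "gf3.independent (\<rho> ` I)" using I representsD(2)[OF M] by auto
    have "gf3.span (\<rho> ` I) \<subseteq> U" using I(2) U by (intro gf3.span_minimal) auto
    then have xs: "\<rho> x \<notin> gf3.span (\<rho> ` I)" using x by auto
    then have "gf3.independent (\<rho> ` insert x I)" using I'(2) gf3.independent_insertI by simp
    then have "insert x I \<in> {K \<in> indep M. K \<subseteq> insert x ?F}" using representsD(2)[OF M, of "insert x I"] I' I x by auto
    then have "card (insert x I) \<le> rank_of M (insert x ?F)"
      unfolding rank_of_def using finI by (intro Max_ge) auto
    moreover have "x \<notin> I" using x I(2) by blast
    moreover have "finite I" using I'(1) representsD(1)[OF M] by (rule finite_subset)
    ultimately show ?thesis using I(3) by simp
  qed
  then show ?thesis unfolding flat_def by auto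
qed

text \<open>The set \<open>D\<close> of elements off \<open>W\<close> is codependent: a basis
  avoiding it would lie in \<open>W\<close> and force all of \<open>S\<close> into \<open>W\<close>.
  A smallest codependent subset is a cocircuit, and six vectors are at most three elements.\<close>

lemma small_cocircuit:
  assumes M: "represents M \<rho> S" and W: "gf3.subspace W" "\<not> S \<subseteq> W" "card (S - W) \<le> 6"
  shows "\<exists>C. cocircuit M C \<and> card C < 4"
proof -
  define D where "D = {e \<in> ground M. \<rho> e \<notin> W}"
  have DM: "D \<subseteq> ground M" by (auto simp: D_def)
  have fD: "finite D" using DM representsD(1)[OF M] by (rule finite_subset)
  have "card D \<le> 3"
  proof -
    have inj: "inj_on \<rho> D" using inj_on_subset[OF representsD(4)[OF M] DM] .
    have "\<rho> ` D \<union> uminus ` \<rho> ` D \<subseteq> S - W"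
      using representsD(6,7)[OF M] subspace_neg_iff[OF W(1)] by (auto simp: D_def)
    moreover have "finite (S - W)" using representsD(8)[OF M] by simp
    ultimately have "card (\<rho> ` D \<union> uminus ` \<rho> ` D) \<le> 6" using W(3) card_mono order_trans by metis
    moreover have "\<rho> ` D \<inter> uminus ` \<rho> ` D = {}"
    proof -
      have False if "d \<in> D" "d' \<in> D" "\<rho> d = - \<rho> d'" for d d'
      proof -
        have "d = d'" using representsD(5)[OF M _ _ that(3)] that(1,2) DM by blast
        then have "\<rho> d = 0" using that(3) by simp
        then show False using representsD(3)[OF M] that(1) DM by blast
      qed
      then show ?thesis by blast
    qed
    moreover have "card (uminus ` \<rho> ` D) = card (\<rho> ` D)" by (simp add: card_image)
    ultimately show ?thesis using fD inj by (simp add: card_Un_disjoint card_image)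
  qed
  have dep: "D \<notin> indep (dual M)"
  proof
    assume "D \<in> indep (dual M)"
    then obtain B where B: "basis M B" "D \<subseteq> ground M - B" by (auto simp: dual_def)
    have BI: "B \<in> indep M" "B \<subseteq> ground M" using B(1) representsD(2)[OF M] by (auto simp: basis_def)
    have "\<rho> ` B \<subseteq> W" using B(2) BI(2) by (auto simp: D_def)
    then have spW: "gf3.span (\<rho> ` B) \<subseteq> W" using W(1) by (simp add: gf3.span_minimal)
    have "\<rho> e \<in> W" if e: "e \<in> ground M" for e
    proof (rule ccontr)
      assume "\<rho> e \<notin> W"
      then have "\<rho> e \<notin> gf3.span (\<rho> ` B)" using spW by blast
      then have "e \<notin> B" "insert e B \<in> indep M" using span_representation_iff[OF M BI(1) e] by auto
      then show False using B(1) by (auto simp: basis_def)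
    qed
    then have "S \<subseteq> W" using representsD(10)[OF M] subspace_neg_iff[OF W(1)] by blast
    then show False using W(2) by blast
  qed
  define P where "P C \<longleftrightarrow> C \<subseteq> D \<and> C \<notin> indep (dual M)" for C
  have "P D" using dep by (simp add: P_def)
  then obtain C where C: "P C" "\<And>C'. P C' \<Longrightarrow> card C \<le> card C'"
    using ex_has_least_nat[of P D card] by blast
  have fC: "finite C" using C(1) fD finite_subset unfolding P_def by blast
  have "circuit (dual M) C"
    unfolding circuit_def
  proof (intro conjI allI impI)
    show "C \<subseteq> ground (dual M)" using C(1) DM by (auto simp: P_def dual_def)
    show "C \<notin> indep (dual M)" using C(1) by (simp add: P_def)
    fix C' assume "C' \<subset> C"
    then have "card C' < card C" using fC by (simp add: psubset_card_mono)
    then have "\<not> P C'" using C(2) by fastforce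
    then show "C' \<in> indep (dual M)" using C(1) \<open>C' \<subset> C\<close> by (auto simp: P_def)
  qed
  moreover have "card C \<le> card D" using C(1) fD by (auto simp: P_def intro: card_mono)
  ultimately show ?thesis using \<open>card D \<le> 3\<close> by (auto simp: cocircuit_def)
qed

lemma many_off_hyperplane:
  assumes rep: "represents N \<tau> S" and no: "\<not> (\<exists>C. cocircuit N C \<and> card C < 4)"
    and S: "\<not> split S (gf3_space r)"
    and W: "gf3.subspace W" "W \<subseteq> gf3_space r" "card (gf3_space r) = 3 * card W"
  shows "6 < card (S - W)"
proof -
  have "\<not> S \<subseteq> W"
  proof
    assume "S \<subseteq> W"
    moreover have "W \<noteq> gf3_space r"
    proof
      assume eq: "W = gf3_space r"
      show False using W(3) unfolding eq by (simp add: card_gf3_space)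
    qed
    moreover have "{0} \<noteq> gf3_space r"
    proof
      assume eq: "{0} = gf3_space r"
      have "card (gf3_space r) = 1" unfolding eq[symmetric] by simp
      then show False using W(3) by simp
    qed
    ultimately have "split S (gf3_space r)"
      using W(1,2) gf3.subspace_0[OF W(1)] gf3.subspace_0[OF subspace_gf3_space]
      by (intro splitI[of W "{0}"]) auto
    then show False using S(1) by blast
  qed
  then show ?thesis using small_cocircuit[OF rep W(1)] no by (meson not_le)
qed

section \<open>The two colours of a minimal non-comatroid\<close>

theorem theorem5p3:
  fixes M :: "'a pre_matroid" and Mc :: "'b pre_matroid"
  assumes "matroid M" and "simple M" and "ternary M"
    and "\<not> ternary_comatroid M"
    and "\<And>F. flat M F \<Longrightarrow> F \<noteq> ground M \<Longrightarrow> ternary_comatroid (restriction M F)"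
    and "rank M \<ge> 4"
    and "is_complement (rank M) M Mc"
  shows "(\<exists>C. cocircuit M C \<and> card C < 4) \<or> (\<exists>C. cocircuit Mc C \<and> card C < 4)"
proof (rule ccontr)
  assume none: "\<not> ?thesis"
  let ?r = "rank M"
  let ?V = "gf3_space ?r"
  obtain R where R: "R \<subseteq> ?V - {0}" "reps M R" "reps Mc (?V - {0} - R)"
    using is_complementD[OF assms(7)] by blast
  let ?G = "?V - {0} - R"
  obtain \<rho> where \<rho>: "represents M \<rho> R" using R(2) unfolding reps_def by blast
  obtain \<sigma> where \<sigma>: "represents Mc \<sigma> ?G" using R(3) unfolding reps_def by blast
  have not_comat: "\<not> comat R" using ternary_comatroid_if_comat[OF _ R(2)] assms(4) by blast
  \<comment> \<open>The ambient dimension is the rank of \<open>M\<close>, so red spans the whole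
    space.\<close>
  have nonspan: "\<not> R \<subseteq> A" if A: "gf3.subspace A" "A \<subset> ?V" for A
  proof
    assume "R \<subseteq> A"
    have fA: "finite A" using A(2) finite_gf3_space finite_subset by blast
    have "3 ^ ?r \<le> card A" using rank_card_le[OF \<rho> A(1) fA \<open>R \<subseteq> A\<close>] .
    moreover have "card A < card ?V" using A(2) by (intro psubset_card_mono) auto
    ultimately show False by (simp add: card_gf3_space)
  qed
  \<comment> \<open>The elements in a proper subspace form a proper flat, so minimality applies to
    them.\<close>
  have flat_comat: "comat (R \<inter> A)" if A: "gf3.subspace A" "A \<subset> ?V" for A
  proof -
    let ?F = "{e \<in> ground M. \<rho> e \<in> A}"
    have "?F \<noteq> ground M"
    proof
      assume "?F = ground M"
      then have "R \<subseteq> A" using representsD(10)[OF \<rho>] subspace_neg_iff[OF A(1)] by blast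
      then show False using nonspan[OF A] by blast
    qed
    then have "ternary_comatroid (restriction M ?F)" using assms(5) flat_subspace[OF \<rho> A(1)] by blast
    then show ?thesis
      using comat_if_ternary_comatroid represents_restriction[OF \<rho> A(1)] unfolding reps_def by blast
  qed
  have span_meet: "gf3.span (S \<inter> A) \<inter> gf3.span (S \<inter> B) = {0}"
    if "gf3.subspace A" "gf3.subspace B" "A \<inter> B = {0}" for A B S
  proof -
    have "gf3.span (S \<inter> A) \<subseteq> A" "gf3.span (S \<inter> B) \<subseteq> B" using that(1,2) by - (rule gf3.span_minimal; simp)+
    then show ?thesis using that(3) gf3.span_zero by blast
  qed
  have nR: "\<not> split R ?V"
  proof
    assume "split R ?V"
    then obtain A B where AB: "gf3.subspace A" "gf3.subspace B" "A \<subset> ?V" "B \<subset> ?V" "A \<inter> B = {0}" "R \<inter> ?V \<subseteq> A \<union> B"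
      unfolding split_def by blast
    have "comat (R \<inter> A \<union> R \<inter> B)"
      using comat_Un[OF flat_comat[OF AB(1,3)] flat_comat[OF AB(2,4)] span_meet[OF AB(1,2,5)]] .
    moreover have "R \<inter> A \<union> R \<inter> B = R" using AB(6) R(1) by blast
    ultimately show False using not_comat by simp
  qed
  have nG: "\<not> split ?G ?V"
  proof
    assume "split ?G ?V"
    then obtain A B where AB: "gf3.subspace A" "gf3.subspace B" "A \<subset> ?V" "B \<subset> ?V" "A \<inter> B = {0}" "?G \<inter> ?V \<subseteq> A \<union> B"
      unfolding split_def by blast
    \<comment> \<open>Green is the complement of red inside \<open>A\<close>, so it is a comatroid
      there as well.\<close>
    have G: "comat (?G \<inter> A)" if A: "gf3.subspace A" "A \<subset> ?V" for A
    proof -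
      have "finite A" using A(2) finite_gf3_space finite_subset by blast
      then have "comat (A - {0} - R \<inter> A)" using comat_complement[OF flat_comat[OF A] _ A(1)] by blast
      moreover have "A - {0} - R \<inter> A = ?G \<inter> A" using A(2) by blast
      ultimately show ?thesis by simp
    qed
    have "comat (?G \<inter> A \<union> ?G \<inter> B)"
      using comat_Un[OF G[OF AB(1,3)] G[OF AB(2,4)] span_meet[OF AB(1,2,5)]] .
    moreover have "?G \<inter> A \<union> ?G \<inter> B = ?G" using AB(6) by blast
    ultimately have "comat ?G" by simp
    \<comment> \<open>Complementing green in the whole space would return red as a
      comatroid.\<close>
    then have "comat (?V - {0} - ?G)" by (rule comat_complement) auto
    moreover have "?V - {0} - ?G = R" using R(1) by blast
    ultimately show False using not_comat by simp
  qed
  have proper: "split R U \<or> split ?G U" if U: "gf3.subspace U" "U \<subset> ?V" "card U \<ge> 9" for U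
  proof -
    have fU: "finite U" using U(2) finite_gf3_space finite_subset by blast
    obtain N where N: "nat_comatroid N" "reps N (R \<inter> U)" using flat_comat[OF U(1,2)] unfolding comat_def by blast
    have "split (R \<inter> U) U \<or> split (U - {0} - R \<inter> U) U" using comatroid_good[OF N U(1) fU U(3)] .
    moreover have "U - {0} - R \<inter> U = ?G \<inter> U" using U(2) by blast
    ultimately show ?thesis by (simp add: split_Int)
  qed
  have "two_coloring ?r R ?G"
  proof
    show "R \<union> ?G = ?V - {0}" using R(1) by blast
    show "- v \<in> R" if "v \<in> R" for v using representsD(7)[OF \<rho> that] .
    show "- v \<in> ?G" if "v \<in> ?G" for v using representsD(7)[OF \<sigma> that] .
    show "6 < card (R - W)" if "gf3.subspace W" "W \<subseteq> ?V" "card ?V = 3 * card W" for W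
      using many_off_hyperplane[OF \<rho> _ nR that] none by blast
    show "6 < card (?G - W)" if "gf3.subspace W" "W \<subseteq> ?V" "card ?V = 3 * card W" for W
      using many_off_hyperplane[OF \<sigma> _ nG that] none by blast
  qed (use proper in auto)
  then show False using two_coloring.impossible[OF _ assms(6) nR nG] by blast
qed

end
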